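(* Let $\lambda\in(0,1)$, $p>2$, let $U'\Subset U\subset\mathbb{R}^2$ be bounded Lipschitz domains, and let $M>0$. There exists a constant $C>0$ independent of $\varepsilon$ such that, for all sufficiently small $\varepsilon>0$ and for every $u\in W^{1,p}(U;\mathbb{R}^2)$ with $$\int_{U'\cap\varepsilon Y_{\mathrm{stiff}}}u\,dx=0\qquad\text{and}\qquad\|u\|_{L^p(U\cap\varepsilon Y_{\mathrm{stiff}};\mathbb{R}^2)}\le M\|u\|_{L^p(U'\cap\varepsilon Y_{\mathrm{stiff}};\mathbb{R}^2)},$$ it holds that $$\|u\|_{L^p(U'\cap\varepsilon Y_{\mathrm{stiff}};\mathbb{R}^2)}\le C\|\nabla u\|_{L^p(U\cap\varepsilon Y_{\mathrm{stiff}};\mathbb{R}^{2\times2})}.$$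
   Context: Domain: non-empty, open, connected set; $U'\Subset U$ means that $U'$ is compactly contained in $U$. $Y_{\mathrm{stiff}}$ denotes the $(0,1]^2$-periodic set $\bigcup_{k\in\mathbb{Z}^2}\big(k+(0,\lambda]^2\cup(\lambda,1]^2\big)$ and $\varepsilon Y_{\mathrm{stiff}}=\{\varepsilon y:y\in Y_{\mathrm{stiff}}\}$. "For all sufficiently small $\varepsilon$" means that there is $\varepsilon_0>0$ (not depending on $u$) such that the assertion holds for all $\varepsilon\in(0,\varepsilon_0)$. *)

theory Defs
  imports "HOL-Analysis.Analysis"
begin

definition bounded_domain :: "'a::euclidean_space set \<Rightarrow> bool" where
  "bounded_domain U \<longleftrightarrow> U \<noteq> {} \<and> open U \<and> connected U \<and> bounded U"

text \<open>Near every boundary point, and up to a rigid motion \<open>x \<mapsto> Q (x - z)\<close>, the set is the strict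
  epigraph of a Lipschitz function.\<close>

definition lipschitz_boundary :: "(real^2) set \<Rightarrow> bool" where
  "lipschitz_boundary U \<longleftrightarrow>
    (\<forall>z \<in> frontier U. \<exists>r>0. \<exists>(Q :: real^2 \<Rightarrow> real^2) \<gamma> L.
       orthogonal_transformation Q \<and> L-lipschitz_on (UNIV::real set) \<gamma> \<and>
       U \<inter> ball z r = {x \<in> ball z r. Q (x - z) $ 2 > \<gamma> (Q (x - z) $ 1)})"

definition bounded_lipschitz_domain :: "(real^2) set \<Rightarrow> bool" where
  "bounded_lipschitz_domain U \<longleftrightarrow> bounded_domain U \<and> lipschitz_boundary U"

definition compactly_contained :: "'a::topological_space set \<Rightarrow> 'a set \<Rightarrow> bool"
    (infix \<open>\<Subset>\<close> 50) where
  "V \<Subset> U \<longleftrightarrow> compact (closure V) \<and> closure V \<subseteq> U"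

definition partial_deriv :: "'n::finite \<Rightarrow> (real^'n \<Rightarrow> real) \<Rightarrow> real^'n \<Rightarrow> real" where
  "partial_deriv j f x = frechet_derivative f (at x) (axis j 1)"

primrec C_k :: "nat \<Rightarrow> (real^'n::finite \<Rightarrow> real) \<Rightarrow> bool" where
  "C_k 0 f \<longleftrightarrow> continuous_on UNIV f"
| "C_k (Suc k) f \<longleftrightarrow> f differentiable_on UNIV \<and> (\<forall>j. C_k k (partial_deriv j f))"

definition test_function :: "(real^'n::finite) set \<Rightarrow> (real^'n \<Rightarrow> real) \<Rightarrow> bool" where
  "test_function U \<phi> \<longleftrightarrow> (\<forall>k. C_k k \<phi>) \<and> {x. \<phi> x \<noteq> 0} \<Subset> U"

text \<open>Functions on a set \<open>E\<close> are represented by total functions whose values outside \<open>E\<close> are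
  irrelevant, and are not identified when they agree almost everywhere.\<close>

definition Lp_space :: "real \<Rightarrow> 'a::euclidean_space set \<Rightarrow> ('a \<Rightarrow> 'b::euclidean_space) set" where
  "Lp_space p E = {f. set_borel_measurable lebesgue E f \<and>
                      set_integrable lebesgue E (\<lambda>x. norm (f x) powr p)}"

text \<open>For \<open>f \<in> Lp_space p E\<close>. On \<open>real^2^2\<close>, \<^const>\<open>norm\<close> is the Frobenius norm.\<close>

definition Lp_norm :: "real \<Rightarrow> 'a::euclidean_space set \<Rightarrow> ('a \<Rightarrow> 'b::euclidean_space) \<Rightarrow> real" where
  "Lp_norm p E f = (LINT x:E|lebesgue. norm (f x) powr p) powr (1 / p)"

definition locally_integrable :: "'a::euclidean_space set \<Rightarrow> ('a \<Rightarrow> 'b::euclidean_space) \<Rightarrow> bool" where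
  "locally_integrable U f \<longleftrightarrow> (\<forall>K. compact K \<and> K \<subseteq> U \<longrightarrow> set_integrable lebesgue K f)"

text \<open>The entry \<open>G x $ i $ j\<close> is the weak \<open>j\<close>-th partial derivative of the component \<open>u $ i\<close>.
  A weak gradient is determined by \<open>U\<close> and \<open>u\<close> up to null sets of \<open>U\<close>.\<close>

definition has_weak_gradient ::
    "(real^'n::finite) set \<Rightarrow> (real^'n \<Rightarrow> real^'m::finite) \<Rightarrow> (real^'n \<Rightarrow> real^'n^'m) \<Rightarrow> bool" where
  "has_weak_gradient U u G \<longleftrightarrow>
     locally_integrable U u \<and> locally_integrable U G \<and>
     (\<forall>\<phi> i j. test_function U \<phi> \<longrightarrow>
        (LINT x:U|lebesgue. u x $ i * partial_deriv j \<phi> x) =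
        - (LINT x:U|lebesgue. G x $ i $ j * \<phi> x))"

definition W1p :: "real \<Rightarrow> (real^'n::finite) set \<Rightarrow> (real^'n \<Rightarrow> real^'m::finite) set" where
  "W1p p U = {u \<in> Lp_space p U. \<exists>G \<in> Lp_space p U. has_weak_gradient U u G}"

definition half_open_square :: "real \<Rightarrow> real \<Rightarrow> (real^2) set" where
  "half_open_square a b = {y. \<forall>i. a < y $ i \<and> y $ i \<le> b}"

definition Y_stiff :: "real \<Rightarrow> (real^2) set" where
  "Y_stiff lam = (\<Union>k::int^2. (\<lambda>y. (\<chi> i. real_of_int (k $ i)) + y) `
                  (half_open_square 0 lam \<union> half_open_square lam 1))"

definition scaled_Y_stiff :: "real \<Rightarrow> real \<Rightarrow> (real^2) set" where
  "scaled_Y_stiff \<epsilon> lam = (\<lambda>y. \<epsilon> *\<^sub>R y) ` Y_stiff lam"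

end

theory Submission
  imports Defs "HOL-Computational_Algebra.Polynomial"
begin

text \<open>For a \<open>C\<^sup>1\<close> map \<open>v\<close> in the plane and \<open>p > 2\<close>, the gradient controls point values: if \<open>S\<close> is star-shaped
about \<open>c\<close> and lies within distance \<open>d\<close> of \<open>c\<close>, then
\<open>\<integral>\<^sub>S |v - v(c)|\<^sup>p \<le> K d\<^sup>p \<integral>\<^sub>S |Dv|\<^sup>p\<close> (\<open>Lp_increment_le_Lp_gradient\<close>). This is what makes the stiff
set, whose squares meet in single points only, behave like a connected set.

Number the grid lines \<open>k\<close> and \<open>k + \<lambda>\<close> in increasing order. The cell \<open>(m, n)\<close> is stiff precisely
when \<open>m + n\<close> is even, so the stiff set is a checkerboard, and every edge of the grid is a side of a
stiff cell. Applying the point estimate at both ends of an edge bounds the \<open>p\<close>-th power of the jump of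
\<open>v\<close> along the edge by \<open>K \<epsilon>\<^bsup>p-2\<^esup>\<close> times the energy of one stiff cell (\<open>grid_edge_estimate\<close>). On a square of
\<open>N \<times> N\<close> grid points a discrete Poincare inequality costs a factor \<open>N\<^sup>p\<close>
(\<open>discrete_poincare_grid\<close>); each cell has area of order \<open>\<epsilon>\<^sup>2\<close>, and with \<open>N\<close> of order \<open>1/\<epsilon>\<close> the product
\<open>\<epsilon>\<^sup>2 N\<^sup>p \<epsilon>\<^bsup>p-2\<^esup>\<close> stays bounded. So on a small box \<open>v\<close> is close to a constant on the stiff set, with a
constant in the estimate that does not depend on \<open>\<epsilon>\<close> (\<open>stiff_poincare_on_box\<close>).

Two overlapping open sets with this property have it jointly: on the overlap both constants are close
to \<open>v\<close>, and the overlap contains a fixed amount of stiff material for all small \<open>\<epsilon>\<close>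
(\<open>stiff_measure_lower_bound\<close>). As \<open>U\<close> is connected, the property spreads to every compact subset of
\<open>U\<close>, in particular to the closure of \<open>U'\<close> (\<open>stiff_poincare_on_compact\<close>).

A Sobolev map is approximated, for fixed \<open>\<epsilon>\<close>, by its mollifications, which are \<open>C\<^sup>1\<close> and converge
together with their gradients in the \<open>p\<close>-th mean on compact subsets of \<open>U\<close> (\<open>smooth_approximation\<close>).
Weak gradients being unique up to null sets (\<open>weak_gradient_unique\<close>), this applies to the given one.
Finally, a map of mean zero is, up to a factor, at least as close to \<open>0\<close> as to any other constant
(\<open>mean_zero_const_le\<close>), which replaces the constant by \<open>0\<close>.

Inequalities are stated for \<open>p\<close>-th powers of norms with values in the extended nonnegative reals and for
Borel functions, so that Fubini's theorem and monotonicity apply without integrability conditions; the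
passage to the norms of the theorem is made at the very end.\<close>

section \<open>Energies and the point-evaluation estimate\<close>

text \<open>The \<open>p\<close>-th power of the norm of \<open>f\<close> in \<open>L\<^sup>p(E)\<close>, for Borel functions; it is infinite if \<open>f\<close> is not in this
space.\<close>

definition Lp_energy :: "real \<Rightarrow> 'a::euclidean_space set \<Rightarrow> ('a \<Rightarrow> 'b::euclidean_space) \<Rightarrow> ennreal" where
  "Lp_energy p E f = (\<integral>\<^sup>+x\<in>E. ennreal (norm (f x) powr p) \<partial>lborel)"

text \<open>Young's inequality, read as: the graph of \<open>t \<mapsto> t\<^sup>p\<close> lies above its tangent at \<open>s\<close>.\<close>

lemma powr_tangent_le:
  fixes a s p :: real
  assumes "p \<ge> 1" "a \<ge> 0" "s \<ge> 0"
  shows "p * s powr (p - 1) * a \<le> a powr p + (p - 1) * s powr p"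
proof (cases "p = 1")
  case True
  then show ?thesis using assms by (cases "s = 0") auto
next
  case False
  with assms have assms: "p > 1" "a \<ge> 0" "s \<ge> 0" by auto
  have "a * s powr (p - 1) \<le> a powr p / p + (s powr (p - 1)) powr (p / (p - 1)) / (p / (p - 1))"
    using assms by (intro Youngs_inequality) (auto simp: field_simps)
  also have "(s powr (p - 1)) powr (p / (p - 1)) = s powr p"
    using assms by (simp add: powr_powr)
  finally have "p * (a * s powr (p - 1)) \<le> p * (a powr p / p + s powr p / (p / (p - 1)))"
    using assms by (intro mult_left_mono) auto
  also have "\<dots> = a powr p + (p - 1) * s powr p"
    using assms by (simp add: field_simps)
  finally show ?thesis by (simp add: algebra_simps)
qed

text \<open>Jensen's inequality for the finite measure with density \<open>w\<close>: integrate the tangent inequality at the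
weighted mean \<open>I / W\<close> of \<open>f\<close> against \<open>w\<close>. It serves below with a power weight, with a mollifier, with an
indicator function and for finite sums.\<close>

lemma weighted_jensen:
  fixes w f :: "'a \<Rightarrow> real"
  assumes w: "integrable M w" "\<And>x. 0 \<le> w x"
    and f[measurable]: "f \<in> borel_measurable M" and f0: "\<And>x. 0 \<le> f x" and p: "p \<ge> 1"
  shows "ennreal ((\<integral>x. w x * f x \<partial>M) powr p)
    \<le> ennreal ((\<integral>x. w x \<partial>M) powr (p - 1)) * (\<integral>\<^sup>+x. ennreal (w x * f x powr p) \<partial>M)"
proof -
  define W where "W = (\<integral>x. w x \<partial>M)"
  define I where "I = (\<integral>x. w x * f x \<partial>M)"
  have [measurable]: "w \<in> borel_measurable M" using w by auto
  have W0: "W \<ge> 0" unfolding W_def by (simp add: w)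
  have I0: "I \<ge> 0" unfolding I_def by (simp add: w f0)
  show ?thesis
  proof (cases "W = 0 \<or> I = 0")
    case True
    have "I = 0"
    proof (cases "I = 0")
      case False
      then have "AE x in M. w x = 0"
        using True w by (simp add: W_def integral_nonneg_eq_0_iff_AE)
      then have "I = (\<integral>x. 0 \<partial>M)" unfolding I_def by (intro integral_cong_AE) auto
      then show ?thesis by simp
    qed
    then show ?thesis using p by (simp flip: I_def)
  next
    case False
    then have Wp: "W > 0" and Ip: "I > 0" using W0 I0 by auto
    have int: "integrable M (\<lambda>x. w x * f x)"
      using Ip not_integrable_integral_eq unfolding I_def by fastforce
    show ?thesis
    proof (cases "(\<integral>\<^sup>+x. ennreal (w x * f x powr p) \<partial>M) = \<infinity>")
      case True
      then show ?thesis using Wp by (simp add: ennreal_mult_top flip: W_def)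
    next
      case False
      have int2: "integrable M (\<lambda>x. w x * f x powr p)"
        using False by (intro integrableI_nonneg) (auto simp: w f0 less_top)
      define s where "s = I / W"
      have s: "s > 0" using Wp Ip by (simp add: s_def)
      have "(\<integral>x. p * s powr (p - 1) * (w x * f x) \<partial>M)
          \<le> (\<integral>x. w x * f x powr p + (p - 1) * s powr p * w x \<partial>M)"
      proof (rule integral_mono)
        fix x
        show "p * s powr (p - 1) * (w x * f x) \<le> w x * f x powr p + (p - 1) * s powr p * w x"
          using mult_left_mono[OF powr_tangent_le[OF p f0[of x], of s] w(2)[of x]] s
          by (simp add: algebra_simps)
      qed (use int int2 w in auto)
      then have "p * s powr (p - 1) * I \<le> (\<integral>x. w x * f x powr p \<partial>M) + (p - 1) * s powr p * W"
        using int int2 w by (simp add: I_def W_def)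
      moreover have "s powr (p - 1) * I = s powr p * W"
        using s Wp Ip by (simp add: s_def powr_diff)
      ultimately have "p * (s powr p * W) \<le> (\<integral>x. w x * f x powr p \<partial>M) + (p - 1) * s powr p * W"
        by (simp add: mult.assoc)
      then have "s powr p * W \<le> (\<integral>x. w x * f x powr p \<partial>M)"
        by (simp add: algebra_simps)
      then have "W powr (p - 1) * (s powr p * W) \<le> W powr (p - 1) * (\<integral>x. w x * f x powr p \<partial>M)"
        by (intro mult_left_mono) auto
      also have "W powr (p - 1) * (s powr p * W) = I powr p"
        using Wp Ip by (simp add: s_def powr_diff powr_divide)
      finally have "ennreal (I powr p) \<le> ennreal (W powr (p - 1) * (\<integral>x. w x * f x powr p \<partial>M))"
        by (rule ennreal_leI)
      also have "\<dots> = ennreal (W powr (p - 1)) * ennreal (\<integral>x. w x * f x powr p \<partial>M)"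
        by (simp add: ennreal_mult' )
      also have "ennreal (\<integral>x. w x * f x powr p \<partial>M) = (\<integral>\<^sup>+x. ennreal (w x * f x powr p) \<partial>M)"
        using int2 by (intro nn_integral_eq_integral[symmetric]) (auto simp: w f0)
      finally show ?thesis by (simp add: I_def W_def)
    qed
  qed
qed

definition has_C1_gradient :: "(real^'n \<Rightarrow> real^'m) \<Rightarrow> (real^'n \<Rightarrow> real^'n^'m) \<Rightarrow> bool" where
  "has_C1_gradient v D \<longleftrightarrow> continuous_on UNIV D \<and> (\<forall>x. (v has_derivative (\<lambda>h. D x *v h)) (at x))"

lemma has_C1_gradient_continuous:
  "has_C1_gradient v D \<Longrightarrow> continuous_on UNIV v"
  "has_C1_gradient v D \<Longrightarrow> continuous_on UNIV D"
  by (auto simp: has_C1_gradient_def intro!: continuous_at_imp_continuous_on has_derivative_continuous)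

lemma has_C1_gradient_measurable:
  "has_C1_gradient v D \<Longrightarrow> v \<in> borel_measurable borel"
  "has_C1_gradient v D \<Longrightarrow> D \<in> borel_measurable borel"
  by (simp_all add: has_C1_gradient_continuous borel_measurable_continuous_onI)

lemma norm_matrix_vector_mult_le:
  fixes A :: "real^'n^'m"
  shows "norm (A *v h) \<le> norm A * norm h"
proof -
  have "norm (A *v h) = L2_set (\<lambda>i. norm ((A *v h) $ i)) UNIV" by (simp add: norm_vec_def)
  also have "\<dots> \<le> L2_set (\<lambda>i. norm (A $ i) * norm h) UNIV"
    by (intro L2_set_mono) (auto simp: matrix_mult_dot Cauchy_Schwarz_ineq2)
  also have "\<dots> = norm A * norm h" by (simp add: norm_vec_def L2_set_left_distrib[symmetric])
  finally show ?thesis .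
qed

lemma C1_increment_le:
  assumes v: "has_C1_gradient v D"
  shows "norm (v x - v c) \<le> norm (x - c) * (\<integral>t. indicator {0<..1} t * norm (D (c + t *\<^sub>R (x - c))) \<partial>lborel)"
proof -
  let ?g = "\<lambda>t::real. D (c + t *\<^sub>R (x - c))"
  have cD: "continuous_on S D" for S using v by (auto simp: has_C1_gradient_def intro: continuous_on_subset)
  have cg: "continuous_on {0..1} ?g"
    by (intro continuous_on_compose2[OF cD[of UNIV]] continuous_intros) auto
  have cn: "continuous_on {0..1} (\<lambda>t. norm (?g t))" using cg by (intro continuous_intros)
  have "((\<lambda>t. ?g t *v (x - c)) has_integral (v (c + 1 *\<^sub>R (x - c)) - v (c + 0 *\<^sub>R (x - c)))) {0..1}"
  proof (rule fundamental_theorem_of_calculus)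
    fix t :: real
    have "((\<lambda>t. v (c + t *\<^sub>R (x - c))) has_derivative (\<lambda>h. ?g t *v (h *\<^sub>R (x - c)))) (at t within {0..1})"
    proof (rule has_derivative_compose[where f = "\<lambda>t. c + t *\<^sub>R (x - c)" and g = v])
      show "((\<lambda>t. c + t *\<^sub>R (x - c)) has_derivative (\<lambda>h. h *\<^sub>R (x - c))) (at t within {0..1})"
        by (auto intro!: derivative_eq_intros)
      show "(v has_derivative (*v) (?g t)) (at (c + t *\<^sub>R (x - c)))"
        using v by (auto simp: has_C1_gradient_def)
    qed
    then show "((\<lambda>t. v (c + t *\<^sub>R (x - c))) has_vector_derivative ?g t *v (x - c)) (at t within {0..1})"
      by (simp add: has_vector_derivative_def matrix_vector_mult_scaleR)
  qed auto
  then have "norm (v x - v c) = norm (integral {0..1} (\<lambda>t. ?g t *v (x - c)))"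
    and io: "(\<lambda>t. ?g t *v (x - c)) integrable_on {0..1}"
    by (auto simp: integral_unique has_integral_integrable)
  then have "norm (v x - v c) \<le> integral {0..1} (\<lambda>t. norm (?g t) * norm (x - c))"
    using Henstock_Kurzweil_Integration.integral_norm_bound_integral[OF io, of "\<lambda>t. norm (?g t) * norm (x - c)"]
    by (simp add: norm_matrix_vector_mult_le integrable_continuous_real continuous_on_mult_right cn)
  also have "\<dots> = norm (x - c) * integral {0..1} (\<lambda>t. norm (?g t))"
    by (simp add: mult.commute)
  also have "integral {0..1} (\<lambda>t. norm (?g t)) = (LINT t:{0..1}|lborel. norm (?g t))"
    by (intro set_borel_integral_eq_integral(2)[symmetric] borel_integrable_atLeastAtMost')
      (use cn in auto)
  also have "\<dots> = (\<integral>t. indicator {0<..1} t * norm (?g t) \<partial>lborel)"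
  proof -
    have [measurable]: "?g \<in> borel_measurable borel"
      by (intro borel_measurable_continuous_onI continuous_on_compose2[OF cD[of UNIV]] continuous_intros) auto
    have "AE t in lborel. t \<noteq> (0::real)" by (rule AE_lborel_singleton)
    then show ?thesis unfolding set_lebesgue_integral_def
      by (intro integral_cong_AE) (auto simp: indicator_def elim!: eventually_mono)
  qed
  finally show ?thesis .
qed

lemma nn_integral_powr_unit_interval:
  assumes "a > -1"
  shows "(\<integral>\<^sup>+t. ennreal (indicator {0<..1} t * t powr a) \<partial>lborel) = ennreal (1 / (a + 1))"
proof -
  have "((\<lambda>t. t powr a) has_integral (1 / (a + 1))) {0..1}"
    using has_integral_powr_from_0[OF assms, of 1] by simp
  then have "((\<lambda>t. indicator {0..1} t * t powr a) has_integral (1 / (a + 1))) UNIV"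
    by (subst (asm) has_integral_restrict_UNIV[symmetric])
       (auto simp: indicator_def elim!: has_integral_eq[rotated])
  then have "(\<integral>\<^sup>+t. ennreal (indicator {0..1} t * t powr a) \<partial>lborel) = ennreal (1 / (a + 1))"
    by (intro nn_integral_has_integral_lborel) auto
  moreover have "(\<integral>\<^sup>+t. ennreal (indicator {0<..1} t * t powr a) \<partial>lborel) = (\<integral>\<^sup>+t. ennreal (indicator {0..1} t * t powr a) \<partial>lborel)"
    by (intro nn_integral_cong_AE eventually_mono[OF AE_lborel_singleton[of 0]]) (auto simp: indicator_def)
  ultimately show ?thesis by simp
qed

lemma nn_integral_homothety:
  fixes c :: "'a::euclidean_space"
  assumes [measurable]: "f \<in> borel_measurable borel" and t: "t > 0"
  shows "ennreal (t ^ DIM('a)) * (\<integral>\<^sup>+x. f (c + t *\<^sub>R (x - c)) \<partial>lborel) = (\<integral>\<^sup>+x. f x \<partial>lborel)"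
proof -
  have "(\<integral>\<^sup>+x. f x \<partial>lborel) = ennreal (t ^ DIM('a)) * (\<integral>\<^sup>+x. f ((c - t *\<^sub>R c) + t *\<^sub>R x) \<partial>lborel)"
    by (subst lborel_affine[of t "c - t *\<^sub>R c"])
      (use t in \<open>auto simp: nn_integral_density nn_integral_distr nn_integral_cmult\<close>)
  then show ?thesis by (simp add: algebra_simps)
qed

text \<open>With \<open>s = p / (2 (p - 1))\<close> this is \<open>W\<^bsup>p-1\<^esup> V\<close>, where \<open>W = 1 / (1 - s)\<close> and \<open>V = 1 / (p/2 - 1)\<close> are the integrals
over \<open>(0, 1]\<close> of \<open>t\<^bsup>-s\<^esup>\<close> and \<open>t\<^bsup>p/2-2\<^esup>\<close>.\<close>

definition increment_const :: "real \<Rightarrow> real" where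
  "increment_const p = (1 / (1 - p / (2 * (p - 1)))) powr (p - 1) * (1 / (p / 2 - 1))"

text \<open>The bound \<open>|v(x) - v(c)| \<le> d \<integral>\<^sub>0\<^sup>1 |D(c + t(x - c))| dt\<close> is raised to the power \<open>p\<close> by Jensen's inequality
with weight \<open>t\<^bsup>-s\<^esup>\<close>. After exchanging the integrals, the homothety \<open>x \<mapsto> c + t(x - c)\<close> maps \<open>S\<close> into itself
and contributes its Jacobian \<open>t\<^bsup>-2\<^esup>\<close>, which the weight has made integrable. The centre \<open>c\<close> may lie outside
\<open>S\<close>, as some corners of a half-open cell do.\<close>

lemma Lp_increment_le_Lp_gradient:
  fixes p :: real and v :: "real^2 \<Rightarrow> real^'m"
  assumes p: "p > 2" and v: "has_C1_gradient v D" and S[measurable]: "S \<in> sets borel"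
    and star: "\<And>x t. x \<in> S \<Longrightarrow> 0 < t \<Longrightarrow> t \<le> 1 \<Longrightarrow> c + t *\<^sub>R (x - c) \<in> S"
    and d: "0 \<le> d" "\<And>x. x \<in> S \<Longrightarrow> norm (x - c) \<le> d"
  shows "Lp_energy p S (\<lambda>x. v x - v c) \<le> ennreal (increment_const p * d powr p) * Lp_energy p S D"
proof -
  \<comment> \<open>Any \<open>s\<close> with \<open>1 / (p - 1) < s < 1\<close> would do: \<open>s < 1\<close> makes the weight \<open>t\<^bsup>-s\<^esup>\<close> integrable at \<open>0\<close>, and
    \<open>s (p - 1) > 1\<close> compensates the Jacobian \<open>t\<^bsup>-2\<^esup>\<close>. The condition \<open>p > 2\<close> leaves room for such an \<open>s\<close>.\<close>
  define s where "s = p / (2 * (p - 1))"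
  have s: "0 < s" "s < 1" "s * (p - 1) = p / 2" using p by (auto simp: s_def field_simps)
  define W where "W = 1 / (1 - s)"
  have Wpos: "W > 0" using s by (simp add: W_def)
  define w where "w = (\<lambda>t::real. indicator {0<..1} t * t powr (-s) :: real)"
  have w0: "w t \<ge> 0" for t by (simp add: w_def)
  have [measurable]: "w \<in> borel_measurable borel" unfolding w_def by measurable
  have nw: "(\<integral>\<^sup>+t. ennreal (w t) \<partial>lborel) = ennreal W"
    using nn_integral_powr_unit_interval[of "-s"] s by (simp add: w_def W_def)
  have wi: "integrable lborel w"
    by (rule integrableI_nn_integral_finite[where x = W]) (use nw w0 Wpos in auto)
  have wI: "(\<integral>t. w t \<partial>lborel) = W"
    by (rule integral_eq_nn_integral[THEN trans]) (use nw w0 Wpos in auto)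
  note [measurable] = has_C1_gradient_measurable[OF v]
  let ?g = "\<lambda>x t. norm (D (c + t *\<^sub>R (x - c)))"
  let ?k = "\<lambda>x t. ennreal (indicator {0<..1} t * t powr (p / 2) * ?g x t powr p)"
  have pt: "ennreal (norm (v x - v c) powr p) \<le> ennreal (d powr p * W powr (p - 1)) * (\<integral>\<^sup>+t. ?k x t \<partial>lborel)"
    if x: "x \<in> S" for x
  proof -
    let ?I = "\<integral>t. indicator {0<..1} t * ?g x t \<partial>lborel"
    have I0: "?I \<ge> 0" by simp
    have "norm (v x - v c) \<le> norm (x - c) * ?I" by (rule C1_increment_le[OF v])
    also have "\<dots> \<le> d * ?I" using d x I0 by (intro mult_right_mono) auto
    finally have "norm (v x - v c) powr p \<le> (d * ?I) powr p" using p by (intro powr_mono2) auto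
    also have "\<dots> = d powr p * ?I powr p" using I0 d by (simp add: powr_mult)
    finally have "ennreal (norm (v x - v c) powr p) \<le> ennreal (d powr p) * ennreal (?I powr p)"
      by (simp add: ennreal_leI flip: ennreal_mult)
    also have "?I = (\<integral>t. w t * (t powr s * ?g x t) \<partial>lborel)"
      by (intro Bochner_Integration.integral_cong) (auto simp: w_def indicator_def powr_minus)
    also have "ennreal ((\<integral>t. w t * (t powr s * ?g x t) \<partial>lborel) powr p) \<le>
      ennreal ((\<integral>t. w t \<partial>lborel) powr (p - 1)) * (\<integral>\<^sup>+t. ennreal (w t * (t powr s * ?g x t) powr p) \<partial>lborel)"
      using wi w0 p by (intro weighted_jensen) auto
    also have "(\<integral>\<^sup>+t. ennreal (w t * (t powr s * ?g x t) powr p) \<partial>lborel) = (\<integral>\<^sup>+t. ?k x t \<partial>lborel)"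
    proof (rule nn_integral_cong)
      fix t :: real
      have "t powr (-s) * (t powr s) powr p = t powr (p / 2)"
      proof -
        have "- s + s * p = p / 2" using s(3) by (simp add: algebra_simps)
        then show ?thesis by (simp only: powr_powr powr_add[symmetric])
      qed
      then show "ennreal (w t * (t powr s * ?g x t) powr p) = ?k x t"
        by (auto simp: w_def indicator_def powr_mult)
    qed
    finally show ?thesis
      by (simp add: wI ennreal_mult mult.assoc mult_left_mono)
  qed
  have "Lp_energy p S (\<lambda>x. v x - v c)
      \<le> (\<integral>\<^sup>+x. ennreal (d powr p * W powr (p - 1)) * ((\<integral>\<^sup>+t. ?k x t \<partial>lborel) * indicator S x) \<partial>lborel)"
    unfolding Lp_energy_def using pt by (intro nn_integral_mono) (auto simp: indicator_def)
  also have "\<dots> = ennreal (d powr p * W powr (p - 1)) * (\<integral>\<^sup>+x. (\<integral>\<^sup>+t. ?k x t * indicator S x \<partial>lborel) \<partial>lborel)"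
    by (simp add: nn_integral_cmult nn_integral_multc)
  finally have 1: "Lp_energy p S (\<lambda>x. v x - v c)
      \<le> ennreal (d powr p * W powr (p - 1)) * (\<integral>\<^sup>+x. (\<integral>\<^sup>+t. ?k x t * indicator S x \<partial>lborel) \<partial>lborel)" (is "_ \<le> _ * ?J") .
  have "?J = (\<integral>\<^sup>+t. (\<integral>\<^sup>+x. ?k x t * indicator S x \<partial>lborel) \<partial>lborel)"
    by (rule lborel_pair.Fubini') simp
  also have "\<dots> \<le> (\<integral>\<^sup>+t. ennreal (indicator {0<..1} t * t powr (p / 2 - 2)) * Lp_energy p S D \<partial>lborel)"
  proof (rule nn_integral_mono)
    fix t :: real
    show "(\<integral>\<^sup>+x. ?k x t * indicator S x \<partial>lborel) \<le> ennreal (indicator {0<..1} t * t powr (p / 2 - 2)) * Lp_energy p S D"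
    proof (cases "t \<in> {0<..1}")
      case t: True
      let ?h = "\<lambda>x. ennreal (norm (D x) powr p) * indicator S x"
      have "(\<integral>\<^sup>+x. ?k x t * indicator S x \<partial>lborel) \<le> (\<integral>\<^sup>+x. ennreal (t powr (p / 2)) * ?h (c + t *\<^sub>R (x - c)) \<partial>lborel)"
        using t star by (intro nn_integral_mono) (auto simp: indicator_def ennreal_mult)
      also have "\<dots> = ennreal (t powr (p / 2)) * (\<integral>\<^sup>+x. ?h (c + t *\<^sub>R (x - c)) \<partial>lborel)"
        by (intro nn_integral_cmult) simp
      also have "ennreal (t powr (p / 2)) = ennreal (t powr (p / 2 - 2)) * ennreal (t ^ DIM(real^2))"
        using t by (simp add: powr_diff flip: ennreal_mult powr_numeral)
      also have "\<dots> * (\<integral>\<^sup>+x. ?h (c + t *\<^sub>R (x - c)) \<partial>lborel) = ennreal (t powr (p / 2 - 2)) * (\<integral>\<^sup>+x. ?h x \<partial>lborel)"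
        using t by (simp only: mult.assoc, subst nn_integral_homothety) auto
      finally show ?thesis using t by (simp add: Lp_energy_def)
    qed simp
  qed
  also have "\<dots> = ennreal (1 / (p / 2 - 1)) * Lp_energy p S D"
    using nn_integral_powr_unit_interval[of "p / 2 - 2"] p by (simp add: nn_integral_multc)
  finally have "?J \<le> ennreal (1 / (p / 2 - 1)) * Lp_energy p S D" .
  then have "Lp_energy p S (\<lambda>x. v x - v c) \<le>
    ennreal (d powr p * W powr (p - 1)) * (ennreal (1 / (p / 2 - 1)) * Lp_energy p S D)"
    by (intro order_trans[OF 1] mult_left_mono) auto
  also have "\<dots> = ennreal ((d powr p * W powr (p - 1)) * (1 / (p / 2 - 1))) * Lp_energy p S D"
    by (subst ennreal_mult) (use p in \<open>auto simp: mult.assoc\<close>)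
  also have "(d powr p * W powr (p - 1)) * (1 / (p / 2 - 1)) = increment_const p * d powr p"
    by (simp add: increment_const_def W_def s_def)
  finally show ?thesis .
qed

section \<open>A discrete Poincare inequality\<close>

lemma sum_powr_le:
  fixes a :: "nat \<Rightarrow> real"
  assumes a: "\<And>i. a i \<ge> 0" and p: "p \<ge> 1"
  shows "(\<Sum>i<n. a i) powr p \<le> real n powr (p - 1) * (\<Sum>i<n. a i powr p)"
proof -
  have "ennreal ((\<integral>i. 1 * a i \<partial>count_space {..<n}) powr p)
    \<le> ennreal ((\<integral>i. 1 \<partial>count_space {..<n}) powr (p - 1)) * (\<integral>\<^sup>+i. ennreal (1 * a i powr p) \<partial>count_space {..<n})"
    using a p by (intro weighted_jensen) (auto intro: integrable_count_space)
  then have "ennreal ((\<Sum>i<n. a i) powr p) \<le> ennreal (real n powr (p - 1) * (\<Sum>i<n. a i powr p))"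
    by (simp add: lebesgue_integral_count_space_finite nn_integral_count_space_finite sum_ennreal ennreal_mult sum_nonneg)
  then show ?thesis by (simp add: ennreal_le_iff sum_nonneg)
qed

lemma norm_add_powr_le:
  fixes x y :: "'a::real_normed_vector"
  assumes p: "p \<ge> 1"
  shows "norm (x + y) powr p \<le> 2 powr (p - 1) * (norm x powr p + norm y powr p)"
proof -
  have "norm (x + y) powr p \<le> (norm x + norm y) powr p"
    using p by (intro powr_mono2 norm_triangle_ineq) auto
  also have "\<dots> \<le> 2 powr (p - 1) * (norm x powr p + norm y powr p)"
    using sum_powr_le[of "\<lambda>i. if i = 0 then norm x else norm y" p 2] p by (simp add: eval_nat_numeral)
  finally show ?thesis .
qed

lemma norm_diff_powr_le_path:
  fixes w :: "nat \<Rightarrow> 'a::real_normed_vector"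
  assumes p: "p \<ge> 1" and mk: "m \<le> N" "k \<le> N"
  shows "norm (w m - w k) powr p \<le> real N powr (p - 1) * (\<Sum>l<N. norm (w (Suc l) - w l) powr p)"
proof -
  have *: "norm (w m - w k) \<le> (\<Sum>l<N. norm (w (Suc l) - w l))" if "k \<le> m" "m \<le> N" for m k
  proof -
    have "norm (w m - w k) = norm (\<Sum>l\<in>{k..<m}. w (Suc l) - w l)"
      using that by (simp add: sum_Suc_diff')
    also have "\<dots> \<le> (\<Sum>l\<in>{k..<m}. norm (w (Suc l) - w l))" by (rule norm_sum)
    also have "\<dots> \<le> (\<Sum>l<N. norm (w (Suc l) - w l))"
      using that by (intro sum_mono2) auto
    finally show ?thesis .
  qed
  have "norm (w m - w k) \<le> (\<Sum>l<N. norm (w (Suc l) - w l))"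
    using *[of k m] *[of m k] mk by (cases "k \<le> m") (auto simp: norm_minus_commute)
  then have "norm (w m - w k) powr p \<le> (\<Sum>l<N. norm (w (Suc l) - w l)) powr p"
    using p by (intro powr_mono2) auto
  also have "\<dots> \<le> real N powr (p - 1) * (\<Sum>l<N. norm (w (Suc l) - w l) powr p)"
    using p by (intro sum_powr_le) auto
  finally show ?thesis .
qed

text \<open>The constant is the value at the foot of a column \<open>k\<close> whose vertical energy is at most the average
\<open>E / (N + 1)\<close>. Each grid point is joined to this foot by a horizontal path to column \<open>k\<close> followed by a
vertical one. An edge of row \<open>j\<close> is used by the \<open>N + 1\<close> points of that row only; an edge of column \<open>k\<close> may
be used by all points, and this is where the choice of \<open>k\<close> gains a factor \<open>N + 1\<close>.\<close>

lemma discrete_poincare_grid: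
  fixes w :: "nat \<Rightarrow> nat \<Rightarrow> 'a::real_normed_vector"
  assumes p: "p \<ge> 1"
    and H: "(\<Sum>i<N. \<Sum>j\<le>N. norm (w (Suc i) j - w i j) powr p) \<le> E"
    and V: "(\<Sum>i\<le>N. \<Sum>j<N. norm (w i (Suc j) - w i j) powr p) \<le> E"
  shows "\<exists>c. (\<Sum>i\<le>N. \<Sum>j\<le>N. norm (w i j - c) powr p) \<le> 2 powr p * real (Suc N) powr p * E"
proof -
  define h where "h = (\<lambda>j. \<Sum>i<N. norm (w (Suc i) j - w i j) powr p)"
  define v where "v = (\<lambda>i. \<Sum>j<N. norm (w i (Suc j) - w i j) powr p)"
  have sumh: "(\<Sum>j\<le>N. h j) \<le> E" unfolding h_def by (subst sum.swap) (rule H)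
  have E0: "E \<ge> 0" using H by (intro order_trans[OF _ H] sum_nonneg) auto
  have "\<exists>k\<le>N. real (Suc N) * v k \<le> E"
  proof (rule ccontr)
    assume "\<not> ?thesis"
    then have "E < real (Suc N) * v k" if "k \<le> N" for k
      using that by (meson not_le)
    then have "E / real (Suc N) < v k" if "k \<le> N" for k
      using that by (simp add: pos_divide_less_eq mult.commute del: of_nat_Suc)
    then have "(\<Sum>k\<le>N. E / real (Suc N)) < (\<Sum>k\<le>N. v k)" by (intro sum_strict_mono) auto
    then show False using V by (simp add: v_def)
  qed
  then obtain k where k: "k \<le> N" "real (Suc N) * v k \<le> E" by auto
  have "norm (w i j - w k 0) powr p \<le> 2 powr (p - 1) * (real N powr (p - 1) * (h j + v k))"
    if "i \<le> N" "j \<le> N" for i j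
  proof -
    have "norm (w i j - w k 0) powr p = norm ((w i j - w k j) + (w k j - w k 0)) powr p" by simp
    also have "\<dots> \<le> 2 powr (p - 1) * (norm (w i j - w k j) powr p + norm (w k j - w k 0) powr p)"
      by (rule norm_add_powr_le[OF p])
    also have "\<dots> \<le> 2 powr (p - 1) * (real N powr (p - 1) * h j + real N powr (p - 1) * v k)"
      unfolding h_def v_def
      using norm_diff_powr_le_path[OF p that(1) k(1), of "\<lambda>i. w i j"]
        norm_diff_powr_le_path[OF p that(2), of 0 "w k"]
      by (intro mult_left_mono add_mono) auto
    finally show ?thesis by (simp add: algebra_simps)
  qed
  then have "(\<Sum>i\<le>N. \<Sum>j\<le>N. norm (w i j - w k 0) powr p)
      \<le> (\<Sum>i\<le>N. \<Sum>j\<le>N. 2 powr (p - 1) * (real N powr (p - 1) * (h j + v k)))"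
    by (intro sum_mono) auto
  also have "\<dots> = 2 powr (p - 1) * (real N powr (p - 1) * (real (Suc N) * (\<Sum>j\<le>N. h j) + real (Suc N) * (real (Suc N) * v k)))"
    by (simp add: sum_distrib_left[symmetric] sum.distrib distrib_left)
  also have "\<dots> \<le> 2 powr (p - 1) * (real (Suc N) powr (p - 1) * (real (Suc N) * E + real (Suc N) * E))"
    using p sumh k(2) E0
    by (intro mult_left_mono mult_mono add_mono powr_mono2 add_nonneg_nonneg mult_nonneg_nonneg sum_nonneg)
       (auto simp: h_def v_def intro!: sum_nonneg)
  also have "\<dots> = 2 powr p * real (Suc N) powr p * E"
    by (simp add: powr_diff)
  finally show ?thesis by blast
qed

section \<open>Energies over disjoint and overlapping sets\<close>

lemma Lp_energy_eq_emeasure: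
  assumes "f \<in> borel_measurable borel" "E \<in> sets borel"
  shows "Lp_energy p E f = emeasure (density lborel (\<lambda>x. ennreal (norm (f x) powr p))) E"
  using assms by (simp add: Lp_energy_def emeasure_density)

lemma Lp_energy_mono:
  "A \<subseteq> B \<Longrightarrow> Lp_energy p A f \<le> Lp_energy p B f"
  unfolding Lp_energy_def by (intro nn_integral_mono) (auto simp: indicator_def)

lemma Lp_energy_empty [simp]: "Lp_energy p {} f = 0"
  by (simp add: Lp_energy_def)

lemma sum_Lp_energy_le:
  assumes "f \<in> borel_measurable borel" "finite I" "\<And>i. i \<in> I \<Longrightarrow> A i \<in> sets borel" "F \<in> sets borel"
    "disjoint_family_on A I" "\<And>i. i \<in> I \<Longrightarrow> A i \<subseteq> F"
  shows "(\<Sum>i\<in>I. Lp_energy p (A i) f) \<le> Lp_energy p F f"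
proof -
  let ?M = "density lborel (\<lambda>x. ennreal (norm (f x) powr p))"
  have "(\<Sum>i\<in>I. Lp_energy p (A i) f) = (\<Sum>i\<in>I. emeasure ?M (A i))"
    using assms by (intro sum.cong) (auto simp: Lp_energy_eq_emeasure)
  also have "\<dots> = emeasure ?M (\<Union>i\<in>I. A i)"
    using assms by (intro sum_emeasure) auto
  also have "\<dots> \<le> emeasure ?M F" using assms by (intro emeasure_mono) auto
  finally show ?thesis using assms by (simp add: Lp_energy_eq_emeasure)
qed

lemma Lp_energy_le_sum:
  assumes "f \<in> borel_measurable borel" "finite I" "\<And>i. i \<in> I \<Longrightarrow> A i \<in> sets borel" "F \<in> sets borel"
    "F \<subseteq> (\<Union>i\<in>I. A i)"
  shows "Lp_energy p F f \<le> (\<Sum>i\<in>I. Lp_energy p (A i) f)"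
proof -
  let ?M = "density lborel (\<lambda>x. ennreal (norm (f x) powr p))"
  have "Lp_energy p F f \<le> emeasure ?M (\<Union>i\<in>I. A i)"
    using assms by (subst Lp_energy_eq_emeasure) (auto intro!: emeasure_mono)
  also have "\<dots> \<le> (\<Sum>i\<in>I. emeasure ?M (A i))"
    using assms by (intro emeasure_subadditive_finite) auto
  also have "\<dots> = (\<Sum>i\<in>I. Lp_energy p (A i) f)"
    using assms by (intro sum.cong) (auto simp: Lp_energy_eq_emeasure)
  finally show ?thesis .
qed

lemma Lp_energy_const:
  assumes "E \<in> sets borel"
  shows "Lp_energy p E (\<lambda>x. c) = ennreal (norm c powr p) * emeasure lborel E"
  using assms by (simp add: Lp_energy_def nn_integral_cmult_indicator)

lemma Lp_energy_add_le:
  assumes p: "p \<ge> 1" and [measurable]: "f \<in> borel_measurable borel" "g \<in> borel_measurable borel" "E \<in> sets borel"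
  shows "Lp_energy p E (\<lambda>x. f x + g x) \<le> ennreal (2 powr (p - 1)) * (Lp_energy p E f + Lp_energy p E g)"
proof -
  have "Lp_energy p E (\<lambda>x. f x + g x)

        \<le> (\<integral>\<^sup>+x. ennreal (2 powr (p - 1)) * (ennreal (norm (f x) powr p) * indicator E x + ennreal (norm (g x) powr p) * indicator E x) \<partial>lborel)"
    unfolding Lp_energy_def
    using norm_add_powr_le[OF p]
    by (intro nn_integral_mono) (auto simp: indicator_def ennreal_leI simp flip: ennreal_mult ennreal_plus)
  then show ?thesis by (simp add: nn_integral_cmult nn_integral_add Lp_energy_def)
qed

section \<open>The checkerboard grid\<close>

text \<open>The lines \<open>k\<close> and \<open>k + lam\<close> in increasing order: index \<open>2k\<close> is the line \<open>k\<close>, index \<open>2k + 1\<close> the line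
\<open>k + lam\<close>.\<close>

definition grid_coord :: "real \<Rightarrow> int \<Rightarrow> real" where
  "grid_coord lam m = of_int (m div 2) + (if odd m then lam else 0)"

definition grid_point :: "real \<Rightarrow> real \<Rightarrow> int \<Rightarrow> int \<Rightarrow> real^2" where
  "grid_point \<epsilon> lam m n = vector [\<epsilon> * grid_coord lam m, \<epsilon> * grid_coord lam n]"

definition grid_cell :: "real \<Rightarrow> real \<Rightarrow> int \<Rightarrow> int \<Rightarrow> (real^2) set" where
  "grid_cell \<epsilon> lam m n = {y. \<epsilon> * grid_coord lam m < y $ 1 \<and> y $ 1 \<le> \<epsilon> * grid_coord lam (m + 1) \<and>
                             \<epsilon> * grid_coord lam n < y $ 2 \<and> y $ 2 \<le> \<epsilon> * grid_coord lam (n + 1)}"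

context
  fixes lam :: real
  assumes lam: "0 < lam" "lam < 1"
begin

lemma grid_coord_step:
  "grid_coord lam (m + 1) - grid_coord lam m = (if even m then lam else 1 - lam)"
  by (auto simp: grid_coord_def elim!: evenE oddE)

lemma grid_coord_shift: "grid_coord lam (m + 2 * k) = grid_coord lam m + of_int k"
  by (auto simp: grid_coord_def)

lemma grid_coord_mono: "m \<le> n \<Longrightarrow> grid_coord lam m \<le> grid_coord lam n"
proof (induction n rule: int_ge_induct)
  case (step i)
  then show ?case using grid_coord_step[of i] lam by (auto split: if_splits)
qed simp

lemma grid_coord_ex: "\<exists>m. grid_coord lam m < t \<and> t \<le> grid_coord lam (m + 1)"
proof -
  define k where "k = \<lceil>t\<rceil> - 1"
  have k: "of_int k < t" "t \<le> of_int k + 1" unfolding k_def by linarith+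
  show ?thesis
  proof (cases "t \<le> of_int k + lam")
    case True
    then show ?thesis using k by (intro exI[of _ "2 * k"]) (auto simp: grid_coord_def)
  next
    case False
    then show ?thesis using k by (intro exI[of _ "2 * k + 1"]) (auto simp: grid_coord_def)
  qed
qed

lemma scaled_grid_coord_ex:
  assumes "\<epsilon> > 0"
  shows "\<exists>m. \<epsilon> * grid_coord lam m < t \<and> t \<le> \<epsilon> * grid_coord lam (m + 1)"
  using grid_coord_ex[of "t / \<epsilon>"] assms by (auto simp: field_simps)

lemma grid_coord_unique:
  assumes e: "\<epsilon> > 0" and "\<epsilon> * grid_coord lam m < t" "t \<le> \<epsilon> * grid_coord lam (m + 1)"
    "\<epsilon> * grid_coord lam n < t" "t \<le> \<epsilon> * grid_coord lam (n + 1)"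
  shows "m = n"
proof (rule ccontr)
  assume "m \<noteq> n"
  then have "m + 1 \<le> n \<or> n + 1 \<le> m" by auto
  then have "grid_coord lam (m + 1) \<le> grid_coord lam n \<or> grid_coord lam (n + 1) \<le> grid_coord lam m"
    using grid_coord_mono by blast
  then have "\<epsilon> * grid_coord lam (m + 1) \<le> \<epsilon> * grid_coord lam n \<or> \<epsilon> * grid_coord lam (n + 1) \<le> \<epsilon> * grid_coord lam m"
    using e by (auto intro: mult_left_mono)
  then show False using assms by linarith
qed

lemma grid_cell_disjoint:
  assumes "\<epsilon> > 0" "x \<in> grid_cell \<epsilon> lam m n" "x \<in> grid_cell \<epsilon> lam m' n'"
  shows "m = m' \<and> n = n'"
  using assms grid_coord_unique[OF assms(1)] unfolding grid_cell_def by blast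

text \<open>In the period cell at \<open>k\<close> the small square has indices \<open>(2k\<^sub>1, 2k\<^sub>2)\<close> and the large one
\<open>(2k\<^sub>1 + 1, 2k\<^sub>2 + 1)\<close>; these are the two ways for \<open>m + n\<close> to be even.\<close>

lemma Y_stiff_eq_Union_cells: "Y_stiff lam = (\<Union>(m, n)\<in>{(m, n). even (m + n)}. grid_cell 1 lam m n)"
proof (intro set_eqI iffI)
  fix y assume "y \<in> Y_stiff lam"
  then obtain k :: "int^2" and z where z: "z \<in> half_open_square 0 lam \<union> half_open_square lam 1"
    "y = (\<chi> i. real_of_int (k $ i)) + z" unfolding Y_stiff_def by auto
  show "y \<in> (\<Union>(m, n)\<in>{(m, n). even (m + n)}. grid_cell 1 lam m n)"
    using z(1)
  proof
    assume "z \<in> half_open_square 0 lam"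
    then have "y \<in> grid_cell 1 lam (2 * k $ 1) (2 * k $ 2)"
      using z(2) by (auto simp: half_open_square_def grid_cell_def grid_coord_def forall_2)
    then show ?thesis by (intro UN_I[of "(2 * k $ 1, 2 * k $ 2)"]) auto
  next
    assume "z \<in> half_open_square lam 1"
    then have "y \<in> grid_cell 1 lam (2 * k $ 1 + 1) (2 * k $ 2 + 1)"
      using z(2) by (auto simp: half_open_square_def grid_cell_def grid_coord_def forall_2)
    then show ?thesis by (intro UN_I[of "(2 * k $ 1 + 1, 2 * k $ 2 + 1)"]) auto
  qed
next
  fix y assume "y \<in> (\<Union>(m, n)\<in>{(m, n). even (m + n)}. grid_cell 1 lam m n)"
  then obtain m n where mn: "even (m + n)" and y: "y \<in> grid_cell 1 lam m n" by auto
  define k :: "int^2" where "k = vector [m div 2, n div 2]"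
  define z where "z = y - (\<chi> i. real_of_int (k $ i))"
  have "z \<in> half_open_square 0 lam \<union> half_open_square lam 1"
  proof (cases "even m")
    case True
    with mn have "even n" by auto
    with True y have "z \<in> half_open_square 0 lam"
      by (auto simp: half_open_square_def grid_cell_def grid_coord_def forall_2 z_def k_def elim!: evenE)
    then show ?thesis ..
  next
    case False
    with mn have "odd n" by auto
    with False y have "z \<in> half_open_square lam 1"
      by (auto simp: half_open_square_def grid_cell_def grid_coord_def forall_2 z_def k_def elim!: oddE)
    then show ?thesis ..
  qed
  moreover have "y = (\<chi> i. real_of_int (k $ i)) + z" by (simp add: z_def)
  ultimately show "y \<in> Y_stiff lam" unfolding Y_stiff_def by blast
qed

lemma scaled_Y_stiff_eq_Union_cells:
  assumes e: "\<epsilon> > 0"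
  shows "scaled_Y_stiff \<epsilon> lam = (\<Union>(m, n)\<in>{(m, n). even (m + n)}. grid_cell \<epsilon> lam m n)"
proof -
  have "(\<lambda>y. \<epsilon> *\<^sub>R y) ` grid_cell 1 lam m n = grid_cell \<epsilon> lam m n" for m n
  proof (intro set_eqI iffI)
    fix x assume "x \<in> grid_cell \<epsilon> lam m n"
    then have "(1 / \<epsilon>) *\<^sub>R x \<in> grid_cell 1 lam m n" using e by (auto simp: grid_cell_def field_simps)
    moreover have "x = \<epsilon> *\<^sub>R ((1 / \<epsilon>) *\<^sub>R x)" using e by simp
    ultimately show "x \<in> (\<lambda>y. \<epsilon> *\<^sub>R y) ` grid_cell 1 lam m n" by blast
  qed (use e in \<open>auto simp: grid_cell_def\<close>)
  then show ?thesis
    unfolding scaled_Y_stiff_def Y_stiff_eq_Union_cells by (simp add: image_UN case_prod_unfold)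
qed

lemma grid_cell_borel [measurable]: "grid_cell \<epsilon> lam m n \<in> sets borel"
  unfolding grid_cell_def by measurable

lemma scaled_Y_stiff_borel [measurable]: "\<epsilon> > 0 \<Longrightarrow> scaled_Y_stiff \<epsilon> lam \<in> sets borel"
  unfolding scaled_Y_stiff_eq_Union_cells by (intro sets.countable_UN'') (auto intro: grid_cell_borel)

lemma grid_cell_Int_stiff:
  assumes "\<epsilon> > 0"
  shows "grid_cell \<epsilon> lam m n \<inter> scaled_Y_stiff \<epsilon> lam = (if even (m + n) then grid_cell \<epsilon> lam m n else {})"
proof -
  have "x \<in> scaled_Y_stiff \<epsilon> lam \<longleftrightarrow> even (m + n)" if "x \<in> grid_cell \<epsilon> lam m n" for x
    using grid_cell_disjoint[OF assms that] that unfolding scaled_Y_stiff_eq_Union_cells[OF assms] by blast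
  then show ?thesis by auto
qed

lemma emeasure_grid_cell:
  assumes e: "\<epsilon> > 0"
  shows "emeasure lborel (grid_cell \<epsilon> lam m n) =
    ennreal (\<epsilon>\<^sup>2 * (grid_coord lam (m + 1) - grid_coord lam m) * (grid_coord lam (n + 1) - grid_coord lam n))"
proof -
  let ?a = "grid_point \<epsilon> lam m n" and ?b = "grid_point \<epsilon> lam (m + 1) (n + 1)"
  have mono: "\<epsilon> * grid_coord lam m \<le> \<epsilon> * grid_coord lam (m + 1)" for m
    using e grid_coord_mono[of m "m + 1"] by auto
  have B: "Basis = {axis 1 1, axis 2 1 :: real^2}" "axis 1 1 \<noteq> (axis 2 1 :: real^2)"
    by (auto simp: Basis_vec_def UNIV_2 axis_eq_axis)
  have le: "\<And>b. b \<in> Basis \<Longrightarrow> ?a \<bullet> b \<le> ?b \<bullet> b"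
    using mono by (auto simp: B inner_axis grid_point_def)
  have pr: "(\<Prod>b\<in>Basis. (?b - ?a) \<bullet> b) = \<epsilon>\<^sup>2 * (grid_coord lam (m + 1) - grid_coord lam m) * (grid_coord lam (n + 1) - grid_coord lam n)"
    using B(2) by (simp add: B(1) inner_axis grid_point_def power2_eq_square algebra_simps)
  have 1: "box ?a ?b \<subseteq> grid_cell \<epsilon> lam m n" and 2: "grid_cell \<epsilon> lam m n \<subseteq> cbox ?a ?b"
    by (auto simp: mem_box_cart grid_cell_def grid_point_def forall_2)
  have "emeasure lborel (box ?a ?b) \<le> emeasure lborel (grid_cell \<epsilon> lam m n)"
    using 1 by (intro emeasure_mono) auto
  moreover have "emeasure lborel (grid_cell \<epsilon> lam m n) \<le> emeasure lborel (cbox ?a ?b)"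
    using 2 by (intro emeasure_mono) auto
  ultimately show ?thesis
    using le pr by (simp add: emeasure_lborel_box emeasure_lborel_cbox)
qed

lemma emeasure_grid_cell_bounds:
  assumes e: "\<epsilon> > 0"
  shows "emeasure lborel (grid_cell \<epsilon> lam m n) \<le> ennreal (\<epsilon>\<^sup>2)"
    and "ennreal (\<epsilon>\<^sup>2 * (min lam (1 - lam))\<^sup>2) \<le> emeasure lborel (grid_cell \<epsilon> lam m n)"
proof -
  have s: "min lam (1 - lam) \<le> grid_coord lam (m + 1) - grid_coord lam m"
    "grid_coord lam (m + 1) - grid_coord lam m \<le> 1" for m
    using lam by (auto simp: grid_coord_step)
  have "(grid_coord lam (m + 1) - grid_coord lam m) * (grid_coord lam (n + 1) - grid_coord lam n) \<le> 1 * 1"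
    using s[of m] s[of n] lam by (intro mult_mono) auto
  then show "emeasure lborel (grid_cell \<epsilon> lam m n) \<le> ennreal (\<epsilon>\<^sup>2)"
    using e by (auto simp: emeasure_grid_cell mult.assoc intro!: ennreal_leI mult_left_le)
  have "min lam (1 - lam) * min lam (1 - lam)
      \<le> (grid_coord lam (m + 1) - grid_coord lam m) * (grid_coord lam (n + 1) - grid_coord lam n)"
    using s[of m] s[of n] lam by (intro mult_mono) auto
  then show "ennreal (\<epsilon>\<^sup>2 * (min lam (1 - lam))\<^sup>2) \<le> emeasure lborel (grid_cell \<epsilon> lam m n)"
    using e by (auto simp: emeasure_grid_cell mult.assoc power2_eq_square[of "min _ _"] intro!: ennreal_leI mult_left_mono)
qed

end

text \<open>Division by a quantity of which only a positive real lower bound is known.\<close>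

lemma ennreal_le_cancel_factor:
  assumes "ennreal x * a \<le> ennreal y * b" "ennreal z \<le> a" "z > 0" "x \<ge> 0" "y \<ge> 0"
  shows "ennreal x \<le> ennreal (y / z) * b"
proof -
  have "ennreal (1 / z) * (ennreal x * ennreal z) \<le> ennreal (1 / z) * (ennreal x * a)"
    using assms by (intro mult_left_mono) auto
  also have "\<dots> \<le> ennreal (1 / z) * (ennreal y * b)"
    using assms by (intro mult_left_mono) auto
  also have "\<dots> = ennreal (y / z) * b"
    using assms by (simp add: mult.assoc[symmetric] ennreal_mult[symmetric])
  also have "ennreal (1 / z) * (ennreal x * ennreal z) = ennreal x"
    using assms by (simp add: ennreal_mult[symmetric])
  finally show ?thesis .
qed

text \<open>The factor \<open>2\<^sup>p\<close> comes from the distance \<open>2\<epsilon>\<close>, which bounds the diameter of a cell.\<close>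

definition cell_const :: "real \<Rightarrow> real" where
  "cell_const p = increment_const p * 2 powr p"

lemma cell_const_pos: "p > 2 \<Longrightarrow> cell_const p > 0"
  by (simp add: cell_const_def increment_const_def field_simps)

context
  fixes lam :: real
  assumes lam: "0 < lam" "lam < 1"
begin

text \<open>A half-open cell contains only one of its corners but is star-shaped about all four: moving from any of
them towards a point of the cell, one is in the cell at once.\<close>

lemma grid_cell_corner:
  assumes e: "\<epsilon> > 0" and ab: "a \<in> {m, m + 1}" "b \<in> {n, n + 1}" and x: "x \<in> grid_cell \<epsilon> lam m n"
  shows "0 < t \<Longrightarrow> t \<le> 1 \<Longrightarrow> grid_point \<epsilon> lam a b + t *\<^sub>R (x - grid_point \<epsilon> lam a b) \<in> grid_cell \<epsilon> lam m n"
    and "norm (x - grid_point \<epsilon> lam a b) \<le> 2 * \<epsilon>"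
proof -
  have conv: "l < c + t * (y - c) \<and> c + t * (y - c) \<le> u"
    if "l < y" "y \<le> u" "c = l \<or> c = u" "0 < t" "t \<le> 1" for l y u c t :: real
  proof -
    have "l < u" using that by linarith
    have "c + t * (y - c) = (1 - t) * c + t * y" by (simp add: algebra_simps)
    moreover have "(1 - t) * l \<le> (1 - t) * c" "(1 - t) * c \<le> (1 - t) * u"
      using that \<open>l < u\<close> by (auto intro: mult_left_mono)
    moreover have "t * l < t * y" "t * y \<le> t * u" using that by auto
    ultimately show ?thesis by (auto simp: algebra_simps)
  qed
  show "grid_point \<epsilon> lam a b + t *\<^sub>R (x - grid_point \<epsilon> lam a b) \<in> grid_cell \<epsilon> lam m n"
    if "0 < t" "t \<le> 1"
    using that x ab conv[of _ "x $ 1" _ "\<epsilon> * grid_coord lam a"] conv[of _ "x $ 2" _ "\<epsilon> * grid_coord lam b"]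
    by (auto simp: grid_cell_def grid_point_def)
  have s: "\<epsilon> * grid_coord lam (k + 1) - \<epsilon> * grid_coord lam k \<le> \<epsilon>" for k
    using grid_coord_step[OF lam, of k] lam e by (auto simp flip: right_diff_distrib split: if_splits intro: mult_left_le)
  have "\<bar>(x - grid_point \<epsilon> lam a b) $ 1\<bar> \<le> \<epsilon>" "\<bar>(x - grid_point \<epsilon> lam a b) $ 2\<bar> \<le> \<epsilon>"
    using x ab s[of m] s[of n] by (auto simp: grid_cell_def grid_point_def)
  then show "norm (x - grid_point \<epsilon> lam a b) \<le> 2 * \<epsilon>"
    using norm_le_l1_cart[of "x - grid_point \<epsilon> lam a b"] by (simp add: sum_2)
qed

definition edge_const :: "real \<Rightarrow> real" where
  "edge_const p = 2 powr p * cell_const p / (min lam (1 - lam))\<^sup>2"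

lemma edge_const_pos: "p > 2 \<Longrightarrow> edge_const p > 0"
  using lam by (simp add: edge_const_def cell_const_pos)

lemma grid_cell_estimate:
  fixes v :: "real^2 \<Rightarrow> real^'m"
  assumes p: "p > 2" and e: "\<epsilon> > 0" and v: "has_C1_gradient v D" and ab: "a \<in> {m, m + 1}" "b \<in> {n, n + 1}"
  shows "Lp_energy p (grid_cell \<epsilon> lam m n) (\<lambda>x. v x - v (grid_point \<epsilon> lam a b))
    \<le> ennreal (cell_const p * \<epsilon> powr p) * Lp_energy p (grid_cell \<epsilon> lam m n) D"
  using Lp_increment_le_Lp_gradient[OF p v grid_cell_borel[OF lam] grid_cell_corner(1)[OF e ab] _ grid_cell_corner(2)[OF e ab]] e
  by (simp add: cell_const_def powr_mult mult.assoc)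

text \<open>Both corner values are close to \<open>v\<close> in the \<open>p\<close>-th mean over the cell, whose area is at least a constant times
\<open>\<epsilon>\<^sup>2\<close>; dividing by the area turns \<open>\<epsilon>\<^sup>p\<close> into \<open>\<epsilon>\<^bsup>p-2\<^esup>\<close>.\<close>

lemma grid_edge_estimate:
  fixes v :: "real^2 \<Rightarrow> real^'m"
  assumes p: "p > 2" and e: "\<epsilon> > 0" and v: "has_C1_gradient v D"
    and ab: "a \<in> {m, m + 1}" "b \<in> {n, n + 1}" and ab': "a' \<in> {m, m + 1}" "b' \<in> {n, n + 1}"
  shows "ennreal (norm (v (grid_point \<epsilon> lam a' b') - v (grid_point \<epsilon> lam a b)) powr p)
    \<le> ennreal (edge_const p * \<epsilon> powr (p - 2)) * Lp_energy p (grid_cell \<epsilon> lam m n) D"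
proof -
  let ?T = "grid_cell \<epsilon> lam m n" and ?K = "cell_const p" and ?mu = "(min lam (1 - lam))\<^sup>2"
  note [measurable] = has_C1_gradient_measurable[OF v]
  have [measurable]: "?T \<in> sets borel" by (rule grid_cell_borel[OF lam])
  have pos: "?K > 0" "?mu > 0" using p lam by (auto simp: cell_const_pos)
  let ?c = "v (grid_point \<epsilon> lam a b)" and ?c' = "v (grid_point \<epsilon> lam a' b')"
  have "ennreal (norm (?c' - ?c) powr p) * emeasure lborel ?T = Lp_energy p ?T (\<lambda>x. (v x - ?c) + - (v x - ?c'))"
    using Lp_energy_const[of ?T p "?c' - ?c"] by simp
  also have "\<dots> \<le> ennreal (2 powr (p - 1)) * (Lp_energy p ?T (\<lambda>x. v x - ?c) + Lp_energy p ?T (\<lambda>x. - (v x - ?c')))"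
    using p by (intro Lp_energy_add_le) auto
  also have "Lp_energy p ?T (\<lambda>x. - (v x - ?c')) = Lp_energy p ?T (\<lambda>x. v x - ?c')"
    unfolding Lp_energy_def by (simp only: norm_minus_cancel)
  also have "ennreal (2 powr (p - 1)) * (Lp_energy p ?T (\<lambda>x. v x - ?c) + Lp_energy p ?T (\<lambda>x. v x - ?c'))
    \<le> ennreal (2 powr (p - 1)) * (ennreal (?K * \<epsilon> powr p) * Lp_energy p ?T D + ennreal (?K * \<epsilon> powr p) * Lp_energy p ?T D)"
    by (intro mult_left_mono add_mono grid_cell_estimate p e v ab ab') auto
  also have "\<dots> = ennreal (2 powr (p - 1)) * (ennreal (2 * (?K * \<epsilon> powr p)) * Lp_energy p ?T D)"
    unfolding mult_2 using pos by (subst ennreal_plus) (auto simp: distrib_right)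
  also have "\<dots> = ennreal (2 powr p * ?K * \<epsilon> powr p) * Lp_energy p ?T D"
    unfolding mult.assoc[symmetric] using pos by (subst ennreal_mult[symmetric]) (auto simp: powr_diff mult.assoc)
  finally have "ennreal (norm (?c' - ?c) powr p) \<le> ennreal (2 powr p * ?K * \<epsilon> powr p / (\<epsilon>\<^sup>2 * ?mu)) * Lp_energy p ?T D"
    using emeasure_grid_cell_bounds(2)[OF lam e, of m n] e pos
    by (intro ennreal_le_cancel_factor) auto
  also have "2 powr p * ?K * \<epsilon> powr p / (\<epsilon>\<^sup>2 * ?mu) = edge_const p * \<epsilon> powr (p - 2)"
    using e by (simp add: edge_const_def powr_diff flip: powr_numeral)
  finally show ?thesis .
qed

end

section \<open>The Poincare inequality on a box\<close>

text \<open>The estimate on \<open>A\<close> uses the energy on a compact subset \<open>F\<close> of \<open>U\<close> that may be larger than \<open>A\<close>: cells that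
meet \<open>A\<close> stick out of it. Neither \<open>F\<close> nor the constants depend on \<open>\<epsilon>\<close> or \<open>v\<close>. The type argument names the
index type of the target space, which no other argument mentions.\<close>

definition stiff_poincare_on :: "real \<Rightarrow> real \<Rightarrow> (real^2) set \<Rightarrow> 'm::finite itself \<Rightarrow> (real^2) set \<Rightarrow> bool" where
  "stiff_poincare_on p lam U TYPE('m) A \<longleftrightarrow> (\<exists>F C \<epsilon>\<^sub>0. compact F \<and> F \<subseteq> U \<and> C \<ge> 0 \<and> \<epsilon>\<^sub>0 > 0 \<and>
     (\<forall>\<epsilon> (v::real^2 \<Rightarrow> real^'m) D. 0 < \<epsilon> \<longrightarrow> \<epsilon> < \<epsilon>\<^sub>0 \<longrightarrow> has_C1_gradient v D \<longrightarrow>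
        (\<exists>c. Lp_energy p (A \<inter> scaled_Y_stiff \<epsilon> lam) (\<lambda>x. v x - c)
               \<le> ennreal C * Lp_energy p (F \<inter> scaled_Y_stiff \<epsilon> lam) D)))"

lemma sum_ennreal_le_realD:
  assumes "\<And>i. i \<in> I \<Longrightarrow> ennreal (a i) \<le> b i" "\<And>i. i \<in> I \<Longrightarrow> a i \<ge> 0" "(\<Sum>i\<in>I. b i) \<le> ennreal B" "B \<ge> 0"
  shows "(\<Sum>i\<in>I. a i) \<le> B"
proof -
  have "ennreal (\<Sum>i\<in>I. a i) = (\<Sum>i\<in>I. ennreal (a i))" using assms by (simp add: sum_ennreal)
  also have "\<dots> \<le> (\<Sum>i\<in>I. b i)" using assms by (intro sum_mono) auto
  finally show ?thesis using assms(3,4) by (meson ennreal_le_iff order_trans)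
qed

text \<open>Cover the box by \<open>(N + 1) \<times> (N + 1)\<close> grid cells, with \<open>N \<epsilon>\<close> of order \<open>r\<close>. In each stiff cell \<open>v\<close> is close
to its value \<open>w i j\<close> at the lower left corner, and these values are close to a common constant by the
discrete inequality. The energies of the cells add up to at most the energy of the double box, in
which all cells involved lie.\<close>

lemma stiff_poincare_on_box:
  fixes lam p r :: real
  assumes lam: "0 < lam" "lam < 1" and p: "p > 2" and r: "r > 0"
    and FU: "{x. \<forall>i. \<bar>x $ i - x0 $ i\<bar> \<le> 2 * r} \<subseteq> U"
  shows "stiff_poincare_on p lam U TYPE('m::finite) {x. \<forall>i. \<bar>x $ i - x0 $ i\<bar> < r}"
proof -
  define F where "F = {x. \<forall>i. \<bar>x $ i - x0 $ i\<bar> \<le> 2 * r}"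
  define A where "A = {x. \<forall>i. \<bar>x $ i - x0 $ i\<bar> < r}"
  have F_cbox: "F = cbox (x0 - (\<chi> i. 2 * r)) (x0 + (\<chi> i. 2 * r))"
    by (simp add: F_def set_eq_iff mem_box_cart abs_diff_le_iff)
  have A_box: "A = box (x0 - (\<chi> i. r)) (x0 + (\<chi> i. r))"
    by (simp add: A_def set_eq_iff mem_box_cart abs_diff_less_iff)
  have [measurable]: "F \<in> sets borel" "A \<in> sets borel" unfolding F_cbox A_box by auto
  have "compact F" unfolding F_cbox by simp
  define K where "K = edge_const lam p"
  define K0 where "K0 = cell_const p"
  have K: "K > 0" "K0 > 0" using p by (auto simp: K_def K0_def edge_const_pos[OF lam] cell_const_pos)
  define C where "C = 2 powr (p - 1) * (K0 * r powr p + 2 powr p * (10 * r) powr p * (2 * K))"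
  have C0: "C \<ge> 0" using K by (simp add: C_def)
  have main: "\<exists>c. Lp_energy p (A \<inter> scaled_Y_stiff \<epsilon> lam) (\<lambda>x. v x - c)
               \<le> ennreal C * Lp_energy p (F \<inter> scaled_Y_stiff \<epsilon> lam) D"
    if e: "0 < \<epsilon>" and er: "\<epsilon> < r / 3" and v: "has_C1_gradient v D"
    for \<epsilon> and v :: "real^2 \<Rightarrow> real^'m" and D
  proof (cases "Lp_energy p (F \<inter> scaled_Y_stiff \<epsilon> lam) D = top \<and> C > 0")
    case True
    then show ?thesis by (simp add: ennreal_mult_top)
  next
    case False
    have "C > 0" using K r by (simp add: C_def add_pos_pos)
    define E where "E = enn2real (Lp_energy p (F \<inter> scaled_Y_stiff \<epsilon> lam) D)"
    have E: "Lp_energy p (F \<inter> scaled_Y_stiff \<epsilon> lam) D = ennreal E" and E0: "E \<ge> 0"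
      using False \<open>C > 0\<close> by (auto simp: E_def less_top)
    let ?Y = "scaled_Y_stiff \<epsilon> lam" and ?g = "grid_coord lam"
    note [measurable] = has_C1_gradient_measurable[OF v]
    have [measurable]: "?Y \<in> sets borel" "grid_cell \<epsilon> lam m n \<in> sets borel" for m n
      using scaled_Y_stiff_borel[OF lam e] grid_cell_borel[OF lam] by auto
    obtain m0 where m0: "\<epsilon> * ?g m0 < x0 $ 1 - r" "x0 $ 1 - r \<le> \<epsilon> * ?g (m0 + 1)"
      using scaled_grid_coord_ex[OF lam e] by blast
    obtain n0 where n0: "\<epsilon> * ?g n0 < x0 $ 2 - r" "x0 $ 2 - r \<le> \<epsilon> * ?g (n0 + 1)"
      using scaled_grid_coord_ex[OF lam e] by blast
    \<comment> \<open>Since \<open>2k\<close> index steps advance a grid coordinate by \<open>k\<close>, the \<open>N = 2k\<close> steps from the line below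
      \<open>x0 - r\<close> cover a length \<open>\<epsilon> k \<ge> 2r + \<epsilon>\<close>; the summand \<open>1\<close> makes up for that line being up to
      \<open>\<epsilon>\<close> too low.\<close>
    define k where "k = nat (\<lceil>2 * r / \<epsilon>\<rceil> + 1)"
    have "\<lceil>2 * r / \<epsilon>\<rceil> \<ge> 0" using r e by (smt (verit) ceiling_less_zero divide_pos_pos)
    then have rk: "real k = of_int \<lceil>2 * r / \<epsilon>\<rceil> + 1" by (simp add: k_def)
    have "2 * r / \<epsilon> + 1 \<le> real k" "real k \<le> 2 * r / \<epsilon> + 2" unfolding rk by linarith+
    then have ke: "2 * r + \<epsilon> \<le> \<epsilon> * real k" "\<epsilon> * real k \<le> 2 * r + 2 * \<epsilon>"
      using e by (auto simp: field_simps)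
    define N where "N = 2 * k"
    have gN: "?g (m + int N) = ?g m + real k" for m
      using grid_coord_shift[OF lam, of m "int k"] by (simp add: N_def)
    have range: "l \<le> \<epsilon> * ?g (q + int N) - 2 * r" "\<epsilon> * ?g (q + int N + 1) \<le> l + 3 * r" "l - r \<le> \<epsilon> * ?g (q - 1)"
      if "\<epsilon> * ?g q < l" "l \<le> \<epsilon> * ?g (q + 1)" for q l
    proof -
      have s: "?g (q + 1) \<le> ?g q + 1" using grid_coord_step[OF lam, of q] lam by (auto split: if_splits)
      then have s': "\<epsilon> * ?g (q + 1) \<le> \<epsilon> * ?g q + \<epsilon>" using e by (metis mult.right_neutral distrib_left mult_left_mono less_imp_le)
      have t: "\<epsilon> * ?g (q + 1) = \<epsilon> * ?g (q - 1) + \<epsilon>"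
        using grid_coord_shift[OF lam, of "q - 1" 1] by (simp add: algebra_simps)
      have u: "\<epsilon> * ?g (q + int N + 1) = \<epsilon> * ?g (q + 1) + \<epsilon> * real k" "\<epsilon> * ?g (q + int N) = \<epsilon> * ?g q + \<epsilon> * real k"
        using gN[of "q + 1"] gN[of q] by (simp_all add: algebra_simps)
      show "l \<le> \<epsilon> * ?g (q + int N) - 2 * r" "\<epsilon> * ?g (q + int N + 1) \<le> l + 3 * r" "l - r \<le> \<epsilon> * ?g (q - 1)"
        using s' t u ke that er by linarith+
    qed
    \<comment> \<open>Index \<open>-1\<close> is needed: if the cell above or to the right of an edge is not stiff, the
      edge is a side of the stiff cell below it or to its left.\<close>
    have cellF: "grid_cell \<epsilon> lam (m0 + i) (n0 + j) \<subseteq> F"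
      if "-1 \<le> i" "i \<le> int N" "-1 \<le> j" "j \<le> int N" for i j
    proof
      fix x assume x: "x \<in> grid_cell \<epsilon> lam (m0 + i) (n0 + j)"
      have mono: "m \<le> n \<Longrightarrow> \<epsilon> * ?g m \<le> \<epsilon> * ?g n" for m n
        using e grid_coord_mono[OF lam, of m n] by auto
      have "\<bar>x $ 1 - x0 $ 1\<bar> \<le> 2 * r"
        using x range[OF m0] mono[of "m0 - 1" "m0 + i"] mono[of "m0 + i + 1" "m0 + int N + 1"] that
        by (auto simp: grid_cell_def)
      moreover have "\<bar>x $ 2 - x0 $ 2\<bar> \<le> 2 * r"
        using x range[OF n0] mono[of "n0 - 1" "n0 + j"] mono[of "n0 + j + 1" "n0 + int N + 1"] that
        by (auto simp: grid_cell_def)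
      ultimately show "x \<in> F" by (simp add: F_def forall_2)
    qed
    define cell where "cell = (\<lambda>i j. grid_cell \<epsilon> lam (m0 + i) (n0 + j) \<inter> ?Y)"
    have [measurable]: "cell i j \<in> sets borel" for i j by (simp add: cell_def)
    have idx: "\<exists>i\<le>N. \<epsilon> * ?g (q + int i) < t \<and> t \<le> \<epsilon> * ?g (q + int i + 1)"
      if q: "\<epsilon> * ?g q < l" "l \<le> \<epsilon> * ?g (q + 1)" and t: "l < t" "t < l + 2 * r" for q l t
    proof -
      obtain m where m: "\<epsilon> * ?g m < t" "t \<le> \<epsilon> * ?g (m + 1)" using scaled_grid_coord_ex[OF lam e] by blast
      have "?g q < ?g (m + 1)" "?g m < ?g (q + int N)"
        using m q t range(1)[OF q] e by (smt (verit) mult_left_mono)+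
      then have "q < m + 1" "m < q + int N"
        using grid_coord_mono[OF lam] by (meson not_le leD)+
      then show ?thesis using m by (intro exI[of _ "nat (m - q)"]) auto
    qed
    have cover: "A \<inter> ?Y \<subseteq> (\<Union>z\<in>{..N} \<times> {..N}. cell (int (fst z)) (int (snd z)))"
    proof
      fix x assume x: "x \<in> A \<inter> ?Y"
      then have "x0 $ 1 - r < x $ 1" "x $ 1 < x0 $ 1 - r + 2 * r" "x0 $ 2 - r < x $ 2" "x $ 2 < x0 $ 2 - r + 2 * r"
        by (auto simp: A_def forall_2 abs_less_iff)
      then obtain i j where "i \<le> N" "\<epsilon> * ?g (m0 + int i) < x $ 1 \<and> x $ 1 \<le> \<epsilon> * ?g (m0 + int i + 1)"
         "j \<le> N" "\<epsilon> * ?g (n0 + int j) < x $ 2 \<and> x $ 2 \<le> \<epsilon> * ?g (n0 + int j + 1)"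
        using idx[OF m0] idx[OF n0] by meson
      then show "x \<in> (\<Union>z\<in>{..N} \<times> {..N}. cell (int (fst z)) (int (snd z)))"
        using x by (intro UN_I[of "(i, j)"]) (auto simp: cell_def grid_cell_def)
    qed
    let ?e = "\<lambda>i j. Lp_energy p (cell i j) D"
    \<comment> \<open>The maps \<open>f\<close> and \<open>h\<close> are the embedding of the naturals or its shift by \<open>-1\<close>, according to which
      of the two cells at an edge is meant.\<close>
    have total: "(\<Sum>z\<in>I \<times> J. ?e (f (fst z)) (h (snd z))) \<le> ennreal E"
      if "finite I" "finite J" "inj_on f I" "inj_on h J" "f ` I \<subseteq> {-1..int N}" "h ` J \<subseteq> {-1..int N}"
      for f h :: "nat \<Rightarrow> int" and I J
    proof -
      have "disjoint_family_on (\<lambda>z. cell (f (fst z)) (h (snd z))) (I \<times> J)"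
        unfolding disjoint_family_on_def
      proof (intro ballI impI)
        fix z z' assume z: "z \<in> I \<times> J" "z' \<in> I \<times> J" "z \<noteq> z'"
        show "cell (f (fst z)) (h (snd z)) \<inter> cell (f (fst z')) (h (snd z')) = {}"
        proof (rule ccontr)
          assume "\<not> ?thesis"
          then obtain x where "x \<in> grid_cell \<epsilon> lam (m0 + f (fst z)) (n0 + h (snd z))"
            "x \<in> grid_cell \<epsilon> lam (m0 + f (fst z')) (n0 + h (snd z'))"
            by (auto simp: cell_def)
          from grid_cell_disjoint[OF lam e this] have "f (fst z) = f (fst z')" "h (snd z) = h (snd z')" by auto
          with z that show False by (auto simp: inj_on_def prod_eq_iff)
        qed
      qed
      moreover have "cell (f (fst z)) (h (snd z)) \<subseteq> F \<inter> ?Y" if "z \<in> I \<times> J" for z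
        using cellF[of "f (fst z)" "h (snd z)"] that \<open>f ` I \<subseteq> _\<close> \<open>h ` J \<subseteq> _\<close>
        by (fastforce simp: cell_def image_subset_iff)
      ultimately show ?thesis
        unfolding E[symmetric] using that(1,2) by (intro sum_Lp_energy_le) auto
    qed
    define w where "w = (\<lambda>i j. v (grid_point \<epsilon> lam (m0 + int i) (n0 + int j)))"
    define \<kappa> where "\<kappa> = K * \<epsilon> powr (p - 2)"
    have \<kappa>: "\<kappa> \<ge> 0" using K by (simp add: \<kappa>_def)
    have cell_eq: "cell i j = (if even (m0 + i + (n0 + j)) then grid_cell \<epsilon> lam (m0 + i) (n0 + j) else {})" for i j
      unfolding cell_def by (rule grid_cell_Int_stiff[OF lam e])
    have edge: "ennreal (norm (v (grid_point \<epsilon> lam a' b') - v (grid_point \<epsilon> lam a b)) powr p) \<le> ennreal \<kappa> * ?e i j"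
      if "even (m0 + i + (n0 + j))" "{a, a'} \<subseteq> {m0 + i, m0 + i + 1}" "{b, b'} \<subseteq> {n0 + j, n0 + j + 1}" for a b a' b' i j
    proof -
      have "cell i j = grid_cell \<epsilon> lam (m0 + i) (n0 + j)" using that(1) by (simp only: cell_eq if_True)
      then show ?thesis
        unfolding \<kappa>_def K_def using that by (auto intro!: grid_edge_estimate[OF lam p e v])
    qed
    \<comment> \<open>Exactly one of the two cells at an edge is stiff; the other one contributes the empty set.\<close>
    have edgeH: "ennreal (norm (w (Suc i) j - w i j) powr p) \<le> ennreal \<kappa> * (?e (int i) (int j) + ?e (int i) (int j - 1))" for i j
    proof (cases "even (m0 + int i + (n0 + int j))")
      case True
      show ?thesis unfolding w_def
        by (rule order_trans[OF edge[OF True]]) (auto intro!: mult_left_mono add_increasing2)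
    next
      case False
      then have "even (m0 + int i + (n0 + (int j - 1)))" by presburger
      then show ?thesis unfolding w_def
        by (rule order_trans[OF edge]) (auto intro!: mult_left_mono add_increasing)
    qed
    have edgeV: "ennreal (norm (w i (Suc j) - w i j) powr p) \<le> ennreal \<kappa> * (?e (int i) (int j) + ?e (int i - 1) (int j))" for i j
    proof (cases "even (m0 + int i + (n0 + int j))")
      case True
      show ?thesis unfolding w_def
        by (rule order_trans[OF edge[OF True]]) (auto intro!: mult_left_mono add_increasing2)
    next
      case False
      then have "even (m0 + (int i - 1) + (n0 + int j))" by presburger
      then show ?thesis unfolding w_def
        by (rule order_trans[OF edge]) (auto intro!: mult_left_mono add_increasing)
    qed
    have jumps: "(\<Sum>z\<in>I \<times> J. norm (x z) powr p) \<le> \<kappa> * (2 * E)"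
      if "\<And>i j. ennreal (norm (x (i, j)) powr p) \<le> ennreal \<kappa> * (?e (int i) (int j) + ?e (f i) (h j))"
        and "I \<subseteq> {..N}" "J \<subseteq> {..N}" "inj f" "inj h" "\<And>i. i \<le> N \<Longrightarrow> f i \<in> {-1..int N}" "\<And>j. j \<le> N \<Longrightarrow> h j \<in> {-1..int N}"
      for x :: "nat \<times> nat \<Rightarrow> real^'m" and I J f h
    proof (rule sum_ennreal_le_realD)
      have fin: "finite I" "finite J" using that(2,3) by (auto intro: finite_subset)
      have "(\<Sum>z\<in>I \<times> J. ?e (int (fst z)) (int (snd z))) + (\<Sum>z\<in>I \<times> J. ?e (f (fst z)) (h (snd z))) \<le> ennreal E + ennreal E"
        using fin that(2-7) by (intro add_mono total) (auto intro: inj_on_subset simp: inj_on_def)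
      then have "ennreal \<kappa> * ((\<Sum>z\<in>I \<times> J. ?e (int (fst z)) (int (snd z))) + (\<Sum>z\<in>I \<times> J. ?e (f (fst z)) (h (snd z))))
          \<le> ennreal \<kappa> * (ennreal E + ennreal E)" by (rule mult_left_mono) simp
      also have "\<dots> = ennreal (\<kappa> * (2 * E))"
        using \<kappa> E0 by (simp add: ennreal_mult[symmetric] ennreal_plus[symmetric] del: ennreal_plus)
      finally show "(\<Sum>z\<in>I \<times> J. ennreal \<kappa> * (?e (int (fst z)) (int (snd z)) + ?e (f (fst z)) (h (snd z)))) \<le> ennreal (\<kappa> * (2 * E))"
        by (simp only: sum_distrib_left[symmetric] sum.distrib)
    qed (use that(1) \<kappa> E0 in auto)
    have NN: "{..<N} \<subseteq> {..N}" by auto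
    have H: "(\<Sum>i<N. \<Sum>j\<le>N. norm (w (Suc i) j - w i j) powr p) \<le> \<kappa> * (2 * E)"
      using jumps[of "\<lambda>(i, j). w (Suc i) j - w i j" int "\<lambda>j. int j - 1" "{..<N}" "{..N}"] edgeH NN
      by (auto simp: sum.cartesian_product case_prod_unfold inj_def)
    have V: "(\<Sum>i\<le>N. \<Sum>j<N. norm (w i (Suc j) - w i j) powr p) \<le> \<kappa> * (2 * E)"
      using jumps[of "\<lambda>(i, j). w i (Suc j) - w i j" "\<lambda>i. int i - 1" int "{..N}" "{..<N}"] edgeV NN
      by (auto simp: sum.cartesian_product case_prod_unfold inj_def)
    obtain c where c: "(\<Sum>i\<le>N. \<Sum>j\<le>N. norm (w i j - c) powr p) \<le> 2 powr p * real (Suc N) powr p * (\<kappa> * (2 * E))"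
      using discrete_poincare_grid[OF _ H V] p by auto
    have cell_bound: "Lp_energy p (cell (int i) (int j)) (\<lambda>x. v x - c)

           \<le> ennreal (2 powr (p - 1)) * (ennreal (K0 * \<epsilon> powr p) * ?e (int i) (int j) + ennreal (\<epsilon>\<^sup>2 * norm (w i j - c) powr p))" for i j
    proof (cases "even (m0 + int i + (n0 + int j))")
      case True
      let ?T = "grid_cell \<epsilon> lam (m0 + int i) (n0 + int j)"
      have "Lp_energy p ?T (\<lambda>x. (v x - w i j) + (w i j - c))
          \<le> ennreal (2 powr (p - 1)) * (Lp_energy p ?T (\<lambda>x. v x - w i j) + Lp_energy p ?T (\<lambda>x. w i j - c))"
        using p by (intro Lp_energy_add_le) auto
      also have "\<dots>
          \<le> ennreal (2 powr (p - 1)) * (ennreal (K0 * \<epsilon> powr p) * Lp_energy p ?T D + ennreal (\<epsilon>\<^sup>2 * norm (w i j - c) powr p))"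
      proof (intro mult_left_mono add_mono)
        show "Lp_energy p ?T (\<lambda>x. v x - w i j) \<le> ennreal (K0 * \<epsilon> powr p) * Lp_energy p ?T D"
          unfolding w_def K0_def by (rule grid_cell_estimate[OF lam p e v]) auto
        have "Lp_energy p ?T (\<lambda>x. w i j - c) \<le> ennreal (norm (w i j - c) powr p) * ennreal (\<epsilon>\<^sup>2)"
          by (subst Lp_energy_const) (auto intro!: mult_left_mono emeasure_grid_cell_bounds[OF lam e])
        then show "Lp_energy p ?T (\<lambda>x. w i j - c) \<le> ennreal (\<epsilon>\<^sup>2 * norm (w i j - c) powr p)"
          by (simp add: ennreal_mult mult.commute)
      qed auto
      finally have "Lp_energy p ?T (\<lambda>x. v x - c) \<le> \<dots>" by simp
      moreover have "?T = cell (int i) (int j)" using True by (simp only: cell_eq if_True)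
      ultimately show ?thesis by simp
    next
      case False
      then have "cell (int i) (int j) = {}" by (simp only: cell_eq if_False)
      then show ?thesis by simp
    qed
    have "Lp_energy p (A \<inter> ?Y) (\<lambda>x. v x - c) \<le> (\<Sum>z\<in>{..N} \<times> {..N}. Lp_energy p (cell (int (fst z)) (int (snd z))) (\<lambda>x. v x - c))"
      using cover by (intro Lp_energy_le_sum) auto
    also have "\<dots>
        \<le> (\<Sum>z\<in>{..N} \<times> {..N}. ennreal (2 powr (p - 1)) * (ennreal (K0 * \<epsilon> powr p) * ?e (int (fst z)) (int (snd z)) + ennreal (\<epsilon>\<^sup>2 * norm (w (fst z) (snd z) - c) powr p)))"
      by (intro sum_mono cell_bound)
    also have "\<dots> = ennreal (2 powr (p - 1)) * (ennreal (K0 * \<epsilon> powr p) * (\<Sum>z\<in>{..N} \<times> {..N}. ?e (int (fst z)) (int (snd z))) +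
        ennreal (\<epsilon>\<^sup>2 * (\<Sum>z\<in>{..N} \<times> {..N}. norm (w (fst z) (snd z) - c) powr p)))"
    proof -
      have "(\<Sum>z\<in>{..N} \<times> {..N}. ennreal (\<epsilon>\<^sup>2 * norm (w (fst z) (snd z) - c) powr p)) =
        ennreal (\<epsilon>\<^sup>2 * (\<Sum>z\<in>{..N} \<times> {..N}. norm (w (fst z) (snd z) - c) powr p))"
        by (subst sum_ennreal) (auto simp: sum_distrib_left)
      then show ?thesis by (simp only: sum_distrib_left[symmetric] sum.distrib)
    qed
    also have "\<dots>
        \<le> ennreal (2 powr (p - 1)) * (ennreal (K0 * \<epsilon> powr p) * ennreal E + ennreal (\<epsilon>\<^sup>2 * (2 powr p * real (Suc N) powr p * (\<kappa> * (2 * E)))))"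
      using c by (intro mult_left_mono add_mono ennreal_leI total)
        (auto simp: inj_on_def sum.cartesian_product case_prod_unfold)
    also have "\<dots> = ennreal (2 powr (p - 1) * (K0 * \<epsilon> powr p * E + \<epsilon>\<^sup>2 * (2 powr p * real (Suc N) powr p * (\<kappa> * (2 * E)))))"
      using K E0 \<kappa> by (simp add: ennreal_mult ennreal_plus)
    also have "\<dots> \<le> ennreal (C * E)"
    proof (rule ennreal_leI)
      have "\<epsilon> * real (Suc N) \<le> 10 * r" using ke er by (simp add: N_def algebra_simps)
      then have "(\<epsilon> * real (Suc N)) powr p \<le> (10 * r) powr p" using e p by (intro powr_mono2) auto
      then have 1: "\<epsilon> powr p * real (Suc N) powr p \<le> (10 * r) powr p" using e by (simp add: powr_mult)
      \<comment> \<open>The powers of \<open>\<epsilon>\<close> cancel here: cell area \<open>\<epsilon>\<^sup>2\<close>, jump constant of order \<open>\<epsilon>\<^bsup>p-2\<^esup>\<close>, and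
        \<open>(N + 1)\<^sup>p\<close> of order \<open>\<epsilon>\<^bsup>-p\<^esup>\<close>.\<close>
      have 2: "\<epsilon>\<^sup>2 * \<kappa> = K * \<epsilon> powr p" using e by (simp add: \<kappa>_def powr_diff)
      have 3: "\<epsilon> powr p \<le> r powr p" using e er p r by (intro powr_mono2) auto
      have "K0 * \<epsilon> powr p * E + \<epsilon>\<^sup>2 * (2 powr p * real (Suc N) powr p * (\<kappa> * (2 * E)))
        = K0 * \<epsilon> powr p * E + 2 powr p * real (Suc N) powr p * ((\<epsilon>\<^sup>2 * \<kappa>) * (2 * E))"
        by (simp add: algebra_simps)
      also have "\<dots> = (\<epsilon> powr p) * (K0 * E) + (\<epsilon> powr p * real (Suc N) powr p) * (2 powr p * (2 * K * E))"
        unfolding 2 by (simp add: algebra_simps)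
      also have "\<dots> \<le> r powr p * (K0 * E) + (10 * r) powr p * (2 powr p * (2 * K * E))"
        using 1 3 K E0 by (intro add_mono mult_right_mono) auto
      finally have "K0 * \<epsilon> powr p * E + \<epsilon>\<^sup>2 * (2 powr p * real (Suc N) powr p * (\<kappa> * (2 * E))) \<le> \<dots>" .
      then have "2 powr (p - 1) * (K0 * \<epsilon> powr p * E + \<epsilon>\<^sup>2 * (2 powr p * real (Suc N) powr p * (\<kappa> * (2 * E))))
        \<le> 2 powr (p - 1) * (r powr p * (K0 * E) + (10 * r) powr p * (2 powr p * (2 * K * E)))"
        by (intro mult_left_mono) auto
      also have "\<dots> = C * E" by (simp add: C_def algebra_simps)
      finally show "2 powr (p - 1) * (K0 * \<epsilon> powr p * E + \<epsilon>\<^sup>2 * (2 powr p * real (Suc N) powr p * (\<kappa> * (2 * E)))) \<le> C * E" .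
    qed
    finally show ?thesis using C0 E0 unfolding E by (auto simp: ennreal_mult)
  qed
  show ?thesis
    unfolding stiff_poincare_on_def F_def[symmetric] A_def[symmetric]
    using \<open>compact F\<close> FU C0 r main
    by (intro exI[of _ F] exI[of _ C] exI[of _ "r / 3"]) (auto simp: F_def)
qed

section \<open>From boxes to compact sets\<close>

lemma emeasure_lborel_vimage_minus:
  fixes S :: "'a::euclidean_space set"
  assumes [measurable]: "S \<in> sets borel"
  shows "emeasure lborel {x. x - a \<in> S} = emeasure lborel S"
proof -
  have "emeasure lborel S = emeasure (distr lborel borel ((+) (- a))) S"
    by (simp add: lborel_distr_plus)
  also have "\<dots> = emeasure lborel {x. x - a \<in> S}"
    by (subst emeasure_distr) (auto simp: vimage_def)
  finally show ?thesis by simp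
qed

text \<open>Cut the interval \<open>(k, k + 1]\<close> that contains \<open>t\<close> into \<open>n\<close> pieces, of length at most \<open>lam\<close> each; \<open>i\<close> is the
number of pieces to the left of the one that contains \<open>t\<close>.\<close>

lemma real_in_small_shift:
  fixes t lam :: real
  assumes n: "n > 0" "1 / real n \<le> lam"
  shows "\<exists>i<n. \<exists>k. of_int k < t - real i / real n \<and> t - real i / real n \<le> of_int k + lam"
proof -
  define k where "k = \<lceil>t\<rceil> - 1"
  define i where "i = nat (\<lceil>real n * (t - of_int k)\<rceil> - 1)"
  have k: "of_int k < t" "t \<le> of_int k + 1" unfolding k_def by linarith+
  have "0 < real n * (t - of_int k)" using k n by simp
  then have i: "real i = of_int \<lceil>real n * (t - of_int k)\<rceil> - 1"
    unfolding i_def by (subst of_nat_nat) auto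
  then have "real i < real n * (t - of_int k)" "real n * (t - of_int k) \<le> real i + 1" by linarith+
  then have 1: "real i / real n < t - of_int k" "t - of_int k \<le> (real i + 1) / real n"
    using n by (auto simp: field_simps)
  have "real n * (t - of_int k) \<le> real n" using k n by (simp add: mult_left_le)
  then have "real i < real n" using i by linarith
  then have "i < n" by simp
  moreover have "(real i + 1) / real n \<le> real i / real n + lam" using n by (simp add: add_divide_distrib)
  ultimately show ?thesis using 1 by (intro exI[of _ i] conjI exI[of _ k]) auto
qed

text \<open>Finitely many translates of the stiff set cover the plane, \<open>n\<^sup>2\<close> of them by vectors of length at most
\<open>2\<epsilon>\<close>. A ball in \<open>S\<close> that keeps a distance of at least \<open>2\<epsilon>\<close> from the complement of \<open>S\<close> is therefore covered
by \<open>n\<^sup>2\<close> translates of the stiff part of \<open>S\<close>, whose measure is at least \<open>1 / n\<^sup>2\<close> of that of the ball.\<close>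

lemma stiff_measure_lower_bound:
  fixes lam :: real
  assumes lam: "0 < lam" "lam < 1" and S: "open S" "S \<noteq> {}"
  shows "\<exists>\<mu>>0. \<exists>\<epsilon>\<^sub>0>0. \<forall>\<epsilon>. 0 < \<epsilon> \<longrightarrow> \<epsilon> < \<epsilon>\<^sub>0 \<longrightarrow> ennreal \<mu> \<le> emeasure lborel (S \<inter> scaled_Y_stiff \<epsilon> lam)"
proof -
  obtain x0 d where d: "d > 0" "ball x0 d \<subseteq> S" using S by (meson ex_in_conv openE)
  define n where "n = nat \<lceil>1 / lam\<rceil>"
  have "1 / lam \<le> real n" "n > 0" using lam unfolding n_def by (simp_all add: real_nat_ceiling_ge)
  then have n: "n > 0" "1 / real n \<le> lam" using lam by (auto simp: field_simps)
  define \<mu> where "\<mu> = measure lborel (ball x0 (d / 2)) / real (n * n)"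
  have "measure lborel (ball x0 (d / 2)) > 0" using d by (intro content_ball_pos) auto
  then have \<mu>: "\<mu> > 0" using n by (simp add: \<mu>_def)
  show ?thesis
  proof (rule exI[of _ \<mu>], intro conjI \<mu> exI[of _ "d / 4"] allI impI)
    show "d / 4 > 0" using d by simp
    fix \<epsilon> :: real assume e: "0 < \<epsilon>" "\<epsilon> < d / 4"
    let ?Y = "scaled_Y_stiff \<epsilon> lam"
    have [measurable]: "?Y \<in> sets borel" "S \<in> sets borel" using scaled_Y_stiff_borel[OF lam e(1)] S by auto
    define a :: "nat \<times> nat \<Rightarrow> real^2" where "a z = vector [\<epsilon> * (real (fst z) / real n), \<epsilon> * (real (snd z) / real n)]" for z
    let ?I = "{..<n} \<times> {..<n}"
    have "ball x0 (d / 2) \<subseteq> (\<Union>z\<in>?I. {x. x - a z \<in> S \<inter> ?Y})"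
    proof
      fix x assume x: "x \<in> ball x0 (d / 2)"
      obtain i k where i: "i < n" "of_int k < x $ 1 / \<epsilon> - real i / real n" "x $ 1 / \<epsilon> - real i / real n \<le> of_int k + lam"
        using real_in_small_shift[OF n] by blast
      obtain j l where j: "j < n" "of_int l < x $ 2 / \<epsilon> - real j / real n" "x $ 2 / \<epsilon> - real j / real n \<le> of_int l + lam"
        using real_in_small_shift[OF n] by blast
      have *: "\<epsilon> * c < y - \<epsilon> * b \<and> y - \<epsilon> * b \<le> \<epsilon> * (c + lam)" if "c < y / \<epsilon> - b" "y / \<epsilon> - b \<le> c + lam" for c y b
      proof -
        have "\<epsilon> * c < \<epsilon> * (y / \<epsilon> - b)" "\<epsilon> * (y / \<epsilon> - b) \<le> \<epsilon> * (c + lam)"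
          using that e by (auto intro: mult_left_mono)
        moreover have "\<epsilon> * (y / \<epsilon> - b) = y - \<epsilon> * b" using e by (simp add: right_diff_distrib)
        ultimately show ?thesis by simp
      qed
      have "x - a (i, j) \<in> grid_cell \<epsilon> lam (2 * k) (2 * l)"
        using *[OF i(2,3)] *[OF j(2,3)] by (simp add: grid_cell_def grid_coord_def a_def)
      then have Y: "x - a (i, j) \<in> ?Y"
        unfolding scaled_Y_stiff_eq_Union_cells[OF lam e(1)] by (intro UN_I[of "(2 * k, 2 * l)"]) auto
      have le1: "\<epsilon> * (real m / real n) \<le> \<epsilon>" if "m < n" for m
        using that e by (intro mult_left_le) auto
      have "norm (a (i, j)) \<le> \<bar>a (i, j) $ 1\<bar> + \<bar>a (i, j) $ 2\<bar>"
        using norm_le_l1_cart[of "a (i, j)"] by (simp add: sum_2)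
      also have "\<dots> \<le> 2 * \<epsilon>" using le1[OF i(1)] le1[OF j(1)] e by (simp add: a_def abs_mult)
      finally have "norm (a (i, j)) \<le> 2 * \<epsilon>" .
      moreover have "norm (x0 - (x - a (i, j))) \<le> norm (x0 - x) + norm (a (i, j))"
        using norm_triangle_ineq[of "x0 - x" "a (i, j)"] by (simp add: algebra_simps)
      ultimately have "x - a (i, j) \<in> ball x0 d" using x e by (simp add: dist_norm)
      then show "x \<in> (\<Union>z\<in>?I. {x. x - a z \<in> S \<inter> ?Y})"
        using Y d i j by (intro UN_I[of "(i, j)"]) auto
    qed
    then have "emeasure lborel (ball x0 (d / 2)) \<le> emeasure lborel (\<Union>z\<in>?I. {x. x - a z \<in> S \<inter> ?Y})"
      by (intro emeasure_mono) auto
    also have "\<dots> \<le> (\<Sum>z\<in>?I. emeasure lborel {x. x - a z \<in> S \<inter> ?Y})"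
      by (intro emeasure_subadditive_finite) (auto simp: pred_def[symmetric])
    also have "\<dots> = ennreal (real (n * n)) * emeasure lborel (S \<inter> ?Y)"
      by (subst emeasure_lborel_vimage_minus) (auto simp: ennreal_of_nat_eq_real_of_nat)
    finally have "ennreal (measure lborel (ball x0 (d / 2))) \<le> ennreal (real (n * n)) * emeasure lborel (S \<inter> ?Y)"
      using emeasure_lborel_ball_finite[of x0 "d / 2"] by (subst emeasure_eq_ennreal_measure[symmetric]) auto
    then have "ennreal (1 / real (n * n)) * ennreal (measure lborel (ball x0 (d / 2)))
        \<le> ennreal (1 / real (n * n)) * (ennreal (real (n * n)) * emeasure lborel (S \<inter> ?Y))"
      by (intro mult_left_mono) auto
    also have "\<dots> = emeasure lborel (S \<inter> ?Y)"
      using n by (simp add: mult.assoc[symmetric] ennreal_mult[symmetric] del: of_nat_mult)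
    finally show "ennreal \<mu> \<le> emeasure lborel (S \<inter> ?Y)"
      by (simp add: \<mu>_def ennreal_mult[symmetric])
  qed
qed

lemma Lp_energy_mult_mono:
  "C \<le> C' \<Longrightarrow> A \<subseteq> B \<Longrightarrow> ennreal C * Lp_energy p A f \<le> ennreal C' * Lp_energy p B f"
  by (intro mult_mono ennreal_leI Lp_energy_mono) auto

lemma Lp_energy_Un_le:
  assumes "f \<in> borel_measurable borel" "A \<in> sets borel" "B \<in> sets borel"
  shows "Lp_energy p (A \<union> B) f \<le> Lp_energy p A f + Lp_energy p B f"
  using assms by (simp add: Lp_energy_eq_emeasure emeasure_subadditive)

lemma stiff_poincare_on_mono:
  "stiff_poincare_on p lam U TYPE('m::finite) A \<Longrightarrow> B \<subseteq> A \<Longrightarrow> stiff_poincare_on p lam U TYPE('m) B"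
  unfolding stiff_poincare_on_def
  by (elim ex_forward conj_forward all_forward imp_forward; (elim ex_forward)?; assumption?)
     (rule order_trans[OF Lp_energy_mono], auto)

text \<open>On \<open>A \<inter> B\<close> the constants \<open>c1\<close> and \<open>c2\<close> of the two sets are both close to \<open>v\<close>. Since the stiff part of
\<open>A \<inter> B\<close> has measure at least \<open>\<mu>\<close>, they are close to each other, and \<open>c1\<close> serves for \<open>B\<close> too.\<close>

lemma stiff_poincare_on_Un:
  assumes lam: "0 < lam" "lam < 1" and p: "p > 2"
    and A: "stiff_poincare_on p lam U TYPE('m::finite) A" "open A"
    and B: "stiff_poincare_on p lam U TYPE('m) B" "open B" "bounded B"
    and AB: "A \<inter> B \<noteq> {}"
  shows "stiff_poincare_on p lam U TYPE('m) (A \<union> B)"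
proof -
  obtain F1 C1 e1 where 1: "compact F1" "F1 \<subseteq> U" "C1 \<ge> 0" "e1 > 0"
    and P1: "\<And>\<epsilon> (v::real^2 \<Rightarrow> real^'m) D. 0 < \<epsilon> \<Longrightarrow> \<epsilon> < e1 \<Longrightarrow> has_C1_gradient v D \<Longrightarrow>
        \<exists>c. Lp_energy p (A \<inter> scaled_Y_stiff \<epsilon> lam) (\<lambda>x. v x - c) \<le> ennreal C1 * Lp_energy p (F1 \<inter> scaled_Y_stiff \<epsilon> lam) D"
    using A(1) unfolding stiff_poincare_on_def by auto
  obtain F2 C2 e2 where 2: "compact F2" "F2 \<subseteq> U" "C2 \<ge> 0" "e2 > 0"
    and P2: "\<And>\<epsilon> (v::real^2 \<Rightarrow> real^'m) D. 0 < \<epsilon> \<Longrightarrow> \<epsilon> < e2 \<Longrightarrow> has_C1_gradient v D \<Longrightarrow>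
        \<exists>c. Lp_energy p (B \<inter> scaled_Y_stiff \<epsilon> lam) (\<lambda>x. v x - c) \<le> ennreal C2 * Lp_energy p (F2 \<inter> scaled_Y_stiff \<epsilon> lam) D"
    using B(1) unfolding stiff_poincare_on_def by auto
  obtain \<mu> e3 where 3: "\<mu> > 0" "e3 > 0"
    and P3: "\<And>\<epsilon>. 0 < \<epsilon> \<Longrightarrow> \<epsilon> < e3 \<Longrightarrow> ennreal \<mu> \<le> emeasure lborel ((A \<inter> B) \<inter> scaled_Y_stiff \<epsilon> lam)"
    using stiff_measure_lower_bound[OF lam open_Int[OF A(2) B(2)] AB] by auto
  define b where "b = measure lborel B"
  have b: "emeasure lborel B = ennreal b" "b \<ge> 0"
    using emeasure_bounded_finite[OF B(3)] by (auto simp: b_def emeasure_eq_ennreal_measure less_top)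
  let ?q = "2 powr (p - 1) :: real"
  define C' where "C' = ?q * (C2 + C1) / \<mu>"
  define C where "C = C1 + ?q * (C2 + b * C')"
  have C': "C' \<ge> 0" and C: "C \<ge> 0" using 1 2 3 b by (auto simp: C'_def C_def)
  show ?thesis
    unfolding stiff_poincare_on_def
  proof (rule exI[of _ "F1 \<union> F2"], rule exI[of _ C], rule exI[of _ "min e1 (min e2 e3)"], intro conjI allI impI)
    fix \<epsilon> :: real and v :: "real^2 \<Rightarrow> real^'m" and D
    assume e: "0 < \<epsilon>" "\<epsilon> < min e1 (min e2 e3)" and v: "has_C1_gradient v D"
    let ?Y = "scaled_Y_stiff \<epsilon> lam"
    note [measurable] = has_C1_gradient_measurable[OF v]
    have [measurable]: "?Y \<in> sets borel" "A \<in> sets borel" "B \<in> sets borel"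
      using scaled_Y_stiff_borel[OF lam e(1)] A B by auto
    define E where "E = Lp_energy p ((F1 \<union> F2) \<inter> ?Y) D"
    obtain c1 where "Lp_energy p (A \<inter> ?Y) (\<lambda>x. v x - c1) \<le> ennreal C1 * Lp_energy p (F1 \<inter> ?Y) D"
      using P1[OF e(1) _ v] e(2) by auto
    then have c1: "Lp_energy p (A \<inter> ?Y) (\<lambda>x. v x - c1) \<le> ennreal C1 * E"
      unfolding E_def by (rule order_trans) (auto intro!: Lp_energy_mult_mono)
    obtain c2 where "Lp_energy p (B \<inter> ?Y) (\<lambda>x. v x - c2) \<le> ennreal C2 * Lp_energy p (F2 \<inter> ?Y) D"
      using P2[OF e(1) _ v] e(2) by auto
    then have c2: "Lp_energy p (B \<inter> ?Y) (\<lambda>x. v x - c2) \<le> ennreal C2 * E"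
      unfolding E_def by (rule order_trans) (auto intro!: Lp_energy_mult_mono)
    have neg: "Lp_energy p S (\<lambda>x. c1 - v x) = Lp_energy p S (\<lambda>x. v x - c1)" for S
      unfolding Lp_energy_def by (simp only: norm_minus_commute)
    have "ennreal (norm (c1 - c2) powr p) * emeasure lborel ((A \<inter> B) \<inter> ?Y) = Lp_energy p ((A \<inter> B) \<inter> ?Y) (\<lambda>x. (v x - c2) + (c1 - v x))"
      using Lp_energy_const[of "(A \<inter> B) \<inter> ?Y" p "c1 - c2"] by simp
    also have "\<dots> \<le> ennreal ?q * (Lp_energy p ((A \<inter> B) \<inter> ?Y) (\<lambda>x. v x - c2) + Lp_energy p ((A \<inter> B) \<inter> ?Y) (\<lambda>x. c1 - v x))"
      using p by (intro Lp_energy_add_le) auto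
    also have "\<dots> \<le> ennreal ?q * (ennreal C2 * E + ennreal C1 * E)"
      unfolding neg
      by (intro mult_left_mono add_mono order_trans[OF Lp_energy_mono c1] order_trans[OF Lp_energy_mono c2]) auto
    also have "\<dots> = ennreal (?q * (C2 + C1)) * E"
      using 1 2 by (simp add: ennreal_mult ennreal_plus distrib_right mult.assoc)
    finally have "ennreal (norm (c1 - c2) powr p) \<le> ennreal C' * E"
      unfolding C'_def using e 1 2 3 by (intro ennreal_le_cancel_factor[OF _ P3[OF e(1)]]) auto
    then have cc: "Lp_energy p (B \<inter> ?Y) (\<lambda>x. c2 - c1) \<le> ennreal C' * E * ennreal b"
      by (subst Lp_energy_const)
        (auto simp: norm_minus_commute b(1)[symmetric] intro!: mult_mono emeasure_mono)
    have "Lp_energy p (B \<inter> ?Y) (\<lambda>x. (v x - c2) + (c2 - c1))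
        \<le> ennreal ?q * (Lp_energy p (B \<inter> ?Y) (\<lambda>x. v x - c2) + Lp_energy p (B \<inter> ?Y) (\<lambda>x. c2 - c1))"
      using p by (intro Lp_energy_add_le) auto
    also have "\<dots> \<le> ennreal ?q * (ennreal C2 * E + ennreal C' * E * ennreal b)"
      by (intro add_mono mult_left_mono c2 cc) auto
    finally have "Lp_energy p (B \<inter> ?Y) (\<lambda>x. v x - c1) \<le> ennreal ?q * (ennreal C2 * E + ennreal C' * E * ennreal b)"
      by simp
    then have "Lp_energy p ((A \<union> B) \<inter> ?Y) (\<lambda>x. v x - c1)
        \<le> ennreal C1 * E + ennreal ?q * (ennreal C2 * E + ennreal C' * E * ennreal b)"
      unfolding Int_Un_distrib2 by (intro order_trans[OF Lp_energy_Un_le] add_mono c1) auto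
    also have "\<dots> = ennreal C * E"
      using 1 2 b C' by (simp add: C_def ennreal_mult ennreal_plus algebra_simps)
    finally show "\<exists>c. Lp_energy p ((A \<union> B) \<inter> ?Y) (\<lambda>x. v x - c) \<le> ennreal C * Lp_energy p ((F1 \<union> F2) \<inter> ?Y) D"
      unfolding E_def by (rule exI)
  qed (use 1 2 3 C in auto)
qed

text \<open>Two points are related if some set with property \<open>P\<close> contains both. By \<open>P_Un\<close> this relation is
transitive and by \<open>P_local\<close> its classes are open, so connectedness leaves a single class: every point lies
with a fixed \<open>a\<close> in a set with property \<open>P\<close>. Finitely many of these cover \<open>K\<close>, and all contain \<open>a\<close>.\<close>

lemma local_to_compact_of_connected:
  fixes U :: "'a::topological_space set"
  assumes U: "open U" "connected U" "U \<noteq> {}"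
    and P_open: "\<And>W. P W \<Longrightarrow> open W"
    and P_local: "\<And>x. x \<in> U \<Longrightarrow> \<exists>W. x \<in> W \<and> P W"
    and P_Un: "\<And>V W. P V \<Longrightarrow> P W \<Longrightarrow> V \<inter> W \<noteq> {} \<Longrightarrow> P (V \<union> W)"
    and K: "compact K" "K \<subseteq> U"
  shows "\<exists>W. K \<subseteq> W \<and> P W"
proof -
  obtain a where a: "a \<in> U" using U by auto
  have conn: "\<exists>W. a \<in> W \<and> b \<in> W \<and> P W" if "b \<in> U" for b
  proof (rule connected_equivalence_relation[OF U(2) a that, of "\<lambda>x y. \<exists>W. x \<in> W \<and> y \<in> W \<and> P W"])
    show "\<exists>W. x \<in> W \<and> z \<in> W \<and> P W" if "\<exists>W. x \<in> W \<and> y \<in> W \<and> P W" "\<exists>W. y \<in> W \<and> z \<in> W \<and> P W" for x y z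
    proof -
      obtain V W where "x \<in> V" "y \<in> V" "P V" "y \<in> W" "z \<in> W" "P W" using \<open>\<exists>W. x \<in> W \<and> _ W\<close> \<open>\<exists>W. y \<in> W \<and> _ W\<close> by auto
      then show ?thesis using P_Un[of V W] by (intro exI[of _ "V \<union> W"]) auto
    qed
    show "\<exists>T. openin (top_of_set U) T \<and> x \<in> T \<and> (\<forall>y\<in>T. \<exists>W. x \<in> W \<and> y \<in> W \<and> P W)" if x: "x \<in> U" for x
    proof -
      obtain W where "x \<in> W" "P W" using P_local[OF x] by auto
      then show ?thesis using x P_open[of W] by (intro exI[of _ "U \<inter> W"]) auto
    qed
  qed auto
  define \<W> where "\<W> = {W. a \<in> W \<and> P W}"
  have "K \<subseteq> \<Union>\<W>" using conn K by (fastforce simp: \<W>_def)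
  then obtain \<T> where T: "\<T> \<subseteq> \<W>" "finite \<T>" "K \<subseteq> \<Union>\<T>"
    using K P_open by (elim compactE[of K \<W>]) (auto simp: \<W>_def)
  obtain W0 where W0: "W0 \<in> \<W>" using conn[OF a] by (auto simp: \<W>_def)
  have "W0 \<union> \<Union>\<T> \<in> \<W>"
    using T(2,1)
  proof (induction \<T>)
    case (insert W \<T>)
    then have "W \<union> (W0 \<union> \<Union>\<T>) \<in> \<W>" using P_Un[of W "W0 \<union> \<Union>\<T>"] by (auto simp: \<W>_def)
    then show ?case by (simp add: Un_left_commute)
  qed (use W0 in auto)
  then show ?thesis using T(3) by (intro exI[of _ "W0 \<union> \<Union>\<T>"]) (auto simp: \<W>_def)
qed

lemma stiff_poincare_on_compact:
  assumes lam: "0 < lam" "lam < 1" and p: "p > 2" and U: "bounded_domain U" and K: "compact K" "K \<subseteq> U"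
  shows "stiff_poincare_on p lam U TYPE('m::finite) K"
proof -
  define P where "P W \<longleftrightarrow> open W \<and> bounded W \<and> stiff_poincare_on p lam U TYPE('m) W" for W
  have "\<exists>W. K \<subseteq> W \<and> P W"
  proof (rule local_to_compact_of_connected[OF _ _ _ _ _ _ K])
    show "open U" "connected U" "U \<noteq> {}" using U by (auto simp: bounded_domain_def)
    show "P (V \<union> W)" if "P V" "P W" "V \<inter> W \<noteq> {}" for V W
      using that stiff_poincare_on_Un[OF lam p] by (auto simp: P_def)
    fix x0 :: "real^2" assume x: "x0 \<in> U"
    then obtain d where d: "d > 0" "cball x0 d \<subseteq> U" using \<open>open U\<close> open_contains_cball by blast
    define r where "r = d / 4"
    let ?A = "{x. \<forall>i. \<bar>x $ i - x0 $ i\<bar> < r}"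
    have A_box: "?A = box (x0 - (\<chi> i. r)) (x0 + (\<chi> i. r))"
      by (simp add: set_eq_iff mem_box_cart abs_diff_less_iff)
    have "{x. \<forall>i. \<bar>x $ i - x0 $ i\<bar> \<le> 2 * r} \<subseteq> U"
    proof
      fix x assume "x \<in> {x. \<forall>i. \<bar>x $ i - x0 $ i\<bar> \<le> 2 * r}"
      then have "norm (x - x0) \<le> d"
        using norm_le_l1_cart[of "x - x0"] by (simp add: sum_2 forall_2 r_def)
      then show "x \<in> U" using d by (auto simp: dist_norm norm_minus_commute)
    qed
    then have "stiff_poincare_on p lam U TYPE('m) ?A"
      using d by (intro stiff_poincare_on_box[OF lam p]) (auto simp: r_def)
    then show "\<exists>W. x0 \<in> W \<and> P W"
      using d A_box by (intro exI[of _ ?A]) (auto simp: P_def r_def)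
  qed (auto simp: P_def)
  then show ?thesis using stiff_poincare_on_mono unfolding P_def by blast
qed

section \<open>Smooth kernels\<close>

text \<open>For \<open>P = 1\<close> this is the standard smooth function that is flat at \<open>0\<close>. Allowing a polynomial in \<open>1/t\<close> as a
factor makes the family closed under differentiation.\<close>

definition flat_exp :: "real poly \<Rightarrow> real \<Rightarrow> real" where
  "flat_exp P t = (if t > 0 then poly P (1 / t) * exp (- 1 / t) else 0)"

lemma poly_times_exp_minus_tendsto_0: "((\<lambda>s::real. poly P s * exp (- s)) \<longlongrightarrow> 0) at_top"
proof -
  have "((\<lambda>s. \<Sum>i\<le>degree P. coeff P i * (s ^ i / exp s)) \<longlongrightarrow> (\<Sum>i\<le>degree P. coeff P i * 0)) at_top"
    by (intro tendsto_intros tendsto_power_div_exp_0)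
  then show ?thesis by (simp add: poly_altdef sum_distrib_right exp_minus divide_inverse mult.assoc)
qed

lemma flat_exp_tendsto_0: "(flat_exp P \<longlongrightarrow> 0) (at 0)"
proof (rule filterlim_split_at)
  show "(flat_exp P \<longlongrightarrow> 0) (at_left 0)"
    by (rule tendsto_eventually) (auto simp: flat_exp_def eventually_at_left_field intro!: exI[of _ "-1"])
  have "((\<lambda>t. poly P (inverse t) * exp (- inverse t)) \<longlongrightarrow> 0) (at_right 0)"
    by (rule filterlim_compose[OF poly_times_exp_minus_tendsto_0 filterlim_inverse_at_top_right])
  then show "(flat_exp P \<longlongrightarrow> 0) (at_right 0)"
    by (rule Lim_transform_eventually) (auto simp: flat_exp_def eventually_at_right_field field_simps intro!: exI[of _ 1])
qed

text \<open>With \<open>s = 1/t\<close> one has \<open>ds/dt = - s\<^sup>2\<close>, hence \<open>d/dt (P(s) e\<^bsup>-s\<^esup>) = s\<^sup>2 (P - P')(s) e\<^bsup>-s\<^esup>\<close>.\<close>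

definition flat_exp_deriv :: "real poly \<Rightarrow> real poly" where
  "flat_exp_deriv P = [:0, 0, 1:] * (P - pderiv P)"

text \<open>At \<open>t = 0\<close> the difference quotient of the function for \<open>P\<close> is the function for the polynomial \<open>s P(s)\<close>,
which tends to \<open>0\<close>.\<close>

lemma flat_exp_has_derivative:
  "(flat_exp P has_real_derivative flat_exp (flat_exp_deriv P) t) (at t)"
proof -
  consider "t > 0" | "t < 0" | "t = 0" by linarith
  then show ?thesis
  proof cases
    case 1
    have i: "((\<lambda>t. 1 / t) has_real_derivative - (1 / t * (1 / t))) (at t)"
      using 1 by (auto intro!: derivative_eq_intros simp: power2_eq_square)
    have "((\<lambda>t. poly P (1 / t)) has_real_derivative poly (pderiv P) (1 / t) * - (1 / t * (1 / t))) (at t)"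
      by (rule DERIV_chain2[OF poly_DERIV i])
    moreover have "((\<lambda>t. exp (- 1 / t)) has_real_derivative exp (- 1 / t) * (1 / t * (1 / t))) (at t)"
      using DERIV_chain2[OF DERIV_exp DERIV_minus[OF i]] by simp
    ultimately have "((\<lambda>t. poly P (1 / t) * exp (- 1 / t)) has_real_derivative flat_exp (flat_exp_deriv P) t) (at t)"
      by (rule DERIV_cong[OF DERIV_mult]) (use 1 in \<open>simp add: flat_exp_def flat_exp_deriv_def algebra_simps\<close>)
    then show ?thesis
      by (rule has_field_derivative_transform_within_open[of _ _ _ "{0<..}"]) (use 1 in \<open>auto simp: flat_exp_def\<close>)
  next
    case 2
    have "((\<lambda>t. 0) has_real_derivative flat_exp (flat_exp_deriv P) t) (at t)"
      using 2 by (simp add: flat_exp_def)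
    then show ?thesis
      by (rule has_field_derivative_transform_within_open[of _ _ _ "{..<0}"]) (use 2 in \<open>auto simp: flat_exp_def\<close>)
  next
    case 3
    have "((\<lambda>h. (flat_exp P (0 + h) - flat_exp P 0) / h) \<longlongrightarrow> 0) (at 0)"
      by (rule Lim_transform_eventually[OF flat_exp_tendsto_0[of "pCons 0 P"]])
        (auto simp: flat_exp_def eventually_at_filter)
    then show ?thesis using 3 by (simp add: DERIV_def flat_exp_def)
  qed
qed

lemma partial_deriv_eq:
  "(f has_derivative f') (at x) \<Longrightarrow> partial_deriv j f x = f' (axis j 1)"
  unfolding partial_deriv_def by (metis frechet_derivative_at)

lemma C_k_Suc_imp: "C_k (Suc k) f \<Longrightarrow> C_k k f"
proof (induction k arbitrary: f)
  case 0
  then show ?case by (simp add: differentiable_imp_continuous_on)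
qed auto

lemma C_k_SucI:
  assumes "\<And>x. (f has_derivative f' x) (at x)" "\<And>j. C_k k (\<lambda>x. f' x (axis j 1))"
  shows "C_k (Suc k) f"
proof -
  have "partial_deriv j f = (\<lambda>x. f' x (axis j 1))" for j using partial_deriv_eq[OF assms(1)] by auto
  moreover have "f differentiable_on UNIV"
    using assms(1) by (auto simp: differentiable_on_def differentiable_def)
  ultimately show ?thesis using assms(2) by simp
qed

lemma C_k_Suc_has_derivative:
  assumes "C_k (Suc k) f"
  shows "(f has_derivative frechet_derivative f (at x)) (at x)"
    "(f has_derivative (\<lambda>h. \<Sum>j\<in>UNIV. h $ j * partial_deriv j f x)) (at x)"
proof -
  show 1: "(f has_derivative frechet_derivative f (at x)) (at x)"
    using assms by (simp add: differentiable_on_def frechet_derivative_works)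
  let ?f' = "frechet_derivative f (at x)"
  have lin: "linear ?f'" using 1 by (rule has_derivative_linear)
  have "?f' h = (\<Sum>j\<in>UNIV. h $ j * partial_deriv j f x)" for h
  proof -
    have "?f' h = ?f' (\<Sum>j\<in>UNIV. h $ j *s axis j 1)" by (simp add: basis_expansion)
    also have "\<dots> = (\<Sum>j\<in>UNIV. ?f' (h $ j *\<^sub>R axis j 1))"
      using linear_sum[OF lin] by (simp add: scalar_mult_eq_scaleR)
    also have "\<dots> = (\<Sum>j\<in>UNIV. h $ j * partial_deriv j f x)"
      using linear_scale[OF lin] by (simp add: partial_deriv_def)
    finally show ?thesis .
  qed
  then have eq: "?f' = (\<lambda>h. \<Sum>j\<in>UNIV. h $ j * partial_deriv j f x)" by (rule ext)
  show "(f has_derivative (\<lambda>h. \<Sum>j\<in>UNIV. h $ j * partial_deriv j f x)) (at x)"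
    using 1 by (simp only: eq)
qed

lemma C_k_const [simp]: "C_k k (\<lambda>x. c)"
proof (induction k arbitrary: c)
  case (Suc k)
  show ?case by (rule C_k_SucI[where f' = "\<lambda>_ _. 0"]) (auto intro: Suc)
qed simp

lemma C_k_add: "C_k k f \<Longrightarrow> C_k k g \<Longrightarrow> C_k k (\<lambda>x. f x + g x)"
proof (induction k arbitrary: f g)
  case (Suc k)
  show ?case
  proof (rule C_k_SucI[OF has_derivative_add[OF C_k_Suc_has_derivative(1)[OF Suc.prems(1)] C_k_Suc_has_derivative(1)[OF Suc.prems(2)]]])
    fix j
    have "C_k k (\<lambda>x. partial_deriv j f x + partial_deriv j g x)"
      using Suc.prems by (intro Suc.IH) simp_all
    then show "C_k k (\<lambda>x. frechet_derivative f (at x) (axis j 1) + frechet_derivative g (at x) (axis j 1))"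
      by (simp only: partial_deriv_def)
  qed
qed (simp add: continuous_on_add)

lemma C_k_mult: "C_k k f \<Longrightarrow> C_k k g \<Longrightarrow> C_k k (\<lambda>x. f x * g x)"
proof (induction k arbitrary: f g)
  case (Suc k)
  show ?case
  proof (rule C_k_SucI[OF has_derivative_mult[OF C_k_Suc_has_derivative(1)[OF Suc.prems(1)] C_k_Suc_has_derivative(1)[OF Suc.prems(2)]]])
    fix j
    have "C_k k (\<lambda>x. f x * partial_deriv j g x + partial_deriv j f x * g x)"
      using Suc.prems C_k_Suc_imp[OF Suc.prems(1)] C_k_Suc_imp[OF Suc.prems(2)]
      by (intro C_k_add Suc.IH) simp_all
    then show "C_k k (\<lambda>x. f x * frechet_derivative g (at x) (axis j 1) + frechet_derivative f (at x) (axis j 1) * g x)"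
      by (simp only: partial_deriv_def)
  qed
qed (simp add: continuous_on_mult)

lemma C_k_prod: "finite I \<Longrightarrow> (\<And>i. i \<in> I \<Longrightarrow> C_k k (f i)) \<Longrightarrow> C_k k (\<lambda>x. \<Prod>i\<in>I. f i x)"
proof (induction I rule: finite_induct)
  case (insert i I)
  have "C_k k (\<lambda>x. f i x * (\<Prod>i\<in>I. f i x))"
    using insert by (intro C_k_mult) simp_all
  then show ?case using insert by simp
qed simp

lemma C_k_reflect: "C_k k f \<Longrightarrow> C_k k (\<lambda>y. f (x - y))"
proof (induction k arbitrary: f)
  case 0
  have "continuous_on UNIV (\<lambda>y. x - y)" by (intro continuous_intros)
  then show ?case using 0 continuous_on_compose2[of UNIV f UNIV "\<lambda>y. x - y"] by simp
next
  case (Suc k)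
  have d: "((\<lambda>y. f (x - y)) has_derivative (\<lambda>h. frechet_derivative f (at (x - y)) (- h))) (at y)" for y
    by (rule has_derivative_compose[OF _ C_k_Suc_has_derivative(1)[OF Suc.prems], where f = "\<lambda>y. x - y"])
      (auto intro!: derivative_eq_intros)
  show ?case
  proof (rule C_k_SucI[OF d])
    fix j
    have "linear (frechet_derivative f (at z))" for z
      using C_k_Suc_has_derivative(1)[OF Suc.prems] by (rule has_derivative_linear)
    then have "(\<lambda>y. frechet_derivative f (at (x - y)) (- axis j 1)) = (\<lambda>y. -1 * partial_deriv j f (x - y))"
      by (simp add: partial_deriv_def linear_neg)
    moreover have "C_k k (\<lambda>y. -1 * partial_deriv j f (x - y))"
      by (rule C_k_mult[OF C_k_const Suc.IH]) (use Suc.prems in simp)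
    ultimately show "C_k k (\<lambda>y. frechet_derivative f (at (x - y)) (- axis j 1))" by simp
  qed
qed

lemma partial_deriv_reflect:
  assumes "C_k (Suc k) f"
  shows "partial_deriv j (\<lambda>y. f (x - y)) y = - partial_deriv j f (x - y)"
proof -
  have d: "((\<lambda>y. f (x - y)) has_derivative (\<lambda>h. frechet_derivative f (at (x - y)) (- h))) (at y)"
    by (rule has_derivative_compose[OF _ C_k_Suc_has_derivative(1)[OF assms], where f = "\<lambda>y. x - y"])
      (auto intro!: derivative_eq_intros)
  have "linear (frechet_derivative f (at (x - y)))"
    using C_k_Suc_has_derivative(1)[OF assms] by (rule has_derivative_linear)
  then show ?thesis
    unfolding partial_deriv_eq[OF d] by (simp only: partial_deriv_def linear_neg)
qed

lemma C_k_flat_exp: "C_k k (\<lambda>x. flat_exp P (a + b * x $ i))"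
proof (induction k arbitrary: P)
  have d: "((\<lambda>x::real^'a. flat_exp P (a + b * x $ i)) has_derivative (\<lambda>h. flat_exp (flat_exp_deriv P) (a + b * x $ i) * (b * h $ i))) (at x)" for P x
    by (rule has_derivative_compose[where f = "\<lambda>x. a + b * x $ i" and g = "flat_exp P" and g' = "\<lambda>h. flat_exp (flat_exp_deriv P) (a + b * x $ i) * h"])
      (auto intro!: derivative_eq_intros bounded_linear_imp_has_derivative flat_exp_has_derivative[THEN has_field_derivative_imp_has_derivative])
  {
    case 0
    show ?case using d by (auto intro!: continuous_at_imp_continuous_on has_derivative_continuous)
  next
    case (Suc k)
    show ?case
      by (rule C_k_SucI[OF d]) (intro C_k_mult Suc C_k_const)
  }
qed

definition mollifier :: "real \<Rightarrow> (real^'n::finite \<Rightarrow> real) \<Rightarrow> bool" where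
  "mollifier \<delta> \<eta> \<longleftrightarrow> (\<forall>k. C_k k \<eta>) \<and> (\<forall>x. 0 \<le> \<eta> x) \<and> (\<forall>x. norm x \<ge> \<delta> \<longrightarrow> \<eta> x = 0) \<and>
     integrable lborel \<eta> \<and> (\<integral>x. \<eta> x \<partial>lborel) = 1"

text \<open>In each coordinate, \<open>e(d + t) e(d - t)\<close> with \<open>e(t) = exp(-1/t)\<close> for \<open>t > 0\<close> is supported in \<open>[-d, d]\<close>; the
product over the coordinates is divided by its integral.\<close>

lemma mollifier_exists:
  assumes \<delta>: "\<delta> > 0"
  shows "\<exists>\<eta>::real^'n::finite \<Rightarrow> real. mollifier \<delta> \<eta>"
proof -
  \<comment> \<open>The cube of half side \<open>d\<close> lies in the ball of radius \<open>\<delta>\<close>, as the norm is at most the sum of the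
    absolute values of the coordinates.\<close>
  define d where "d = \<delta> / real CARD('n)"
  have d: "d > 0" using \<delta> by (simp add: d_def)
  define \<psi> :: "real^'n \<Rightarrow> real" where
    "\<psi> = (\<lambda>x. \<Prod>i\<in>UNIV. flat_exp 1 (d + 1 * x $ i) * flat_exp 1 (d + (-1) * x $ i))"
  have C: "C_k k \<psi>" for k unfolding \<psi>_def by (intro C_k_prod C_k_mult C_k_flat_exp) auto
  have f1: "flat_exp 1 t \<ge> 0" "flat_exp 1 t = 0 \<longleftrightarrow> t \<le> 0" for t by (auto simp: flat_exp_def)
  have pos: "\<psi> x \<ge> 0" for x unfolding \<psi>_def by (intro prod_nonneg) (auto simp: f1)
  have supp: "\<psi> x = 0" if "norm x \<ge> \<delta>" for x
  proof -
    have "\<exists>i. \<bar>x $ i\<bar> \<ge> d"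
    proof (rule ccontr)
      assume "\<not> ?thesis"
      then have "(\<Sum>i\<in>UNIV. \<bar>x $ i\<bar>) < (\<Sum>i\<in>(UNIV::'n set). d)" by (intro sum_strict_mono) (auto simp: not_le)
      then have "norm x < \<delta>" using norm_le_l1_cart[of x] by (simp add: d_def)
      then show False using that by simp
    qed
    then obtain i where "\<bar>x $ i\<bar> \<ge> d" ..
    then have "flat_exp 1 (d + 1 * x $ i) * flat_exp 1 (d + (-1) * x $ i) = 0"
      by (simp add: f1 abs_if split: if_splits)
    then show ?thesis unfolding \<psi>_def by (intro prod_zero) auto
  qed
  have cont: "continuous_on UNIV \<psi>" using C[of 0] by simp
  then have [measurable]: "\<psi> \<in> borel_measurable borel" by (rule borel_measurable_continuous_onI)
  have "integrable lborel (\<lambda>x. indicator (cball 0 \<delta>) x *\<^sub>R \<psi> x)"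
    by (rule borel_integrable_compact) (auto intro: continuous_on_subset[OF cont])
  moreover have "(\<lambda>x. indicator (cball 0 \<delta>) x *\<^sub>R \<psi> x) = \<psi>"
    using supp by (auto simp: indicator_def fun_eq_iff)
  ultimately have int: "integrable lborel \<psi>" by simp
  have "(\<integral>x. \<psi> x \<partial>lborel) \<noteq> 0"
  proof
    assume "(\<integral>x. \<psi> x \<partial>lborel) = 0"
    then have "AE x in lborel. \<psi> x = 0" using int pos by (simp add: integral_nonneg_eq_0_iff_AE)
    then have "{x. \<psi> x \<noteq> 0} \<in> null_sets lborel"
      by (subst AE_iff_null_sets) auto
    then have "negligible {x. \<psi> x \<noteq> 0}"
      by (simp add: negligible_iff_null_sets null_sets_completionI)
    moreover have "open {x. \<psi> x \<noteq> 0}"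
      using cont by (intro open_Collect_neq) auto
    moreover have "0 \<in> {x. \<psi> x \<noteq> 0}" using d by (simp add: \<psi>_def f1)
    ultimately show False using open_not_negligible by blast
  qed
  moreover have "(\<integral>x. \<psi> x \<partial>lborel) \<ge> 0" using pos by simp
  ultimately have Z: "(\<integral>x. \<psi> x \<partial>lborel) > 0" by simp
  show ?thesis
    using C pos supp int Z
    by (intro exI[of _ "\<lambda>x. inverse (\<integral>x. \<psi> x \<partial>lborel) * \<psi> x"]) (auto simp: mollifier_def intro!: C_k_mult)
qed

section \<open>Convolution\<close>

lemma borel_measurable_vec_nth [measurable (raw)]:
  fixes f :: "'a \<Rightarrow> ('b::euclidean_space)^'n"
  assumes "f \<in> borel_measurable M"
  shows "(\<lambda>x. f x $ i) \<in> borel_measurable M"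
  by (rule measurable_compose[OF assms]) (intro borel_measurable_continuous_onI continuous_intros)

lemma compact_support_bounded_uniformly_continuous:
  fixes g :: "'a::euclidean_space \<Rightarrow> real"
  assumes g: "continuous_on UNIV g" and supp: "\<And>x. norm x \<ge> R \<Longrightarrow> g x = 0"
  shows "uniformly_continuous_on UNIV g" "\<exists>B\<ge>0. \<forall>x. \<bar>g x\<bar> \<le> B"
proof -
  let ?K = "cball 0 (R + 1) :: 'a set"
  have uc: "uniformly_continuous_on ?K g"
    by (intro compact_uniformly_continuous continuous_on_subset[OF g]) auto
  show "uniformly_continuous_on UNIV g"
    unfolding uniformly_continuous_on_def
  proof (intro allI impI)
    fix e :: real assume "e > 0"
    then obtain d where d: "d > 0" "\<And>x x'. x \<in> ?K \<Longrightarrow> x' \<in> ?K \<Longrightarrow> dist x' x < d \<Longrightarrow> dist (g x') (g x) < e"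
      using uc unfolding uniformly_continuous_on_def by metis
    have "dist (g x') (g x) < e" if dx: "dist x' x < min d 1" for x x'
    proof (cases "x \<in> ?K \<and> x' \<in> ?K")
      case False
      have "\<bar>norm x' - norm x\<bar> \<le> dist x' x" by (simp add: dist_norm norm_triangle_ineq3)
      with False dx have "norm x \<ge> R" "norm x' \<ge> R" by auto
      then show ?thesis using supp \<open>e > 0\<close> by simp
    qed (use d dx in auto)
    then show "\<exists>d>0. \<forall>x\<in>UNIV. \<forall>x'\<in>UNIV. dist x' x < d \<longrightarrow> dist (g x') (g x) < e"
      using d by (intro exI[of _ "min d 1"]) auto
  qed
  have "compact (g ` ?K)" by (intro compact_continuous_image continuous_on_subset[OF g]) auto
  then have "bounded (g ` ?K)" by (rule compact_imp_bounded)
  then obtain B where "\<forall>y\<in>g ` ?K. norm y \<le> B" unfolding bounded_iff by (rule exE)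
  then have "\<bar>g x\<bar> \<le> B" if "x \<in> ?K" for x using that by simp
  then have "\<bar>g x\<bar> \<le> max B 0" for x
    using supp[of x] by (cases "x \<in> ?K") (simp_all add: le_max_iff_disj)
  then show "\<exists>B\<ge>0. \<forall>x. \<bar>g x\<bar> \<le> B" by (intro exI[of _ "max B 0"]) auto
qed

lemma mollifierD:
  assumes "mollifier \<delta> \<eta>"
  shows "C_k k \<eta>" "0 \<le> \<eta> x" "norm x \<ge> \<delta> \<Longrightarrow> \<eta> x = 0" "integrable lborel \<eta>" "(\<integral>x. \<eta> x \<partial>lborel) = 1"
    "continuous_on UNIV \<eta>" "\<eta> \<in> borel_measurable borel" "\<exists>B. \<forall>x. \<bar>\<eta> x\<bar> \<le> B"
proof -
  show s: "\<eta> x = 0" if "norm x \<ge> \<delta>" for x using that assms unfolding mollifier_def by blast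
  show c: "continuous_on UNIV \<eta>" using assms C_k.simps(1)[of \<eta>] unfolding mollifier_def by blast
  then show "\<eta> \<in> borel_measurable borel" by (rule borel_measurable_continuous_onI)
  show "\<exists>B. \<forall>x. \<bar>\<eta> x\<bar> \<le> B" using compact_support_bounded_uniformly_continuous(2)[OF c s] by auto
qed (use assms in \<open>simp_all only: mollifier_def\<close>)

lemma mollifier_partial_deriv:
  assumes "mollifier \<delta> \<eta>"
  shows "continuous_on UNIV (partial_deriv j \<eta>)" "norm x > \<delta> \<Longrightarrow> partial_deriv j \<eta> x = 0"
    "partial_deriv j \<eta> \<in> borel_measurable borel" "\<exists>B. \<forall>x. \<bar>partial_deriv j \<eta> x\<bar> \<le> B"
proof -
  show c: "continuous_on UNIV (partial_deriv j \<eta>)" using mollifierD(1)[OF assms, of "Suc 0"] by simp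
  show s: "partial_deriv j \<eta> x = 0" if x: "norm x > \<delta>" for x
  proof -
    have "(\<eta> has_derivative (\<lambda>h. 0)) (at x)"
      by (rule has_derivative_transform_within_open[of "\<lambda>_. 0" _ _ _ "{x. norm x > \<delta>}"])
        (use assms x in \<open>auto simp: mollifier_def open_Collect_less continuous_intros\<close>)
    then show ?thesis by (simp add: partial_deriv_eq)
  qed
  show "partial_deriv j \<eta> \<in> borel_measurable borel" using c by (rule borel_measurable_continuous_onI)
  show "\<exists>B. \<forall>x. \<bar>partial_deriv j \<eta> x\<bar> \<le> B"
    using compact_support_bounded_uniformly_continuous(2)[OF c, of "\<delta> + 1"] s by auto
qed

definition convolve :: "('a::euclidean_space \<Rightarrow> real) \<Rightarrow> ('a \<Rightarrow> 'b::euclidean_space) \<Rightarrow> 'a \<Rightarrow> 'b" where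
  "convolve g f x = (\<integral>y. g (x - y) *\<^sub>R f y \<partial>lborel)"

lemma convolve_integrable:
  fixes g :: "'a::euclidean_space \<Rightarrow> real" and f :: "'a \<Rightarrow> 'b::euclidean_space"
  assumes g: "g \<in> borel_measurable borel" "\<And>x. \<bar>g x\<bar> \<le> B" and f: "integrable lborel f"
  shows "integrable lborel (\<lambda>y. g (x - y) *\<^sub>R f y)"
proof (rule Bochner_Integration.integrable_bound)
  show "integrable lborel (\<lambda>y. B * norm (f y))" using f by auto
  have "B \<ge> 0" using g(2)[of undefined] by linarith
  then show "AE y in lborel. norm (g (x - y) *\<^sub>R f y) \<le> norm (B * norm (f y))"
    using g(2) by (auto simp: abs_mult intro!: mult_right_mono)
qed (use g f in auto)

lemma norm_integral_scaleR_le: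
  fixes g :: "'a::euclidean_space \<Rightarrow> real" and f :: "'a \<Rightarrow> 'b::euclidean_space"
  assumes f: "integrable lborel f" and g: "\<And>y. \<bar>g y\<bar> \<le> e"
  shows "norm (\<integral>y. g y *\<^sub>R f y \<partial>lborel) \<le> e * (\<integral>y. norm (f y) \<partial>lborel)"
proof (cases "integrable lborel (\<lambda>y. g y *\<^sub>R f y)")
  case True
  have "norm (\<integral>y. g y *\<^sub>R f y \<partial>lborel) \<le> (\<integral>y. e * norm (f y) \<partial>lborel)"
    using True f g by (intro Bochner_Integration.integral_norm_bound_integral) (auto intro!: mult_right_mono)
  then show ?thesis by simp
next
  case False
  have "e \<ge> 0" using g[of undefined] by linarith
  then show ?thesis using False by (simp add: not_integrable_integral_eq)
qed

lemma continuous_on_convolve: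
  fixes g :: "'a::euclidean_space \<Rightarrow> real" and f :: "'a \<Rightarrow> 'b::euclidean_space"
  assumes g: "continuous_on UNIV g" "\<And>x. norm x \<ge> R \<Longrightarrow> g x = 0" and f: "integrable lborel f"
  shows "continuous_on UNIV (convolve g f)"
proof -
  note uc = compact_support_bounded_uniformly_continuous[OF g]
  obtain B where B: "\<And>x. \<bar>g x\<bar> \<le> B" using uc(2) by auto
  have gm: "g \<in> borel_measurable borel" using g by (intro borel_measurable_continuous_onI)
  note int = convolve_integrable[OF gm B f]
  define I where "I = (\<integral>y. norm (f y) \<partial>lborel)"
  have I: "I \<ge> 0" by (simp add: I_def)
  show ?thesis
    unfolding continuous_on_iff
  proof (intro ballI allI impI)
    fix x :: 'a and e :: real assume e: "e > 0"
    have "e / (I + 1) > 0" using e I by simp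
    then obtain d where d: "d > 0" "\<And>z z'. dist z' z < d \<Longrightarrow> dist (g z') (g z) < e / (I + 1)"
      using uc(1) unfolding uniformly_continuous_on_def by (meson UNIV_I)
    have "dist (convolve g f x') (convolve g f x) < e" if "dist x' x < d" for x'
    proof -
      have "dist (convolve g f x') (convolve g f x) = norm (\<integral>y. (g (x' - y) - g (x - y)) *\<^sub>R f y \<partial>lborel)"
        using int by (simp add: convolve_def dist_norm scaleR_diff_left)
      also have "\<dots> \<le> e / (I + 1) * I"
        unfolding I_def
      proof (rule norm_integral_scaleR_le[OF f])
        fix y
        have "dist (x' - y) (x - y) < d" using that by (simp add: dist_norm)
        from d(2)[OF this] show "\<bar>g (x' - y) - g (x - y)\<bar> \<le> e / ((\<integral>y. norm (f y) \<partial>lborel) + 1)"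
          by (simp add: dist_real_def I_def)
      qed
      also have "\<dots> < e" using e I by (simp add: field_simps)
      finally show ?thesis .
    qed
    then show "\<exists>d>0. \<forall>x'\<in>UNIV. dist x' x < d \<longrightarrow> dist (convolve g f x') (convolve g f x) < e" using d by auto
  qed
qed

text \<open>The remainder of the linearization is small uniformly in the base point, because the partial derivatives
have compact support and are therefore uniformly continuous. Uniformity allows the remainder to be
integrated against an arbitrary integrable function.\<close>

lemma C1_uniform_linearization:
  fixes \<eta> :: "real^'n \<Rightarrow> real"
  assumes \<eta>: "mollifier \<delta> \<eta>" and e: "e > 0"
  shows "\<exists>d>0. \<forall>z h. norm h < d \<longrightarrow> \<bar>\<eta> (z + h) - \<eta> z - (\<Sum>j\<in>UNIV. h $ j * partial_deriv j \<eta> z)\<bar> \<le> e * norm h"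
proof -
  define e' where "e' = e / real CARD('n)"
  have e': "e' > 0" using e by (simp add: e'_def)
  note C = mollifierD(1)[OF \<eta>, of "Suc 0"]
  have "\<exists>d>0. \<forall>z z'. dist z' z < d \<longrightarrow> dist (partial_deriv j \<eta> z') (partial_deriv j \<eta> z) < e'" for j
    using compact_support_bounded_uniformly_continuous(1)[of "partial_deriv j \<eta>" "\<delta> + 1"] mollifier_partial_deriv[OF \<eta>] e'
    unfolding uniformly_continuous_on_def by auto
  then obtain d where d: "\<And>j. d j > 0" "\<And>j z z'. dist z' z < d j \<Longrightarrow> dist (partial_deriv j \<eta> z') (partial_deriv j \<eta> z) < e'"
    by metis
  define D where "D = Min (range d)"
  have D: "D > 0" "\<And>j. D \<le> d j" using d(1) by (auto simp: D_def)
  show ?thesis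
  proof (intro exI[of _ D] conjI D(1) allI impI)
    fix z h :: "real^'n" assume h: "norm h < D"
    let ?f' = "\<lambda>x k. \<Sum>j\<in>UNIV. k $ j * partial_deriv j \<eta> x"
    have "norm (\<eta> (z + h) - \<eta> z - ?f' z (z + h - z)) \<le> norm (z + h - z) * e"
    proof (rule differentiable_bound_linearization[where S = "ball z D"])
      show "z + t *\<^sub>R (z + h - z) \<in> ball z D" if "t \<in> {0..1}" for t
      proof -
        have "\<bar>t\<bar> * norm h \<le> norm h" using that by (intro mult_left_le_one_le) auto
        then show ?thesis using h by (simp add: dist_norm)
      qed
      show "(\<eta> has_derivative ?f' x) (at x within ball z D)" for x
        by (rule has_derivative_at_withinI[OF C_k_Suc_has_derivative(2)[OF C]])
      show "onorm (?f' x - ?f' z) \<le> e" if "x \<in> ball z D" for x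
      proof (rule onorm_le)
        fix k :: "real^'n"
        have "norm ((?f' x - ?f' z) k) = \<bar>\<Sum>j\<in>UNIV. k $ j * (partial_deriv j \<eta> x - partial_deriv j \<eta> z)\<bar>"
          by (simp add: sum_subtractf right_diff_distrib)
        also have "\<dots> \<le> (\<Sum>j\<in>UNIV. \<bar>k $ j * (partial_deriv j \<eta> x - partial_deriv j \<eta> z)\<bar>)" by (rule sum_abs)
        also have "\<dots> \<le> (\<Sum>j\<in>(UNIV::'n set). norm k * e')"
        proof (rule sum_mono)
          fix j
          have "dist x z < d j" using that D(2)[of j] by (simp add: dist_commute)
          from d(2)[OF this] show "\<bar>k $ j * (partial_deriv j \<eta> x - partial_deriv j \<eta> z)\<bar> \<le> norm k * e'"
            unfolding abs_mult by (intro mult_mono component_le_norm_cart) (auto simp: dist_real_def)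
        qed
        also have "\<dots> = e * norm k" by (simp add: e'_def)
        finally show "norm ((?f' x - ?f' z) k) \<le> e * norm k" .
      qed
    qed (use D in simp)
    then show "\<bar>\<eta> (z + h) - \<eta> z - ?f' z h\<bar> \<le> e * norm h" by (simp add: mult.commute)
  qed
qed

lemma has_C1_gradient_convolve:
  fixes f :: "real^'n::finite \<Rightarrow> real^'m::finite"
  assumes \<eta>: "mollifier \<delta> \<eta>" and f: "integrable lborel f"
  shows "has_C1_gradient (convolve \<eta> f) (\<lambda>x. \<chi> i j. convolve (partial_deriv j \<eta>) (\<lambda>y. f y $ i) x)"
proof -
  have fi: "integrable lborel (\<lambda>y. f y $ i)" for i
    using f by (rule integrable_bounded_linear[OF bounded_linear_vec_nth])
  note pd = mollifier_partial_deriv[OF \<eta>]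
  obtain B where B: "\<And>x. \<bar>\<eta> x\<bar> \<le> B" using mollifierD(8)[OF \<eta>] by blast
  obtain B' where B': "\<And>j x. \<bar>partial_deriv j \<eta> x\<bar> \<le> B' j" using pd(4) by metis
  note [measurable] = mollifierD(7)[OF \<eta>] pd(3)
  have int: "integrable lborel (\<lambda>y. \<eta> (x - y) *\<^sub>R f y)" for x
    by (rule convolve_integrable[OF _ B f]) measurable
  have int': "integrable lborel (\<lambda>y. partial_deriv j \<eta> (x - y) *\<^sub>R f y)" for j x
    by (rule convolve_integrable[OF _ B' f]) measurable
  have inti: "integrable lborel (\<lambda>y. partial_deriv j \<eta> (x - y) *\<^sub>R f y $ i)" for i j x
    by (rule convolve_integrable[OF _ B' fi]) measurable
  let ?D = "\<lambda>x. \<chi> i j. convolve (partial_deriv j \<eta>) (\<lambda>y. f y $ i) x"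
  have Dh: "?D x *v h = (\<integral>y. (\<Sum>j\<in>UNIV. h $ j * partial_deriv j \<eta> (x - y)) *\<^sub>R f y \<partial>lborel)" (is "_ = ?R") for x h
  proof (rule vec_eq_iff[THEN iffD2], rule allI)
    fix i
    have "integrable lborel (\<lambda>y. \<Sum>j\<in>UNIV. h $ j *\<^sub>R (partial_deriv j \<eta> (x - y) *\<^sub>R f y))"
      using int' by (intro Bochner_Integration.integrable_sum integrable_scaleR_right) auto
    then have "integrable lborel (\<lambda>y. (\<Sum>j\<in>UNIV. h $ j * partial_deriv j \<eta> (x - y)) *\<^sub>R f y)"
      by (simp add: scaleR_sum_left)
    then have "?R $ i = (\<integral>y. ((\<Sum>j\<in>UNIV. h $ j * partial_deriv j \<eta> (x - y)) *\<^sub>R f y) $ i \<partial>lborel)"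
      by (rule integral_bounded_linear[OF bounded_linear_vec_nth, symmetric])
    also have "\<dots> = (\<integral>y. (\<Sum>j\<in>UNIV. h $ j * (partial_deriv j \<eta> (x - y) *\<^sub>R f y $ i)) \<partial>lborel)"
      by (simp add: sum_distrib_right mult.assoc)
    also have "\<dots> = (\<Sum>j\<in>UNIV. h $ j * convolve (partial_deriv j \<eta>) (\<lambda>y. f y $ i) x)"
      unfolding convolve_def using inti
      by (subst Bochner_Integration.integral_sum) auto
    also have "\<dots> = (?D x *v h) $ i" by (simp add: matrix_vector_mult_def mult.commute)
    finally show "(?D x *v h) $ i = ?R $ i" by simp
  qed
  define I where "I = (\<integral>y. norm (f y) \<partial>lborel)"
  have I: "I \<ge> 0" by (simp add: I_def)
  show ?thesis
    unfolding has_C1_gradient_def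
  proof (intro conjI allI)
    show "continuous_on UNIV ?D"
      by (intro continuous_on_vec_lambda continuous_on_convolve[where R = "\<delta> + 1"] fi) (auto simp: pd)
    fix x
    show "(convolve \<eta> f has_derivative (*v) (?D x)) (at x)"
      unfolding has_derivative_at_alt
    proof (intro conjI allI impI)
      show "bounded_linear ((*v) (?D x))" by (rule matrix_vector_mul_bounded_linear)
      fix e :: real assume e: "e > 0"
      have "e / (I + 1) > 0" using e I by simp
      from C1_uniform_linearization[OF \<eta> this] obtain d where d: "d > 0"
        "\<And>z h. norm h < d \<Longrightarrow> \<bar>\<eta> (z + h) - \<eta> z - (\<Sum>j\<in>UNIV. h $ j * partial_deriv j \<eta> z)\<bar> \<le> e / (I + 1) * norm h"
        by auto
      have "norm (convolve \<eta> f x' - convolve \<eta> f x - ?D x *v (x' - x)) \<le> e * norm (x' - x)" if x': "norm (x' - x) < d" for x'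
      proof -
        let ?h = "x' - x"
        let ?\<phi> = "\<lambda>y. \<eta> (x' - y) - \<eta> (x - y) - (\<Sum>j\<in>UNIV. ?h $ j * partial_deriv j \<eta> (x - y))"
        have i3: "integrable lborel (\<lambda>y. (\<Sum>j\<in>UNIV. ?h $ j * partial_deriv j \<eta> (x - y)) *\<^sub>R f y)"
        proof -
          have "integrable lborel (\<lambda>y. \<Sum>j\<in>UNIV. ?h $ j *\<^sub>R (partial_deriv j \<eta> (x - y) *\<^sub>R f y))"
            using int' by (intro Bochner_Integration.integrable_sum integrable_scaleR_right) auto
          then show ?thesis by (simp add: scaleR_sum_left)
        qed
        have "convolve \<eta> f x' - convolve \<eta> f x - ?D x *v ?h = (\<integral>y. ?\<phi> y *\<^sub>R f y \<partial>lborel)"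
          unfolding Dh unfolding scaleR_diff_left convolve_def
          using int[of x] int[of x'] i3
          by (simp only: Bochner_Integration.integral_diff Bochner_Integration.integrable_diff)
        also have "norm \<dots> \<le> (e / (I + 1) * norm ?h) * I"
          unfolding I_def
        proof (rule norm_integral_scaleR_le[OF f])
          fix y
          have "x - y + ?h = x' - y" by simp
          with d(2)[OF x', of "x - y"] show "\<bar>?\<phi> y\<bar> \<le> e / ((\<integral>y. norm (f y) \<partial>lborel) + 1) * norm ?h"
            by (simp add: I_def)
        qed
        also have "\<dots> = e * norm ?h * (I / (I + 1))" by simp
        also have "\<dots> \<le> e * norm ?h" using I e by (intro mult_left_le) (auto simp: field_simps)
        finally show ?thesis .
      qed
      then show "\<exists>d>0. \<forall>y. norm (y - x) < d \<longrightarrow> norm (convolve \<eta> f y - convolve \<eta> f x - ?D x *v (y - x)) \<le> e * norm (y - x)"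
        using d by auto
    qed
  qed
qed

text \<open>The function \<open>y \<mapsto> \<eta>(x - y)\<close> is a test function on \<open>U\<close>, and its partial derivatives are those of \<open>\<eta>\<close>
with opposite sign; this sign cancels the one in the definition of the weak gradient. So derivatives of the mollified
map are mollified weak derivatives.\<close>

lemma weak_gradient_convolve:
  fixes u :: "real^'n::finite \<Rightarrow> real^'m::finite"
  assumes \<eta>: "mollifier \<delta> \<eta>" and w: "has_weak_gradient U u G" and x: "cball x \<delta> \<subseteq> U"
    and f: "f \<in> borel_measurable borel" "AE y in lborel. y \<in> cball x \<delta> \<longrightarrow> f y = u y"
    and g: "g \<in> borel_measurable borel" "AE y in lborel. y \<in> cball x \<delta> \<longrightarrow> g y = G y"
  shows "convolve (partial_deriv j \<eta>) (\<lambda>y. f y $ i) x = convolve \<eta> (\<lambda>y. g y $ i $ j) x"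
proof -
  let ?\<phi> = "\<lambda>y. \<eta> (x - y)" and ?C = "cball x \<delta>"
  note pd = mollifier_partial_deriv[OF \<eta>]
  note C = mollifierD(1)[OF \<eta>] and \<eta>s = mollifierD(3)[OF \<eta>]
  note [measurable] = mollifierD(7)[OF \<eta>] pd(3)
  note [measurable] = f(1) g(1)
  have pd\<phi>: "partial_deriv j ?\<phi> y = - partial_deriv j \<eta> (x - y)" for y
    by (rule partial_deriv_reflect[OF C])
  have "norm (x - y) \<le> \<delta>" if "\<eta> (x - y) \<noteq> 0" for y
    using that \<eta>s[of "x - y"] by (cases "norm (x - y) \<le> \<delta>") auto
  then have supp: "{y. ?\<phi> y \<noteq> 0} \<subseteq> ?C" by (auto simp: dist_norm)
  then have "closure {y. ?\<phi> y \<noteq> 0} \<subseteq> ?C" by (rule closure_minimal) simp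
  moreover have "compact (closure {y. ?\<phi> y \<noteq> 0})"
    using supp by (meson bounded_cball bounded_subset compact_closure)
  ultimately have "test_function U ?\<phi>"
    using x C by (auto simp: test_function_def compactly_contained_def intro: C_k_reflect)
  then have eq: "(LINT y:U|lebesgue. u y $ i * partial_deriv j ?\<phi> y) = - (LINT y:U|lebesgue. G y $ i $ j * ?\<phi> y)"
    using w by (auto simp: has_weak_gradient_def)
  have um: "set_integrable lebesgue ?C u" "set_integrable lebesgue ?C G"
    using w x by (auto simp: has_weak_gradient_def locally_integrable_def)
  have mlb: "h \<in> borel_measurable lebesgue" if "h \<in> borel_measurable borel" for h :: "real^'n \<Rightarrow> real"
    using that by (intro measurable_completion) simp
  have "(LINT y:U|lebesgue. u y $ i * partial_deriv j ?\<phi> y) = (\<integral>y. - (partial_deriv j \<eta> (x - y) * (indicator ?C y *\<^sub>R u y) $ i) \<partial>lebesgue)"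
    unfolding set_lebesgue_integral_def
  proof (rule Bochner_Integration.integral_cong)
    fix y
    show "indicator U y *\<^sub>R (u y $ i * partial_deriv j ?\<phi> y) = - (partial_deriv j \<eta> (x - y) * (indicator ?C y *\<^sub>R u y) $ i)"
      using pd(2)[of "x - y" j] x by (auto simp: pd\<phi> indicator_def dist_norm)
  qed simp
  also have "\<dots> = (\<integral>y. - (partial_deriv j \<eta> (x - y) * f y $ i) \<partial>lebesgue)"
  proof (rule integral_cong_AE)
    have ms: "(\<lambda>y. (indicator ?C y *\<^sub>R u y) $ i) \<in> borel_measurable lebesgue"
      by (rule measurable_compose[OF borel_measurable_integrable[OF um(1)[unfolded set_integrable_def]]]) measurable
    show "(\<lambda>y. - (partial_deriv j \<eta> (x - y) * (indicator ?C y *\<^sub>R u y) $ i)) \<in> borel_measurable lebesgue"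
      by (intro borel_measurable_uminus[OF borel_measurable_times[OF mlb ms]]) measurable
    show "(\<lambda>y. - (partial_deriv j \<eta> (x - y) * f y $ i)) \<in> borel_measurable lebesgue" by (intro mlb) measurable
    show "AE y in lebesgue. - (partial_deriv j \<eta> (x - y) * (indicator ?C y *\<^sub>R u y) $ i) = - (partial_deriv j \<eta> (x - y) * f y $ i)"
      using AE_completion[OF f(2)]
    proof eventually_elim
      case (elim y)
      then show ?case using pd(2)[of "x - y" j] by (auto simp: indicator_def dist_norm)
    qed
  qed
  also have "\<dots> = - convolve (partial_deriv j \<eta>) (\<lambda>y. f y $ i) x"
    unfolding convolve_def by (subst integral_completion) auto
  finally have 1: "(LINT y:U|lebesgue. u y $ i * partial_deriv j ?\<phi> y) = - convolve (partial_deriv j \<eta>) (\<lambda>y. f y $ i) x" .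
  have "(LINT y:U|lebesgue. G y $ i $ j * ?\<phi> y) = (\<integral>y. \<eta> (x - y) * (indicator ?C y *\<^sub>R G y) $ i $ j \<partial>lebesgue)"
    unfolding set_lebesgue_integral_def
  proof (rule Bochner_Integration.integral_cong)
    fix y
    show "indicator U y *\<^sub>R (G y $ i $ j * ?\<phi> y) = \<eta> (x - y) * (indicator ?C y *\<^sub>R G y) $ i $ j"
      using \<eta>s[of "x - y"] x by (auto simp: indicator_def dist_norm)
  qed simp
  also have "\<dots> = (\<integral>y. \<eta> (x - y) * g y $ i $ j \<partial>lebesgue)"
  proof (rule integral_cong_AE)
    have ms: "(\<lambda>y. (indicator ?C y *\<^sub>R G y) $ i $ j) \<in> borel_measurable lebesgue"
      by (rule measurable_compose[OF borel_measurable_integrable[OF um(2)[unfolded set_integrable_def]]]) measurable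
    show "(\<lambda>y. \<eta> (x - y) * (indicator ?C y *\<^sub>R G y) $ i $ j) \<in> borel_measurable lebesgue"
      by (intro borel_measurable_times[OF mlb ms]) measurable
    show "(\<lambda>y. \<eta> (x - y) * g y $ i $ j) \<in> borel_measurable lebesgue" by (intro mlb) measurable
    show "AE y in lebesgue. \<eta> (x - y) * (indicator ?C y *\<^sub>R G y) $ i $ j = \<eta> (x - y) * g y $ i $ j"
      using AE_completion[OF g(2)]
    proof eventually_elim
      case (elim y)
      then show ?case using \<eta>s[of "x - y"] by (auto simp: indicator_def dist_norm)
    qed
  qed
  also have "\<dots> = convolve \<eta> (\<lambda>y. g y $ i $ j) x"
    unfolding convolve_def by (subst integral_completion) auto
  finally show ?thesis using 1 eq by simp
qed

section \<open>Approximation in the p-th mean\<close>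

lemma Lp_energy_translate:
  fixes f :: "'a::euclidean_space \<Rightarrow> 'b::euclidean_space"
  assumes [measurable]: "f \<in> borel_measurable borel"
  shows "Lp_energy p UNIV (\<lambda>x. f (x - h)) = Lp_energy p UNIV f"
proof -
  have "Lp_energy p UNIV f = (\<integral>\<^sup>+x. ennreal (norm (f x) powr p) \<partial>distr lborel borel ((+) (- h)))"
    by (simp add: Lp_energy_def lborel_distr_plus)
  also have "\<dots> = Lp_energy p UNIV (\<lambda>x. f (x - h))"
    by (subst nn_integral_distr) (auto simp: Lp_energy_def)
  finally show ?thesis by simp
qed

definition Lp_translation_continuous :: "real \<Rightarrow> ('a::euclidean_space \<Rightarrow> 'b::euclidean_space) \<Rightarrow> bool" where
  "Lp_translation_continuous p f \<longleftrightarrow> f \<in> borel_measurable borel \<and>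
     (\<forall>e>0. \<exists>d>0. \<forall>h. norm h < d \<longrightarrow> Lp_energy p UNIV (\<lambda>x. f (x - h) - f x) \<le> ennreal e)"

lemma Lp_translation_continuous_scaledI:
  assumes "f \<in> borel_measurable borel" "K > 0"
    and "\<And>e. e > 0 \<Longrightarrow> \<exists>d>0. \<forall>h. norm h < d \<longrightarrow> Lp_energy p UNIV (\<lambda>x. f (x - h) - f x) \<le> ennreal (K * e)"
  shows "Lp_translation_continuous p f"
  using assms(1) assms(3)[of "e / K" for e] \<open>K > 0\<close> by (simp add: Lp_translation_continuous_def)

lemma Lp_translation_continuous_0: "Lp_translation_continuous p (\<lambda>x. 0)"
  by (auto simp: Lp_translation_continuous_def Lp_energy_def intro!: exI[of _ 1])

text \<open>Approximate \<open>A\<close> by \<open>T \<subseteq> A \<subseteq> S\<close> with \<open>T\<close> compact and \<open>S\<close> open. A shift shorter than the distance from \<open>T\<close>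
to the complement of \<open>S\<close> keeps \<open>T\<close> inside \<open>S\<close>, so the indicator changes at \<open>x\<close> only if \<open>x\<close> or its
translate lies in the small set \<open>S - T\<close>.\<close>

lemma Lp_translation_continuous_indicator:
  fixes A :: "'a::euclidean_space set" and c :: "'b::euclidean_space"
  assumes A: "A \<in> sets borel" "bounded A"
  shows "Lp_translation_continuous p (\<lambda>x. indicator A x *\<^sub>R c)"
  unfolding Lp_translation_continuous_def
proof (intro conjI allI impI)
  note [measurable] = A(1)
  show "(\<lambda>x. indicator A x *\<^sub>R c) \<in> borel_measurable borel" by measurable
  fix e :: real assume e: "e > 0"
  define a where "a = norm c powr p"
  define r where "r = e / (4 * (a + 1))"
  have a: "a \<ge> 0" and r: "r > 0" using e by (auto simp: a_def r_def add_nonneg_pos)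
  obtain S where S: "open S" "A \<subseteq> S" "emeasure lborel (S - A) < r"
    using outer_regular_lborel[OF A(1) r] by auto
  have "A \<in> sets lebesgue" using A(1) by (simp add: sets_completionI_sets)
  then obtain T where T: "closed T" "T \<subseteq> A" "emeasure lebesgue (A - T) < r"
    using sets_lebesgue_inner_closed[OF _ r] by metis
  have "compact T" using T A(2) by (meson bounded_subset compact_eq_bounded_closed)
  then obtain d where d: "d > 0" "(\<Union>x\<in>T. ball x d) \<subseteq> S"
    using S T by (elim compact_subset_open_imp_ball_epsilon_subset[of T S]) auto
  have [measurable]: "S \<in> sets borel" "T \<in> sets borel" using S T by auto
  have "emeasure lborel (S - T) \<le> emeasure lborel (S - A) + emeasure lborel (A - T)"
    by (rule order_trans[OF emeasure_mono emeasure_subadditive]) auto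
  also have "\<dots> \<le> ennreal r + ennreal r"
    using S(3) T(3) by (intro add_mono) auto
  finally have ST: "emeasure lborel (S - T) \<le> ennreal (2 * r)" using r by (simp flip: ennreal_plus)
  have "Lp_energy p UNIV (\<lambda>x. indicator A (x - h) *\<^sub>R c - indicator A x *\<^sub>R c) \<le> ennreal e" if h: "norm h < d" for h
  proof -
    have near: "y + h \<in> S" "y - h \<in> S" if "y \<in> T" for y
    proof -
      have "y + h \<in> ball y d" "y - h \<in> ball y d" using h by (auto simp: dist_norm)
      then show "y + h \<in> S" "y - h \<in> S" using d(2) that by blast+
    qed
    have "Lp_energy p UNIV (\<lambda>x. indicator A (x - h) *\<^sub>R c - indicator A x *\<^sub>R c)
      \<le> (\<integral>\<^sup>+x. ennreal a * (indicator {x. x - h \<in> S - T} x + indicator (S - T) x) \<partial>lborel)"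
      unfolding Lp_energy_def
    proof (rule nn_integral_mono)
      fix x
      have 1: "x - h \<in> S - T \<or> x \<in> S - T" if "(x - h \<in> A) \<noteq> (x \<in> A)"
        using that near(1)[of "x - h"] near(2)[of x] S(2) T(2) by auto
      show "ennreal (norm (indicator A (x - h) *\<^sub>R c - indicator A x *\<^sub>R c) powr p) * indicator UNIV x
        \<le> ennreal a * (indicator {x. x - h \<in> S - T} x + indicator (S - T) x)"
      proof (cases "(x - h \<in> A) = (x \<in> A)")
        case True
        then show ?thesis by (auto simp: indicator_def)
      next
        case False
        then have "norm (indicator A (x - h) *\<^sub>R c - indicator A x *\<^sub>R c) powr p = a"
          by (auto simp: indicator_def a_def)
        moreover have "(1::ennreal) \<le> indicator {x. x - h \<in> S - T} x + indicator (S - T) x"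
          using 1[OF False] by (auto simp: indicator_def)
        ultimately show ?thesis using mult_left_mono[of "1::ennreal" _ "ennreal a"] by simp
      qed
    qed
    also have "\<dots> = ennreal a * (emeasure lborel {x. x - h \<in> S - T} + emeasure lborel (S - T))"
      by (subst nn_integral_cmult) (auto simp: nn_integral_add)
    also have "emeasure lborel {x. x - h \<in> S - T} = emeasure lborel (S - T)"
      by (rule emeasure_lborel_vimage_minus) auto
    also have "ennreal a * (emeasure lborel (S - T) + emeasure lborel (S - T)) \<le> ennreal a * (ennreal (2 * r) + ennreal (2 * r))"
      by (intro mult_left_mono add_mono ST) auto
    also have "\<dots> = ennreal (a * (4 * r))"
      using a r by (simp add: ennreal_mult[symmetric] ennreal_plus[symmetric] del: ennreal_plus)
    also have "\<dots> \<le> ennreal e" using a e by (intro ennreal_leI) (auto simp: r_def field_simps)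
    finally show ?thesis .
  qed
  then show "\<exists>d>0. \<forall>h. norm h < d \<longrightarrow> Lp_energy p UNIV (\<lambda>x. indicator A (x - h) *\<^sub>R c - indicator A x *\<^sub>R c) \<le> ennreal e"
    using d by auto
qed

lemma Lp_translation_continuous_add:
  fixes f g :: "'a::euclidean_space \<Rightarrow> 'b::euclidean_space"
  assumes p: "p \<ge> 1" and f: "Lp_translation_continuous p f" and g: "Lp_translation_continuous p g"
  shows "Lp_translation_continuous p (\<lambda>x. f x + g x)"
proof (rule Lp_translation_continuous_scaledI)
  let ?q = "2 powr (p - 1) :: real"
  have [measurable]: "f \<in> borel_measurable borel" "g \<in> borel_measurable borel"
    using f g by (auto simp: Lp_translation_continuous_def)
  show "(\<lambda>x. f x + g x) \<in> borel_measurable borel" by measurable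
  show "?q * 2 > 0" by simp
  fix e :: real assume e: "e > 0"
  obtain d1 where d1: "d1 > 0" "\<And>h. norm h < d1 \<Longrightarrow> Lp_energy p UNIV (\<lambda>x. f (x - h) - f x) \<le> ennreal e"
    using f e unfolding Lp_translation_continuous_def by blast
  obtain d2 where d2: "d2 > 0" "\<And>h. norm h < d2 \<Longrightarrow> Lp_energy p UNIV (\<lambda>x. g (x - h) - g x) \<le> ennreal e"
    using g e unfolding Lp_translation_continuous_def by blast
  have "Lp_energy p UNIV (\<lambda>x. f (x - h) + g (x - h) - (f x + g x)) \<le> ennreal (?q * 2 * e)" if "norm h < min d1 d2" for h
  proof -
    have "Lp_energy p UNIV (\<lambda>x. (f (x - h) - f x) + (g (x - h) - g x))
      \<le> ennreal ?q * (Lp_energy p UNIV (\<lambda>x. f (x - h) - f x) + Lp_energy p UNIV (\<lambda>x. g (x - h) - g x))"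
      by (intro Lp_energy_add_le p) auto
    also have "\<dots> \<le> ennreal ?q * (ennreal e + ennreal e)"
      using that by (intro mult_left_mono add_mono d1 d2) auto
    also have "\<dots> = ennreal (?q * 2 * e)"
      using e by (simp add: ennreal_mult[symmetric] ennreal_plus[symmetric] del: ennreal_plus)
    finally show ?thesis by (simp add: algebra_simps)
  qed
  then show "\<exists>d>0. \<forall>h. norm h < d \<longrightarrow> Lp_energy p UNIV (\<lambda>x. f (x - h) + g (x - h) - (f x + g x)) \<le> ennreal (?q * 2 * e)"
    using d1 d2 by (intro exI[of _ "min d1 d2"]) auto
qed

lemma Lp_translation_continuous_sum:
  fixes f :: "'i \<Rightarrow> 'a::euclidean_space \<Rightarrow> 'b::euclidean_space"
  assumes p: "p \<ge> 1" and f: "finite I" "\<And>i. i \<in> I \<Longrightarrow> Lp_translation_continuous p (f i)"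
  shows "Lp_translation_continuous p (\<lambda>x. \<Sum>i\<in>I. f i x)"
  using f
proof (induction I rule: finite_induct)
  case (insert i I)
  have "Lp_translation_continuous p (\<lambda>x. f i x + (\<Sum>i\<in>I. f i x))"
    using insert by (intro Lp_translation_continuous_add p) simp_all
  then show ?case using insert by simp
qed (simp add: Lp_translation_continuous_0)

lemma Lp_translation_continuous_closed:
  fixes f :: "'a::euclidean_space \<Rightarrow> 'b::euclidean_space"
  assumes p: "p \<ge> 1" and f[measurable]: "f \<in> borel_measurable borel"
    and approx: "\<And>e. e > 0 \<Longrightarrow> \<exists>g. Lp_translation_continuous p g \<and> Lp_energy p UNIV (\<lambda>x. f x - g x) \<le> ennreal e"
  shows "Lp_translation_continuous p f"
proof (rule Lp_translation_continuous_scaledI[OF f])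
  let ?q = "2 powr (p - 1) :: real"
  show "?q + 2 * ?q * ?q > 0" by (intro add_pos_pos mult_pos_pos) auto
  fix r :: real assume r: "r > 0"
  obtain g where g: "Lp_translation_continuous p g" "Lp_energy p UNIV (\<lambda>x. f x - g x) \<le> ennreal r"
    using approx[OF r] by auto
  have [measurable]: "g \<in> borel_measurable borel" using g by (auto simp: Lp_translation_continuous_def)
  obtain d where d: "d > 0" "\<And>h. norm h < d \<Longrightarrow> Lp_energy p UNIV (\<lambda>x. g (x - h) - g x) \<le> ennreal r"
    using g r unfolding Lp_translation_continuous_def by blast
  have "Lp_energy p UNIV (\<lambda>x. f (x - h) - f x) \<le> ennreal ((?q + 2 * ?q * ?q) * r)" if h: "norm h < d" for h
  proof -
    have 1: "Lp_energy p UNIV (\<lambda>x. f (x - h) - g (x - h)) \<le> ennreal r"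
      using Lp_energy_translate[of "\<lambda>x. f x - g x" p h] g(2) by simp
    have 2: "Lp_energy p UNIV (\<lambda>x. g x - f x) \<le> ennreal r"
      using g(2) by (simp add: Lp_energy_def norm_minus_commute)
    have "Lp_energy p UNIV (\<lambda>x. (g (x - h) - g x) + (g x - f x))
        \<le> ennreal ?q * (Lp_energy p UNIV (\<lambda>x. g (x - h) - g x) + Lp_energy p UNIV (\<lambda>x. g x - f x))"
      by (intro Lp_energy_add_le p) auto
    also have "\<dots> \<le> ennreal ?q * (ennreal r + ennreal r)"
      by (intro mult_left_mono add_mono 2 d(2) h) auto
    finally have 3: "Lp_energy p UNIV (\<lambda>x. (g (x - h) - g x) + (g x - f x)) \<le> ennreal ?q * (ennreal r + ennreal r)" .
    have "Lp_energy p UNIV (\<lambda>x. (f (x - h) - g (x - h)) + ((g (x - h) - g x) + (g x - f x)))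
      \<le> ennreal ?q * (Lp_energy p UNIV (\<lambda>x. f (x - h) - g (x - h)) + Lp_energy p UNIV (\<lambda>x. (g (x - h) - g x) + (g x - f x)))"
      by (intro Lp_energy_add_le p) auto
    also have "\<dots> \<le> ennreal ?q * (ennreal r + ennreal ?q * (ennreal r + ennreal r))"
      by (intro mult_left_mono add_mono 1 3) auto
    also have "\<dots> = ennreal ((?q + 2 * ?q * ?q) * r)"
      using r by (simp add: ennreal_mult[symmetric] ennreal_plus[symmetric] algebra_simps del: ennreal_plus)
    finally show ?thesis by simp
  qed
  then show "\<exists>d>0. \<forall>h. norm h < d \<longrightarrow> Lp_energy p UNIV (\<lambda>x. f (x - h) - f x) \<le> ennreal ((?q + 2 * ?q * ?q) * r)" using d by auto
qed

text \<open>Simple functions that converge to \<open>f\<close> and are dominated by \<open>2|f|\<close> vanish where \<open>f\<close> does, so they are combinations of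
indicators of bounded sets; they converge in the \<open>p\<close>-th mean by dominated convergence.\<close>

lemma Lp_translation_continuousI:
  fixes f :: "'a::euclidean_space \<Rightarrow> 'b::euclidean_space"
  assumes p: "p \<ge> 1" and f[measurable]: "f \<in> borel_measurable borel"
    and supp: "bounded {x. f x \<noteq> 0}" and fin: "Lp_energy p UNIV f < \<infinity>"
  shows "Lp_translation_continuous p f"
proof (rule Lp_translation_continuous_closed[OF p f])
  obtain s where s: "\<And>i. simple_function borel (s i)" "\<And>x. (\<lambda>i. s i x) \<longlonglongrightarrow> f x"
    "\<And>i x. norm (s i x) \<le> 2 * norm (f x)"
    using borel_measurable_implies_sequence_metric[OF f, of 0] by (auto simp: dist_norm)
  have tc: "Lp_translation_continuous p (s i)" for i
  proof -
    have fin: "finite (range (s i))" using simple_functionD(1)[OF s(1)] by simp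
    have "s i = (\<lambda>x. \<Sum>y\<in>range (s i). indicator (s i -` {y}) x *\<^sub>R y)"
    proof
      fix x
      have "(\<Sum>y\<in>range (s i). indicator (s i -` {y}) x *\<^sub>R y) = (\<Sum>y\<in>range (s i). if y = s i x then y else 0)"
        by (intro sum.cong) (auto simp: indicator_def)
      then show "s i x = (\<Sum>y\<in>range (s i). indicator (s i -` {y}) x *\<^sub>R y)" using fin by simp
    qed
    moreover have "Lp_translation_continuous p (\<lambda>x. \<Sum>y\<in>range (s i). indicator (s i -` {y}) x *\<^sub>R y)"
    proof (rule Lp_translation_continuous_sum[OF p fin])
      fix y
      show "Lp_translation_continuous p (\<lambda>x. indicator (s i -` {y}) x *\<^sub>R y)"
      proof (cases "y = 0")
        case False
        have "s i -` {y} \<subseteq> {x. f x \<noteq> 0}"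
        proof
          fix x assume "x \<in> s i -` {y}"
          then show "x \<in> {x. f x \<noteq> 0}" using s(3)[of i x] False by auto
        qed
        then have "bounded (s i -` {y})" using supp bounded_subset by blast
        then show ?thesis
          using simple_functionD(2)[OF s(1), of i "{y}"] by (intro Lp_translation_continuous_indicator) auto
      qed (simp add: Lp_translation_continuous_0)
    qed
    ultimately show ?thesis by simp
  qed
  have sm: "s i \<in> borel_measurable borel" for i using tc by (auto simp: Lp_translation_continuous_def)
  note [measurable] = sm
  have lim: "(\<lambda>i. Lp_energy p UNIV (\<lambda>x. f x - s i x)) \<longlonglongrightarrow> integral\<^sup>N lborel (\<lambda>_::'a. 0)"
    unfolding Lp_energy_def
  proof (rule nn_integral_dominated_convergence[where u' = "\<lambda>_. 0" and w = "\<lambda>x. ennreal (3 powr p) * ennreal (norm (f x) powr p)"])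
    show "AE x in lborel. ennreal (norm (f x - s i x) powr p) * indicator UNIV x
        \<le> ennreal (3 powr p) * ennreal (norm (f x) powr p)" for i
    proof (rule AE_I2)
      fix x
      have "norm (f x - s i x) \<le> 3 * norm (f x)" using norm_triangle_ineq4[of "f x" "s i x"] s(3)[of i x] by linarith
      then have "norm (f x - s i x) powr p \<le> (3 * norm (f x)) powr p" using p by (intro powr_mono2) auto
      then show "ennreal (norm (f x - s i x) powr p) * indicator UNIV x \<le> ennreal (3 powr p) * ennreal (norm (f x) powr p)"
        by (simp add: powr_mult ennreal_mult[symmetric] ennreal_leI)
    qed
    have "(\<integral>\<^sup>+x. ennreal (3 powr p) * ennreal (norm (f x) powr p) \<partial>lborel) = ennreal (3 powr p) * Lp_energy p UNIV f"
      by (subst nn_integral_cmult) (auto simp: Lp_energy_def)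
    then show "(\<integral>\<^sup>+x. ennreal (3 powr p) * ennreal (norm (f x) powr p) \<partial>lborel) < \<infinity>"
      using fin by (simp add: ennreal_mult_less_top)
    show "AE x in lborel. (\<lambda>i. ennreal (norm (f x - s i x) powr p) * indicator UNIV x) \<longlonglongrightarrow> 0"
    proof (rule AE_I2)
      fix x
      have "(\<lambda>i. norm (f x - s i x)) \<longlonglongrightarrow> norm (f x - f x)" by (intro tendsto_intros s(2))
      then have "(\<lambda>i. norm (f x - s i x) powr p) \<longlonglongrightarrow> 0 powr p"
        using p by (intro tendsto_powr') auto
      then have "(\<lambda>i. ennreal (norm (f x - s i x) powr p)) \<longlonglongrightarrow> ennreal 0"
        using p by (intro tendsto_ennrealI) auto
      then show "(\<lambda>i. ennreal (norm (f x - s i x) powr p) * indicator UNIV x) \<longlonglongrightarrow> 0" by simp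
    qed
  qed auto
  fix e :: real assume "e > 0"
  then have "\<forall>\<^sub>F i in sequentially. Lp_energy p UNIV (\<lambda>x. f x - s i x) < ennreal e"
    using lim by (intro order_tendstoD(2)[OF lim]) simp
  then obtain i where "Lp_energy p UNIV (\<lambda>x. f x - s i x) < ennreal e"
    by (meson eventually_sequentially order_refl)
  then show "\<exists>g. Lp_translation_continuous p g \<and> Lp_energy p UNIV (\<lambda>x. f x - g x) \<le> ennreal e"
    using tc by (intro exI[of _ "s i"]) auto
qed

lemma lborel_reflect:
  fixes g :: "'a::euclidean_space \<Rightarrow> 'b::{banach, second_countable_topology}"
  assumes "g \<in> borel_measurable borel"
  shows "(\<integral>y. g y \<partial>lborel) = (\<integral>h. g (x - h) \<partial>lborel)"
    "integrable lborel (\<lambda>h. g (x - h)) \<longleftrightarrow> integrable lborel g"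
proof -
  have *: "lborel = distr lborel borel (\<lambda>h. x - h)"
    using lborel_affine[of "-1" x] by (simp add: density_1)
  have "(\<integral>y. g y \<partial>lborel) = (\<integral>y. g y \<partial>distr lborel borel (\<lambda>h. x - h))" using * by metis
  also have "\<dots> = (\<integral>h. g (x - h) \<partial>lborel)" using assms by (subst integral_distr) auto
  finally show "(\<integral>y. g y \<partial>lborel) = (\<integral>h. g (x - h) \<partial>lborel)" .
  have "integrable lborel g \<longleftrightarrow> integrable (distr lborel borel (\<lambda>h. x - h)) g" using * by metis
  also have "\<dots> \<longleftrightarrow> integrable lborel (\<lambda>h. g (x - h))" using assms by (subst integrable_distr_eq) auto
  finally show "integrable lborel (\<lambda>h. g (x - h)) \<longleftrightarrow> integrable lborel g" by simp
qed

text \<open>By Jensen's inequality for the probability density \<open>\<eta>\<close>, the deviation of the mollified function is at most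
an average, over shifts shorter than \<open>\<delta>\<close>, of the deviations of the translates of \<open>f\<close>.\<close>

lemma mollification_Lp_close:
  fixes f :: "real^'n::finite \<Rightarrow> 'b::euclidean_space"
  assumes p: "p \<ge> 1" and f: "integrable lborel f" and tc: "Lp_translation_continuous p f" and e: "e > 0"
  shows "\<exists>\<delta>\<^sub>0>0. \<forall>\<delta> \<eta>. \<delta> \<le> \<delta>\<^sub>0 \<longrightarrow> mollifier \<delta> \<eta> \<longrightarrow>
           Lp_energy p UNIV (\<lambda>x. convolve \<eta> f x - f x) \<le> ennreal e"
proof -
  have [measurable]: "f \<in> borel_measurable borel" using f by auto
  obtain d where d: "d > 0" "\<And>h. norm h < d \<Longrightarrow> Lp_energy p UNIV (\<lambda>x. f (x - h) - f x) \<le> ennreal e"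
    using tc e unfolding Lp_translation_continuous_def by blast
  show ?thesis
  proof (intro exI[of _ d] conjI d(1) allI impI)
    fix \<delta> and \<eta> :: "real^'n \<Rightarrow> real" assume \<delta>: "\<delta> \<le> d" and \<eta>: "mollifier \<delta> \<eta>"
    note \<eta>0 = mollifierD(2)[OF \<eta>] and \<eta>s = mollifierD(3)[OF \<eta>] and \<eta>i = mollifierD(4)[OF \<eta>] and \<eta>1 = mollifierD(5)[OF \<eta>]
    note [measurable] = mollifierD(7)[OF \<eta>]
    obtain B where B: "\<And>x. \<bar>\<eta> x\<bar> \<le> B" using mollifierD(8)[OF \<eta>] by blast
    have int: "integrable lborel (\<lambda>y. \<eta> (x - y) *\<^sub>R f y)" for x
      by (rule convolve_integrable[OF _ B f]) measurable
    have int': "integrable lborel (\<lambda>h. \<eta> h *\<^sub>R f (x - h))" for x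
      using lborel_reflect(2)[of "\<lambda>y. \<eta> (x - y) *\<^sub>R f y" x] int by simp
    have pt: "ennreal (norm (convolve \<eta> f x - f x) powr p) \<le> (\<integral>\<^sup>+h. ennreal (\<eta> h * norm (f (x - h) - f x) powr p) \<partial>lborel)" for x
    proof -
      have i2: "integrable lborel (\<lambda>h. \<eta> h *\<^sub>R (f (x - h) - f x))"
        unfolding scaleR_diff_right using int' \<eta>i by (intro Bochner_Integration.integrable_diff) auto
      have "convolve \<eta> f x = (\<integral>h. \<eta> h *\<^sub>R f (x - h) \<partial>lborel)"
        unfolding convolve_def using lborel_reflect(1)[of "\<lambda>y. \<eta> (x - y) *\<^sub>R f y" x] by simp
      moreover have "f x = (\<integral>h. \<eta> h *\<^sub>R f x \<partial>lborel)" using \<eta>i \<eta>1 by simp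
      ultimately have "convolve \<eta> f x - f x = (\<integral>h. \<eta> h *\<^sub>R (f (x - h) - f x) \<partial>lborel)"
        unfolding scaleR_diff_right using int' \<eta>i by (subst Bochner_Integration.integral_diff) auto
      also have "norm \<dots> \<le> (\<integral>h. \<eta> h * norm (f (x - h) - f x) \<partial>lborel)"
        using integral_norm_bound[of lborel "\<lambda>h. \<eta> h *\<^sub>R (f (x - h) - f x)"] \<eta>0 by simp
      finally have "norm (convolve \<eta> f x - f x) powr p \<le> (\<integral>h. \<eta> h * norm (f (x - h) - f x) \<partial>lborel) powr p"
        using p by (intro powr_mono2) auto
      then have "ennreal (norm (convolve \<eta> f x - f x) powr p) \<le> ennreal ((\<integral>h. \<eta> h * norm (f (x - h) - f x) \<partial>lborel) powr p)"
        by (rule ennreal_leI)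
      also have "\<dots> \<le> ennreal ((\<integral>h. \<eta> h \<partial>lborel) powr (p - 1)) * (\<integral>\<^sup>+h. ennreal (\<eta> h * norm (f (x - h) - f x) powr p) \<partial>lborel)"
        by (intro weighted_jensen \<eta>i \<eta>0 p) auto
      finally show ?thesis by (simp add: \<eta>1)
    qed
    have "Lp_energy p UNIV (\<lambda>x. convolve \<eta> f x - f x)
      \<le> (\<integral>\<^sup>+x. (\<integral>\<^sup>+h. ennreal (\<eta> h * norm (f (x - h) - f x) powr p) \<partial>lborel) \<partial>lborel)"
      unfolding Lp_energy_def using pt by (intro nn_integral_mono) auto
    also have "\<dots> = (\<integral>\<^sup>+h. (\<integral>\<^sup>+x. ennreal (\<eta> h * norm (f (x - h) - f x) powr p) \<partial>lborel) \<partial>lborel)"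
      by (rule lborel_pair.Fubini') measurable
    also have "\<dots> \<le> (\<integral>\<^sup>+h. ennreal (\<eta> h) * ennreal e \<partial>lborel)"
    proof (rule nn_integral_mono)
      fix h :: "real^'n"
      show "(\<integral>\<^sup>+x. ennreal (\<eta> h * norm (f (x - h) - f x) powr p) \<partial>lborel) \<le> ennreal (\<eta> h) * ennreal e"
      proof (cases "norm h < \<delta>")
        case True
        have "(\<integral>\<^sup>+x. ennreal (\<eta> h * norm (f (x - h) - f x) powr p) \<partial>lborel) = ennreal (\<eta> h) * Lp_energy p UNIV (\<lambda>x. f (x - h) - f x)"
          using \<eta>0 by (simp add: Lp_energy_def ennreal_mult nn_integral_cmult)
        also have "\<dots> \<le> ennreal (\<eta> h) * ennreal e"
          using True \<delta> by (intro mult_left_mono d(2)) auto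
        finally show ?thesis .
      qed (use \<eta>s in simp)
    qed
    also have "\<dots> = ennreal e"
      using \<eta>i \<eta>0 \<eta>1 by (simp add: nn_integral_multc nn_integral_eq_integral)
    finally show "Lp_energy p UNIV (\<lambda>x. convolve \<eta> f x - f x) \<le> ennreal e" .
  qed
qed

section \<open>Weak gradients\<close>

lemma borel_representative:
  fixes f :: "'a::euclidean_space \<Rightarrow> 'b::euclidean_space"
  assumes f: "f \<in> borel_measurable lebesgue"
  shows "\<exists>g\<in>borel_measurable borel. AE x in lborel. g x = f x"
proof -
  have "\<exists>g\<in>borel_measurable lborel. AE x in lborel. f x \<bullet> b = (g x :: real)" for b
    using f by (intro completion_ex_borel_measurable_real) auto
  then obtain g where g: "\<And>b. g b \<in> borel_measurable lborel" "\<And>b. AE x in lborel. f x \<bullet> b = (g b x :: real)"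
    by metis
  have [measurable]: "g b \<in> borel_measurable borel" for b using g(1) by simp
  show ?thesis
  proof (rule bexI[of _ "\<lambda>x. \<Sum>b\<in>Basis. g b x *\<^sub>R b"])
    have "AE x in lborel. \<forall>b\<in>Basis. f x \<bullet> b = g b x"
      using g(2) by (simp add: AE_finite_all)
    then show "AE x in lborel. (\<Sum>b\<in>Basis. g b x *\<^sub>R b) = f x"
    proof eventually_elim
      case (elim x)
      have "(\<Sum>b\<in>Basis. g b x *\<^sub>R b) = (\<Sum>b\<in>Basis. (f x \<bullet> b) *\<^sub>R b)"
        using elim by (intro sum.cong) auto
      then show ?case by (simp add: euclidean_representation)
    qed
  qed measurable
qed

lemma borel_representative_on:
  fixes f :: "'a::euclidean_space \<Rightarrow> 'b::euclidean_space"
  assumes f: "set_borel_measurable lebesgue E f"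
  shows "\<exists>g\<in>borel_measurable borel. AE x in lborel. x \<in> E \<longrightarrow> g x = f x"
proof -
  obtain g where "g \<in> borel_measurable borel" and g: "AE x in lborel. g x = indicator E x *\<^sub>R f x"
    using borel_representative f unfolding set_borel_measurable_def by blast
  moreover have "AE x in lborel. x \<in> E \<longrightarrow> g x = f x"
    using g by eventually_elim auto
  ultimately show ?thesis by blast
qed

lemma integrable_representative:
  fixes f :: "'a::euclidean_space \<Rightarrow> 'b::euclidean_space"
  assumes f: "set_integrable lebesgue K f" and [measurable]: "K \<in> sets borel"
    and g[measurable]: "g \<in> borel_measurable borel" and gf: "AE x in lborel. x \<in> K \<longrightarrow> g x = f x"
  shows "integrable lborel (\<lambda>x. indicator K x *\<^sub>R g x)"
proof -
  have m: "(\<lambda>x. indicator K x *\<^sub>R g x) \<in> borel_measurable lborel" by measurable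
  have "AE x in lebesgue. indicator K x *\<^sub>R g x = indicator K x *\<^sub>R f x"
    using AE_completion[OF gf] by eventually_elim (auto simp: indicator_def)
  then have "integrable lebesgue (\<lambda>x. indicator K x *\<^sub>R g x)"
    using f measurable_completion[OF m] unfolding set_integrable_def
    by (subst integrable_cong_AE) auto
  then show ?thesis using m by (simp add: integrable_completion)
qed

lemma open_compact_exhaustion:
  fixes U :: "'a::euclidean_space set"
  assumes "open U"
  obtains C :: "nat \<Rightarrow> 'a set" where "\<And>n. compact (C n)" "\<And>n. C n \<subseteq> U" "\<And>x. x \<in> U \<Longrightarrow> \<forall>\<^sub>F n in sequentially. x \<in> C n"
proof -
  obtain C where C: "\<And>n::nat. compact (C n)" "\<And>n. C n \<subseteq> U" "(\<Union>n. C n) = U"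
    using open_Union_compact_subsets[OF assms] by (metis (no_types))
  show ?thesis
  proof (rule that[of "\<lambda>n. \<Union>k\<le>n. C k"])
    fix x assume "x \<in> U"
    then obtain k where "x \<in> C k" using C(3) by blast
    then show "\<forall>\<^sub>F n in sequentially. x \<in> (\<Union>k\<le>n. C k)"
      by (auto simp: eventually_sequentially intro!: exI[of _ k])
  qed (use C in \<open>auto intro!: compact_UN\<close>)
qed

lemma locally_integrable_measurable:
  assumes U: "open U" and f: "locally_integrable U f"
  shows "set_borel_measurable lebesgue U f"
proof -
  obtain C where C: "\<And>n::nat. compact (C n)" "\<And>n. C n \<subseteq> U" "\<And>x. x \<in> U \<Longrightarrow> \<forall>\<^sub>F n in sequentially. x \<in> C n"
    using open_compact_exhaustion[OF U] by blast
  show ?thesis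
    unfolding set_borel_measurable_def
  proof (rule borel_measurable_LIMSEQ_metric)
    show "(\<lambda>x. indicator (C n) x *\<^sub>R f x) \<in> borel_measurable lebesgue" for n
      using f C(1,2)[of n] unfolding locally_integrable_def set_integrable_def
      by (intro borel_measurable_integrable) blast
    fix x
    show "(\<lambda>n. indicator (C n) x *\<^sub>R f x) \<longlonglongrightarrow> indicator U x *\<^sub>R f x"
    proof (cases "x \<in> U")
      case True
      then show ?thesis
        using C(3)[OF True] by (intro tendsto_eventually) (auto elim!: eventually_mono)
    next
      case False
      then have "x \<notin> C n" for n using C(2) by blast
      then show ?thesis using False by simp
    qed
  qed
qed

lemma compact_fattening:
  fixes F :: "'a::euclidean_space set"
  assumes "compact F" "open U" "F \<subseteq> U"
  obtains d K where "d > 0" "compact K" "K \<subseteq> U" "\<And>x. x \<in> F \<Longrightarrow> cball x d \<subseteq> K"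
proof -
  obtain d where d: "d > 0" "(\<Union>x\<in>F. cball x d) \<subseteq> U"
    using compact_subset_open_imp_cball_epsilon_subset[OF assms] by blast
  show ?thesis
    using that[of d "\<Union>x\<in>F. cball x d"] d compact_minkowski_sum_cball[OF assms(1), of d] by auto
qed

lemma convolve_nth:
  assumes "integrable lborel (\<lambda>y. g (x - y) *\<^sub>R f y)"
  shows "convolve g (\<lambda>y. f y $ i) x = convolve g f x $ i"
  unfolding convolve_def using integral_bounded_linear[OF bounded_linear_vec_nth[of i] assms] by simp

text \<open>The gradient of a mollification, as \<open>has_C1_gradient_convolve\<close> gives it, is the mollification of the weak
gradient wherever the kernel does not reach beyond \<open>K\<close>.\<close>

lemma mollified_gradient:
  fixes u :: "real^'n::finite \<Rightarrow> real^'m::finite"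
  assumes \<eta>: "mollifier \<delta> \<eta>" and w: "has_weak_gradient U u G" and x: "cball x \<delta> \<subseteq> K" "K \<subseteq> U"
    and f: "f \<in> borel_measurable borel" "AE y in lborel. y \<in> K \<longrightarrow> f y = u y"
    and g: "integrable lborel g" "AE y in lborel. y \<in> K \<longrightarrow> g y = G y"
  shows "(\<chi> i j. convolve (partial_deriv j \<eta>) (\<lambda>y. f y $ i) x) = convolve \<eta> g x"
proof -
  obtain B where B: "\<And>x. \<bar>\<eta> x\<bar> \<le> B" using mollifierD(8)[OF \<eta>] by blast
  note int = convolve_integrable[OF mollifierD(7)[OF \<eta>] B]
  have xU: "cball x \<delta> \<subseteq> U" using x by blast
  have gm: "g \<in> borel_measurable borel" using g(1) by auto
  have fc: "AE y in lborel. y \<in> cball x \<delta> \<longrightarrow> f y = u y"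
    using f(2) by eventually_elim (use x in blast)
  have gc: "AE y in lborel. y \<in> cball x \<delta> \<longrightarrow> g y = G y"
    using g(2) by eventually_elim (use x in blast)
  have "convolve (partial_deriv j \<eta>) (\<lambda>y. f y $ i) x = convolve \<eta> g x $ i $ j" for i j
  proof -
    have "convolve (partial_deriv j \<eta>) (\<lambda>y. f y $ i) x = convolve \<eta> (\<lambda>y. g y $ i $ j) x"
      by (rule weak_gradient_convolve[OF \<eta> w xU f(1) fc gm gc])
    also have "\<dots> = convolve \<eta> (\<lambda>y. g y $ i) x $ j"
      by (rule convolve_nth) (rule int[OF integrable_bounded_linear[OF bounded_linear_vec_nth g(1)]])
    also have "convolve \<eta> (\<lambda>y. g y $ i) x = convolve \<eta> g x $ i" by (rule convolve_nth) (rule int[OF g(1)])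
    finally show ?thesis .
  qed
  then show ?thesis by (simp add: vec_eq_iff)
qed

lemma Lp_energy_eq_0_AE:
  assumes [measurable]: "f \<in> borel_measurable borel" "E \<in> sets borel" and 0: "Lp_energy p E f = 0"
  shows "AE x in lborel. x \<in> E \<longrightarrow> f x = 0"
proof -
  have "AE x in lborel. ennreal (norm (f x) powr p) * indicator E x = 0"
    using 0 unfolding Lp_energy_def by (subst (asm) nn_integral_0_iff_AE) auto
  then show ?thesis
    by eventually_elim (auto simp: indicator_def split: if_splits)
qed

lemma Lp_energy_cong: "(\<And>x. x \<in> E \<Longrightarrow> f x = g x) \<Longrightarrow> Lp_energy p E f = Lp_energy p E g"
  unfolding Lp_energy_def by (intro nn_integral_cong) (auto simp: indicator_def)

lemma Lp_energy_indicator: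
  "p > 0 \<Longrightarrow> Lp_energy p UNIV (\<lambda>x. indicator E x *\<^sub>R f x) = Lp_energy p E f"
  unfolding Lp_energy_def by (intro nn_integral_cong) (auto simp: indicator_def)

text \<open>Mollifying either gradient gives the derivatives of the same mollification of \<open>u\<close>, so the mollified
difference vanishes. As mollifications converge in the first mean, the difference itself is zero almost
everywhere on each compact subset of \<open>U\<close>. The exponent \<open>1\<close> is used because a weak gradient is only
assumed to be locally integrable.\<close>

lemma weak_gradient_unique:
  fixes u :: "real^'n::finite \<Rightarrow> real^'m::finite"
  assumes U: "open U" and G: "has_weak_gradient U u G" and D: "has_weak_gradient U u D"
  shows "AE x in lborel. x \<in> U \<longrightarrow> G x = D x"
proof -
  have um: "set_borel_measurable lebesgue U u" and Gm: "set_borel_measurable lebesgue U G" and Dm: "set_borel_measurable lebesgue U D"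
    using G D locally_integrable_measurable[OF U] by (auto simp: has_weak_gradient_def)
  obtain f where [measurable]: "f \<in> borel_measurable borel" and f: "AE x in lborel. x \<in> U \<longrightarrow> f x = u x"
    using borel_representative_on[OF um] by blast
  obtain g where [measurable]: "g \<in> borel_measurable borel" and g: "AE x in lborel. x \<in> U \<longrightarrow> g x = G x"
    using borel_representative_on[OF Gm] by blast
  obtain h where [measurable]: "h \<in> borel_measurable borel" and h: "AE x in lborel. x \<in> U \<longrightarrow> h x = D x"
    using borel_representative_on[OF Dm] by blast
  have onF: "AE x in lborel. x \<in> F \<longrightarrow> g x = h x" if F: "compact F" "F \<subseteq> U" for F
  proof -
    obtain d K where K: "d > 0" "compact K" "K \<subseteq> U" "\<And>x. x \<in> F \<Longrightarrow> cball x d \<subseteq> K"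
      using compact_fattening[OF F(1) U F(2)] by blast
    have [measurable]: "K \<in> sets borel" "F \<in> sets borel" using K F by (auto intro: borel_compact)
    have GK: "set_integrable lebesgue K G" and DK: "set_integrable lebesgue K D"
      using G D K by (auto simp: has_weak_gradient_def locally_integrable_def)
    have gK: "AE x in lborel. x \<in> K \<longrightarrow> g x = G x" and hK: "AE x in lborel. x \<in> K \<longrightarrow> h x = D x"
      using g h K(3) by (auto elim: eventually_mono)
    define g' where "g' = (\<lambda>x. indicator K x *\<^sub>R g x)"
    define h' where "h' = (\<lambda>x. indicator K x *\<^sub>R h x)"
    have gi: "integrable lborel g'" and hi: "integrable lborel h'"
      unfolding g'_def h'_def
      by (rule integrable_representative[OF GK _ _ gK] integrable_representative[OF DK _ _ hK]; measurable)+
    have g'K: "AE x in lborel. x \<in> K \<longrightarrow> g' x = G x" and h'K: "AE x in lborel. x \<in> K \<longrightarrow> h' x = D x"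
      using gK hK by (auto simp: g'_def h'_def elim: eventually_mono)
    have fK: "AE x in lborel. x \<in> K \<longrightarrow> f x = u x" using f K(3) by (auto elim: eventually_mono)
    define w where "w = (\<lambda>x. g' x - h' x)"
    have wi: "integrable lborel w" unfolding w_def using gi hi by (rule Bochner_Integration.integrable_diff)
    have [measurable]: "w \<in> borel_measurable borel" using wi by auto
    have "bounded {x. w x \<noteq> 0}"
      by (rule bounded_subset[OF compact_imp_bounded[OF K(2)]]) (auto simp: w_def g'_def h'_def indicator_def)
    moreover have "Lp_energy 1 UNIV w < \<infinity>"
      using wi by (simp add: Lp_energy_def integrable_iff_bounded)
    ultimately have tc: "Lp_translation_continuous 1 w" by (intro Lp_translation_continuousI) auto
    have "Lp_energy 1 F w \<le> ennreal e" if e: "e > 0" for e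
    proof -
      obtain \<delta>0 where \<delta>0: "\<delta>0 > 0" "\<And>\<delta> \<eta>. \<delta> \<le> \<delta>0 \<Longrightarrow> mollifier \<delta> \<eta> \<Longrightarrow> Lp_energy 1 UNIV (\<lambda>x. convolve \<eta> w x - w x) \<le> ennreal e"
        using mollification_Lp_close[OF _ wi tc e] by auto
      define \<delta> where "\<delta> = min \<delta>0 d"
      have \<delta>: "\<delta> > 0" "\<delta> \<le> \<delta>0" "\<delta> \<le> d" using \<delta>0 K by (auto simp: \<delta>_def)
      obtain \<eta> :: "real^'n \<Rightarrow> real" where \<eta>: "mollifier \<delta> \<eta>" using mollifier_exists[OF \<delta>(1)] by blast
      obtain B where B: "\<And>x. \<bar>\<eta> x\<bar> \<le> B" using mollifierD(8)[OF \<eta>] by blast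
      note int = convolve_integrable[OF mollifierD(7)[OF \<eta>] B]
      have zero: "convolve \<eta> w x = 0" if x: "x \<in> F" for x
      proof -
        have c: "cball x \<delta> \<subseteq> K" using K(4)[OF x] \<delta> by (meson order_trans subset_cball)
        have "convolve \<eta> g' x = convolve \<eta> h' x"
          using mollified_gradient[OF \<eta> G c K(3) \<open>f \<in> borel_measurable borel\<close> fK gi g'K]
            mollified_gradient[OF \<eta> D c K(3) \<open>f \<in> borel_measurable borel\<close> fK hi h'K] by (rule trans[OF sym])
        moreover have "convolve \<eta> w x = convolve \<eta> g' x - convolve \<eta> h' x"
          unfolding convolve_def w_def scaleR_diff_right
          by (rule Bochner_Integration.integral_diff[OF int[OF gi] int[OF hi]])
        ultimately show ?thesis by simp
      qed
      have "Lp_energy 1 F w = Lp_energy 1 F (\<lambda>x. convolve \<eta> w x - w x)"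
        unfolding Lp_energy_def using zero by (intro nn_integral_cong) (auto simp: indicator_def)
      also have "\<dots> \<le> Lp_energy 1 UNIV (\<lambda>x. convolve \<eta> w x - w x)" by (rule Lp_energy_mono) auto
      also have "\<dots> \<le> ennreal e" using \<delta>0(2)[OF \<delta>(2) \<eta>] .
      finally show ?thesis .
    qed
    then have "Lp_energy 1 F w \<le> 0 + ennreal e" if "e > 0" for e using that by simp
    then have "Lp_energy 1 F w \<le> 0" by (rule ennreal_le_epsilon)
    then have wF: "AE x in lborel. x \<in> F \<longrightarrow> w x = 0" by (intro Lp_energy_eq_0_AE[where p = 1]) auto
    have "g x - h x = w x" if "x \<in> F" for x
    proof -
      have "x \<in> K" using K(4)[OF that] K(1) by auto
      then show ?thesis by (simp add: w_def g'_def h'_def)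
    qed
    then show ?thesis using wF by (fastforce elim: eventually_mono)
  qed
  obtain C where C: "\<And>n::nat. compact (C n)" "\<And>n. C n \<subseteq> U" "\<And>x. x \<in> U \<Longrightarrow> \<forall>\<^sub>F n in sequentially. x \<in> C n"
    using open_compact_exhaustion[OF U] by blast
  have "AE x in lborel. \<forall>n. x \<in> C n \<longrightarrow> g x = h x"
    unfolding AE_all_countable by (intro allI onF C)
  with g h show ?thesis
  proof eventually_elim
    case (elim x)
    show ?case
    proof
      assume x: "x \<in> U"
      obtain n where "x \<in> C n" using eventually_happens'[OF sequentially_bot C(3)[OF x]] by blast
      then show "G x = D x" using elim x by metis
    qed
  qed
qed

text \<open>Near \<open>F\<close> nothing changes if \<open>u\<close> and \<open>G\<close> are cut off outside a compact neighbourhood \<open>K\<close>. The cut-off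
functions are globally integrable with bounded support, and for radii smaller than the distance from \<open>F\<close> to the
boundary of \<open>K\<close> the mollified cut-off of \<open>u\<close> has the mollified cut-off of \<open>G\<close> as its gradient on \<open>F\<close>.\<close>

lemma smooth_approximation:
  fixes u :: "real^'n::finite \<Rightarrow> real^'m::finite"
  assumes U: "open U" and p: "p \<ge> 1" and w: "has_weak_gradient U u G" and F: "compact F" "F \<subseteq> U"
    and f: "f \<in> borel_measurable borel" "AE x in lborel. x \<in> U \<longrightarrow> f x = u x" "Lp_energy p U f < \<infinity>"
    and g: "g \<in> borel_measurable borel" "AE x in lborel. x \<in> U \<longrightarrow> g x = G x" "Lp_energy p U g < \<infinity>"
    and e: "e > 0"
  shows "\<exists>v D. has_C1_gradient v D \<and> Lp_energy p F (\<lambda>x. v x - f x) \<le> ennreal e \<and> Lp_energy p F (\<lambda>x. D x - g x) \<le> ennreal e"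
proof -
  note [measurable] = f(1) g(1)
  obtain d K where K: "d > 0" "compact K" "K \<subseteq> U" "\<And>x. x \<in> F \<Longrightarrow> cball x d \<subseteq> K"
    using compact_fattening[OF F(1) U F(2)] by blast
  have FK: "F \<subseteq> K"
  proof
    fix x assume "x \<in> F"
    then show "x \<in> K" using K(4)[of x] K(1) by auto
  qed
  have [measurable]: "K \<in> sets borel" using K by (auto intro: borel_compact)
  define f' where "f' = (\<lambda>x. indicator K x *\<^sub>R f x)"
  define g' where "g' = (\<lambda>x. indicator K x *\<^sub>R g x)"
  have [measurable]: "f' \<in> borel_measurable borel" "g' \<in> borel_measurable borel" unfolding f'_def g'_def by measurable
  have uK: "set_integrable lebesgue K u" and GK: "set_integrable lebesgue K G"
    using w K by (auto simp: has_weak_gradient_def locally_integrable_def)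
  have fK: "AE x in lborel. x \<in> K \<longrightarrow> f x = u x" and gK: "AE x in lborel. x \<in> K \<longrightarrow> g x = G x"
    using f(2) g(2) K(3) by (auto elim: eventually_mono)
  have fi: "integrable lborel f'" and gi: "integrable lborel g'"
    unfolding f'_def g'_def
    by (rule integrable_representative[OF uK _ _ fK] integrable_representative[OF GK _ _ gK]; measurable)+
  have "bounded {x. f' x \<noteq> 0}" "bounded {x. g' x \<noteq> 0}"
    by (rule bounded_subset[OF compact_imp_bounded[OF K(2)]], auto simp: f'_def g'_def indicator_def)+
  moreover have "Lp_energy p UNIV f' < \<infinity>" "Lp_energy p UNIV g' < \<infinity>"
    using p f(3) g(3) Lp_energy_mono[OF K(3)] unfolding f'_def g'_def
    by (auto simp: Lp_energy_indicator intro: le_less_trans)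
  ultimately have ftc: "Lp_translation_continuous p f'" and gtc: "Lp_translation_continuous p g'"
    by (auto intro!: Lp_translation_continuousI p)
  obtain \<delta>1 where \<delta>1: "\<delta>1 > 0" "\<And>\<delta> \<eta>. \<delta> \<le> \<delta>1 \<Longrightarrow> mollifier \<delta> \<eta> \<Longrightarrow> Lp_energy p UNIV (\<lambda>x. convolve \<eta> f' x - f' x) \<le> ennreal e"
    using mollification_Lp_close[OF p fi ftc e] by auto
  obtain \<delta>2 where \<delta>2: "\<delta>2 > 0" "\<And>\<delta> \<eta>. \<delta> \<le> \<delta>2 \<Longrightarrow> mollifier \<delta> \<eta> \<Longrightarrow> Lp_energy p UNIV (\<lambda>x. convolve \<eta> g' x - g' x) \<le> ennreal e"
    using mollification_Lp_close[OF p gi gtc e] by auto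
  define \<delta> where "\<delta> = min (min \<delta>1 \<delta>2) d"
  have \<delta>: "\<delta> > 0" "\<delta> \<le> \<delta>1" "\<delta> \<le> \<delta>2" "\<delta> \<le> d" using \<delta>1 \<delta>2 K by (auto simp: \<delta>_def)
  obtain \<eta> :: "real^'n \<Rightarrow> real" where \<eta>: "mollifier \<delta> \<eta>" using mollifier_exists[OF \<delta>(1)] by blast
  let ?D = "\<lambda>x. \<chi> i j. convolve (partial_deriv j \<eta>) (\<lambda>y. f' y $ i) x"
  have "AE x in lborel. x \<in> K \<longrightarrow> f' x = u x" "AE x in lborel. x \<in> K \<longrightarrow> g' x = G x"
    using fK gK by (auto simp: f'_def g'_def elim: eventually_mono)
  then have Deq: "?D x = convolve \<eta> g' x" if "x \<in> F" for x
    using K(4)[OF that] \<delta> by (intro mollified_gradient[OF \<eta> w _ K(3) _ _ gi]) auto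
  have "Lp_energy p F (\<lambda>x. convolve \<eta> f' x - f x) = Lp_energy p F (\<lambda>x. convolve \<eta> f' x - f' x)"
    using FK by (intro Lp_energy_cong) (auto simp: f'_def)
  also have "\<dots> \<le> ennreal e"
    by (rule order_trans[OF Lp_energy_mono \<delta>1(2)[OF \<delta>(2) \<eta>]]) auto
  finally have 1: "Lp_energy p F (\<lambda>x. convolve \<eta> f' x - f x) \<le> ennreal e" .
  have "Lp_energy p F (\<lambda>x. ?D x - g x) = Lp_energy p F (\<lambda>x. convolve \<eta> g' x - g' x)"
    using FK by (intro Lp_energy_cong) (auto simp: g'_def Deq)
  also have "\<dots> \<le> ennreal e"
    by (rule order_trans[OF Lp_energy_mono \<delta>2(2)[OF \<delta>(3) \<eta>]]) auto
  finally show ?thesis using 1 has_C1_gradient_convolve[OF \<eta> fi] by blast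
qed

section \<open>The estimate for Sobolev maps\<close>

lemma Lp_norm_eq_Lp_energy:
  fixes u :: "'a::euclidean_space \<Rightarrow> 'b::euclidean_space"
  assumes u: "set_borel_measurable lebesgue U u" and A: "A \<in> sets borel" "A \<subseteq> U"
    and f: "f \<in> borel_measurable borel" "AE x in lborel. x \<in> U \<longrightarrow> f x = u x"
  shows "Lp_norm p A u = enn2real (Lp_energy p A f) powr (1 / p)"
proof -
  note [measurable] = f(1) A(1)
  have mf: "(\<lambda>x. indicator A x *\<^sub>R norm (f x) powr p) \<in> borel_measurable lborel" by measurable
  have "(\<lambda>x. norm (indicator U x *\<^sub>R u x) powr p) \<in> borel_measurable lebesgue"
    using u unfolding set_borel_measurable_def
    by (intro measurable_compose[of _ lebesgue borel "\<lambda>y. norm y powr p"]) (auto intro: measurable_completion)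
  moreover have "indicator A \<in> borel_measurable lebesgue"
    using A(1) by (intro borel_measurable_indicator) (simp add: sets_completionI_sets)
  ultimately have "(\<lambda>x. indicator A x *\<^sub>R norm (indicator U x *\<^sub>R u x) powr p) \<in> borel_measurable lebesgue"
    by (intro borel_measurable_scaleR)
  also have "(\<lambda>x. indicator A x *\<^sub>R norm (indicator U x *\<^sub>R u x) powr p) = (\<lambda>x. indicator A x *\<^sub>R norm (u x) powr p)"
    using A(2) by (auto simp: fun_eq_iff indicator_def)
  finally have mu: "(\<lambda>x. indicator A x *\<^sub>R norm (u x) powr p) \<in> borel_measurable lebesgue" .
  have "(LINT x:A|lebesgue. norm (u x) powr p) = (\<integral>x. indicator A x *\<^sub>R norm (f x) powr p \<partial>lebesgue)"
    unfolding set_lebesgue_integral_def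
  proof (rule integral_cong_AE[OF mu measurable_completion[OF mf]])
    show "AE x in lebesgue. indicator A x *\<^sub>R norm (u x) powr p = indicator A x *\<^sub>R norm (f x) powr p"
      using AE_completion[OF f(2)] A(2) by (auto simp: indicator_def elim!: eventually_mono)
  qed
  also have "\<dots> = (\<integral>x. indicator A x *\<^sub>R norm (f x) powr p \<partial>lborel)"
    by (rule integral_completion[OF mf])
  also have "\<dots> = enn2real (\<integral>\<^sup>+x. ennreal (indicator A x *\<^sub>R norm (f x) powr p) \<partial>lborel)"
    by (rule integral_eq_nn_integral[OF mf]) auto
  also have "(\<integral>\<^sup>+x. ennreal (indicator A x *\<^sub>R norm (f x) powr p) \<partial>lborel) = Lp_energy p A f"
    unfolding Lp_energy_def by (intro nn_integral_cong) (auto simp: indicator_def)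
  finally show ?thesis by (simp add: Lp_norm_def)
qed

lemma Lp_space_energy_finite:
  fixes u :: "'a::euclidean_space \<Rightarrow> 'b::euclidean_space"
  assumes u: "u \<in> Lp_space p U" and [measurable]: "U \<in> sets borel"
    and f[measurable]: "f \<in> borel_measurable borel" and fu: "AE x in lborel. x \<in> U \<longrightarrow> f x = u x"
  shows "Lp_energy p U f < \<infinity>"
proof -
  have "set_integrable lebesgue U (\<lambda>x. norm (u x) powr p)" using u by (simp add: Lp_space_def)
  then have "integrable lborel (\<lambda>x. indicator U x *\<^sub>R norm (f x) powr p)"
    by (rule integrable_representative) (use fu in \<open>auto elim: eventually_mono\<close>)
  then have "(\<integral>\<^sup>+x. ennreal (norm (indicator U x *\<^sub>R norm (f x) powr p)) \<partial>lborel) < \<infinity>"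
    by (simp add: integrable_iff_bounded)
  also have "(\<integral>\<^sup>+x. ennreal (norm (indicator U x *\<^sub>R norm (f x) powr p)) \<partial>lborel) = Lp_energy p U f"
    unfolding Lp_energy_def by (intro nn_integral_cong) (auto simp: indicator_def)
  finally show ?thesis .
qed

text \<open>If \<open>f\<close> has mean zero on \<open>A\<close>, then \<open>- c\<close> is the mean of \<open>f - c\<close>, and Jensen's inequality applies to it.\<close>

lemma mean_zero_const_le:
  fixes f :: "'a::euclidean_space \<Rightarrow> 'b::euclidean_space"
  assumes p: "p \<ge> 1" and [measurable]: "A \<in> sets borel" and fin: "emeasure lborel A < \<infinity>"
    and f: "integrable lborel (\<lambda>x. indicator A x *\<^sub>R f x)" "(\<integral>x. indicator A x *\<^sub>R f x \<partial>lborel) = 0"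
    and fm[measurable]: "f \<in> borel_measurable borel"
  shows "ennreal (norm c powr p) * emeasure lborel A \<le> Lp_energy p A (\<lambda>x. f x - c)"
proof -
  define m where "m = measure lborel A"
  have m: "emeasure lborel A = ennreal m" "m \<ge> 0"
    using fin by (auto simp: m_def emeasure_eq_ennreal_measure less_top)
  have iA: "integrable lborel (indicator A :: 'a \<Rightarrow> real)" using fin by simp
  show ?thesis
  proof (cases "m = 0 \<or> Lp_energy p A (\<lambda>x. f x - c) = top")
    case True
    then show ?thesis using m by auto
  next
    case False
    define X where "X = enn2real (Lp_energy p A (\<lambda>x. f x - c))"
    have X: "Lp_energy p A (\<lambda>x. f x - c) = ennreal X" "X \<ge> 0" using False by (auto simp: X_def less_top)
    have mp: "m > 0" using False m by auto
    have "(\<integral>x. indicator A x *\<^sub>R (f x - c) \<partial>lborel) = - (m *\<^sub>R c)"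
      unfolding scaleR_diff_right using f iA by (subst Bochner_Integration.integral_diff) (auto simp: m_def)
    then have "m * norm c = norm (\<integral>x. indicator A x *\<^sub>R (f x - c) \<partial>lborel)" using m by simp
    also have "\<dots> \<le> (\<integral>x. indicator A x * norm (f x - c) \<partial>lborel)"
      using integral_norm_bound[of lborel "\<lambda>x. indicator A x *\<^sub>R (f x - c)"] by simp
    finally have "(m * norm c) powr p \<le> (\<integral>x. indicator A x * norm (f x - c) \<partial>lborel) powr p"
      using p m by (intro powr_mono2) auto
    then have "ennreal ((m * norm c) powr p) \<le> ennreal ((\<integral>x. indicator A x * norm (f x - c) \<partial>lborel) powr p)"
      by (rule ennreal_leI)
    also have "\<dots>
        \<le> ennreal ((\<integral>x. indicator A x \<partial>lborel) powr (p - 1)) * (\<integral>\<^sup>+x. ennreal (indicator A x * norm (f x - c) powr p) \<partial>lborel)"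
      by (intro weighted_jensen iA p) auto
    also have "(\<integral>\<^sup>+x. ennreal (indicator A x * norm (f x - c) powr p) \<partial>lborel) = Lp_energy p A (\<lambda>x. f x - c)"
      unfolding Lp_energy_def by (intro nn_integral_cong) (auto simp: indicator_def)
    finally have "ennreal ((m * norm c) powr p) \<le> ennreal (m powr (p - 1) * X)"
      using X by (simp add: m_def ennreal_mult)
    then have "(m * norm c) powr p \<le> m powr (p - 1) * X" using X by (simp add: ennreal_le_iff)
    moreover have "(m * norm c) powr p = m powr (p - 1) * (m * norm c powr p)"
      using mp by (simp add: powr_mult powr_diff)
    ultimately have "norm c powr p * m \<le> X" using mp by (simp add: mult.commute)
    then show ?thesis using m X by (simp add: ennreal_mult[symmetric] ennreal_leI)
  qed
qed

theorem lemma3p5: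
  fixes lam p M :: real and U U' :: "(real^2) set"
  assumes "0 < lam" "lam < 1" and "p > 2"
    and "bounded_lipschitz_domain U" "bounded_lipschitz_domain U'" and "U' \<Subset> U"
    and "M > 0"
  shows "\<exists>C>0. \<exists>\<epsilon>\<^sub>0>0. \<forall>\<epsilon>. 0 < \<epsilon> \<and> \<epsilon> < \<epsilon>\<^sub>0 \<longrightarrow>
    (\<forall>u :: real^2 \<Rightarrow> real^2. \<forall>Du :: real^2 \<Rightarrow> real^2^2.
       u \<in> W1p p U \<and> has_weak_gradient U u Du \<and>
       (LINT x:U' \<inter> scaled_Y_stiff \<epsilon> lam|lebesgue. u x) = 0 \<and>
       Lp_norm p (U \<inter> scaled_Y_stiff \<epsilon> lam) u \<le> M * Lp_norm p (U' \<inter> scaled_Y_stiff \<epsilon> lam) u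
       \<longrightarrow> Lp_norm p (U' \<inter> scaled_Y_stiff \<epsilon> lam) u \<le> C * Lp_norm p (U \<inter> scaled_Y_stiff \<epsilon> lam) Du)"
proof -
  note lam = assms(1,2) and p = assms(3)
  have U: "bounded_domain U" "open U" and U': "open U'" "bounded U'"
    using assms(4,5) by (auto simp: bounded_lipschitz_domain_def bounded_domain_def)
  have K: "compact (closure U')" "closure U' \<subseteq> U" using assms(6) by (auto simp: compactly_contained_def)
  have "stiff_poincare_on p lam U TYPE(2) (closure U')"
    by (rule stiff_poincare_on_compact[OF lam p U(1) K])
  then obtain F0 C0 \<epsilon>0 where F0: "compact F0" "F0 \<subseteq> U" and C0: "C0 \<ge> 0" and \<epsilon>0: "\<epsilon>0 > 0"
    and P: "\<And>\<epsilon> (v::real^2 \<Rightarrow> real^2) D. 0 < \<epsilon> \<Longrightarrow> \<epsilon> < \<epsilon>0 \<Longrightarrow> has_C1_gradient v D \<Longrightarrow>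
        \<exists>c. Lp_energy p (closure U' \<inter> scaled_Y_stiff \<epsilon> lam) (\<lambda>x. v x - c)
            \<le> ennreal C0 * Lp_energy p (F0 \<inter> scaled_Y_stiff \<epsilon> lam) D"
    unfolding stiff_poincare_on_def by auto
  define F where "F = F0 \<union> closure U'"
  have F: "compact F" "F \<subseteq> U" using F0 K by (auto simp: F_def)
  define q :: real where "q = 2 powr (p - 1)"
  have q: "q > 0" by (simp add: q_def)
  define C1 where "C1 = 2 * q * q * (q * C0)"
  define C where "C = (C1 + 1) powr (1 / p)"
  have C1: "C1 \<ge> 0" using q C0 by (simp add: C1_def)
  have Cpos: "C > 0" using C1 by (simp add: C_def)
  have main: "Lp_norm p (U' \<inter> scaled_Y_stiff \<epsilon> lam) u \<le> C * Lp_norm p (U \<inter> scaled_Y_stiff \<epsilon> lam) Du"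
    if \<epsilon>: "0 < \<epsilon>" "\<epsilon> < \<epsilon>0" and u: "u \<in> W1p p U" and Du: "has_weak_gradient U u Du"
      and mean: "(LINT x:U' \<inter> scaled_Y_stiff \<epsilon> lam|lebesgue. u x) = 0"
    for \<epsilon> and u :: "real^2 \<Rightarrow> real^2" and Du :: "real^2 \<Rightarrow> real^2^2"
  proof -
    obtain G where uL: "u \<in> Lp_space p U" and GL: "G \<in> Lp_space p U" and G: "has_weak_gradient U u G"
      using u by (auto simp: W1p_def)
    let ?Y = "scaled_Y_stiff \<epsilon> lam"
    let ?A = "U' \<inter> ?Y"
    have [measurable]: "?Y \<in> sets borel" "U \<in> sets borel" "U' \<in> sets borel" "F0 \<in> sets borel"
      using scaled_Y_stiff_borel[OF lam \<epsilon>(1)] U U' F0 by (auto intro: borel_compact)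
    have Am: "?A \<in> sets borel" by measurable
    have um: "set_borel_measurable lebesgue U u" and Dm: "set_borel_measurable lebesgue U Du"
      using Du locally_integrable_measurable[OF U(2)] by (auto simp: has_weak_gradient_def)
    obtain f where f: "f \<in> borel_measurable borel" "AE x in lborel. x \<in> U \<longrightarrow> f x = u x"
      using borel_representative_on[OF um] by blast
    obtain g where g: "g \<in> borel_measurable borel" "AE x in lborel. x \<in> U \<longrightarrow> g x = Du x"
      using borel_representative_on[OF Dm] by blast
    \<comment> \<open>The given weak gradient is not known to be \<open>p\<close>-integrable, but it agrees almost everywhere with
      the one provided by the Sobolev space.\<close>
    have gG: "AE x in lborel. x \<in> U \<longrightarrow> g x = G x"
      using g(2) weak_gradient_unique[OF U(2) G Du] by eventually_elim auto
    note [measurable] = f(1) g(1)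
    have ffin: "Lp_energy p U f < \<infinity>" and gfin: "Lp_energy p U g < \<infinity>"
      using Lp_space_energy_finite[OF uL _ f] Lp_space_energy_finite[OF GL _ g(1) gG] by auto
    have sub: "?A \<subseteq> F" "?A \<subseteq> U" "F0 \<subseteq> F" "?A \<subseteq> closure U' \<inter> ?Y"
      using K closure_subset[of U'] by (auto simp: F_def)
    have AK: "set_integrable lebesgue (closure U') u"
      using Du K by (auto simp: has_weak_gradient_def locally_integrable_def)
    have "?A \<in> sets lebesgue" using Am by (simp add: sets_completionI_sets)
    then have uA: "set_integrable lebesgue ?A u"
      by (rule set_integrable_subset[OF AK]) (use closure_subset[of U'] in auto)
    have fA: "AE x in lborel. x \<in> ?A \<longrightarrow> f x = u x" using f(2) sub(2) by (auto elim: eventually_mono)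
    have iA: "integrable lborel (\<lambda>x. indicator ?A x *\<^sub>R f x)"
      by (rule integrable_representative[OF uA Am f(1) fA])
    have "(\<integral>x. indicator ?A x *\<^sub>R f x \<partial>lborel) = (\<integral>x. indicator ?A x *\<^sub>R f x \<partial>lebesgue)"
      by (rule integral_completion[symmetric]) measurable
    also have "\<dots> = (\<integral>x. indicator ?A x *\<^sub>R u x \<partial>lebesgue)"
    proof (rule integral_cong_AE)
      show "(\<lambda>x. indicator ?A x *\<^sub>R f x) \<in> borel_measurable lebesgue" by (rule measurable_completion) measurable
      show "(\<lambda>x. indicator ?A x *\<^sub>R u x) \<in> borel_measurable lebesgue"
        using uA unfolding set_integrable_def by (rule borel_measurable_integrable)
      show "AE x in lebesgue. indicator ?A x *\<^sub>R f x = indicator ?A x *\<^sub>R u x"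
        using AE_completion[OF fA] by eventually_elim (auto simp: indicator_def)
    qed
    finally have m0: "(\<integral>x. indicator ?A x *\<^sub>R f x \<partial>lborel) = 0"
      using mean by (simp add: set_lebesgue_integral_def)
    have Afin: "emeasure lborel ?A < \<infinity>"
      using emeasure_bounded_finite[OF bounded_subset[OF U'(2), of ?A]] by auto
    have const: "Lp_energy p ?A f \<le> ennreal (2 * q) * Lp_energy p ?A (\<lambda>x. f x - c)" for c
    proof -
      have "Lp_energy p ?A (\<lambda>x. (f x - c) + c) \<le> ennreal q * (Lp_energy p ?A (\<lambda>x. f x - c) + Lp_energy p ?A (\<lambda>x. c))"
        unfolding q_def using p by (intro Lp_energy_add_le) auto
      also have "Lp_energy p ?A (\<lambda>x. c) = ennreal (norm c powr p) * emeasure lborel ?A"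
        by (rule Lp_energy_const[OF Am])
      also have "ennreal q * (Lp_energy p ?A (\<lambda>x. f x - c) + \<dots>)
          \<le> ennreal q * (Lp_energy p ?A (\<lambda>x. f x - c) + Lp_energy p ?A (\<lambda>x. f x - c))"
        using p by (intro mult_left_mono add_left_mono mean_zero_const_le Am Afin iA m0 f) auto
      also have "\<dots> = ennreal (2 * q) * Lp_energy p ?A (\<lambda>x. f x - c)"
        using q by (simp add: ennreal_mult mult_2[symmetric] mult_ac)
      finally show ?thesis by simp
    qed
    have est: "Lp_energy p ?A f \<le> ennreal C1 * Lp_energy p (F0 \<inter> ?Y) g + ennreal e" if e: "e > 0" for e
    proof -
      \<comment> \<open>Chosen so that the accumulated approximation errors sum to exactly \<open>e\<close>.\<close>
      define r where "r = e / (2 * q * q * (1 + C0 * q))"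
      have r: "r > 0" unfolding r_def using e q C0 by (intro divide_pos_pos mult_pos_pos add_pos_nonneg) auto
      obtain v D where v: "has_C1_gradient v D" "Lp_energy p F (\<lambda>x. v x - f x)
          \<le> ennreal r" "Lp_energy p F (\<lambda>x. D x - g x) \<le> ennreal r"
        using smooth_approximation[OF U(2) _ G F f ffin g(1) gG gfin r] p by auto
      note [measurable] = has_C1_gradient_measurable[OF v(1)]
      obtain c where c: "Lp_energy p (closure U' \<inter> ?Y) (\<lambda>x. v x - c) \<le> ennreal C0 * Lp_energy p (F0 \<inter> ?Y) D"
        using P[OF \<epsilon> v(1)] by auto
      let ?E = "Lp_energy p (F0 \<inter> ?Y) g"
      have "Lp_energy p (F0 \<inter> ?Y) (\<lambda>x. (D x - g x) + g x) \<le> ennreal q * (Lp_energy p (F0 \<inter> ?Y) (\<lambda>x. D x - g x) + ?E)"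
        unfolding q_def using p by (intro Lp_energy_add_le) auto
      also have "\<dots> \<le> ennreal q * (ennreal r + ?E)"
        using sub by (intro mult_left_mono add_right_mono order_trans[OF Lp_energy_mono v(3)]) auto
      finally have DE: "Lp_energy p (F0 \<inter> ?Y) D \<le> ennreal q * (ennreal r + ?E)" by simp
      have "Lp_energy p ?A (\<lambda>x. v x - c) \<le> ennreal C0 * Lp_energy p (F0 \<inter> ?Y) D"
        by (rule order_trans[OF Lp_energy_mono[OF sub(4)] c])
      also have "\<dots> \<le> ennreal C0 * (ennreal q * (ennreal r + ?E))"
        by (intro mult_left_mono DE) auto
      finally have vc: "Lp_energy p ?A (\<lambda>x. v x - c) \<le> ennreal C0 * (ennreal q * (ennreal r + ?E))" .
      have fv: "Lp_energy p ?A (\<lambda>x. f x - v x) \<le> ennreal r"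
      proof -
        have "Lp_energy p ?A (\<lambda>x. f x - v x) = Lp_energy p ?A (\<lambda>x. v x - f x)"
          unfolding Lp_energy_def by (simp only: norm_minus_commute)
        also have "\<dots> \<le> ennreal r" by (rule order_trans[OF Lp_energy_mono[OF sub(1)] v(2)])
        finally show ?thesis .
      qed
      have "Lp_energy p ?A (\<lambda>x. (f x - v x) + (v x - c))
          \<le> ennreal q * (Lp_energy p ?A (\<lambda>x. f x - v x) + Lp_energy p ?A (\<lambda>x. v x - c))"
        unfolding q_def using p by (intro Lp_energy_add_le) auto
      also have "\<dots> \<le> ennreal q * (ennreal r + ennreal C0 * (ennreal q * (ennreal r + ?E)))"
        by (intro mult_left_mono add_mono fv vc) auto
      finally have fc: "Lp_energy p ?A (\<lambda>x. f x - c) \<le> ennreal q * (ennreal r + ennreal C0 * (ennreal q * (ennreal r + ?E)))"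
        by simp
      have "Lp_energy p ?A f \<le> ennreal (2 * q) * (ennreal q * (ennreal r + ennreal C0 * (ennreal q * (ennreal r + ?E))))"
        by (rule order_trans[OF const mult_left_mono[OF fc]]) auto
      also have "\<dots> = ennreal (2 * q * q * (q * C0)) * ?E + ennreal (2 * q * q * (1 + C0 * q) * r)"
        using q C0 r by (simp add: ennreal_mult ennreal_plus algebra_simps)
      also have "2 * q * q * (1 + C0 * q) * r = e"
      proof -
        have "1 + C0 * q > 0" using q C0 by (intro add_pos_nonneg) auto
        then show ?thesis using q unfolding r_def by simp
      qed
      finally show ?thesis by (simp add: C1_def)
    qed
    then have "Lp_energy p ?A f \<le> ennreal C1 * Lp_energy p (F0 \<inter> ?Y) g" by (rule ennreal_le_epsilon)
    also have "\<dots> \<le> ennreal (C1 + 1) * Lp_energy p (U \<inter> ?Y) g"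
      using F0 C1 by (intro Lp_energy_mult_mono) auto
    finally have E: "Lp_energy p ?A f \<le> ennreal (C1 + 1) * Lp_energy p (U \<inter> ?Y) g" .
    have fin: "Lp_energy p (U \<inter> ?Y) g < \<infinity>"
      by (rule le_less_trans[OF Lp_energy_mono gfin]) auto
    have "enn2real (Lp_energy p ?A f) \<le> enn2real (ennreal (C1 + 1) * Lp_energy p (U \<inter> ?Y) g)"
      using E fin by (intro enn2real_mono) (auto simp: ennreal_mult_less_top)
    also have "\<dots> = (C1 + 1) * enn2real (Lp_energy p (U \<inter> ?Y) g)"
      using C1 by (simp add: enn2real_mult)
    finally have "enn2real (Lp_energy p ?A f) powr (1 / p) \<le> ((C1 + 1) * enn2real (Lp_energy p (U \<inter> ?Y) g)) powr (1 / p)"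
      using p by (intro powr_mono2) auto
    also have "\<dots> = C * enn2real (Lp_energy p (U \<inter> ?Y) g) powr (1 / p)"
      using C1 by (simp add: C_def powr_mult)
    finally show ?thesis
      using Lp_norm_eq_Lp_energy[OF um Am sub(2) f, of p] Lp_norm_eq_Lp_energy[OF Dm _ _ g, of "U \<inter> ?Y" p] by simp
  qed
  show ?thesis
    using Cpos \<epsilon>0 main by blast
qed

end
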